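(* Let $(R,\mathfrak m)$ be a commutative Noetherian local ring and let $M$ be a nonzero finitely generated $R$-module of dimension $d$. Let $D_0\subset D_1\subset\cdots\subset D_t=M$ be the dimension filtration of $M$, let $d_i=\dim D_i$, and set $\mathcal D_0=D_0$ and $\mathcal D_i=D_i/D_{i-1}$ for $i=1,\ldots,t$. The following statements are equivalent: (i) $M$ is a sequentially Cohen-Macaulay module. (ii) For every good parameter ideal $\mathfrak q$ of $M$, $$\ell(M/\mathfrak q^{n+1}M)=\sum_{i=0}^t\binom{n+d_i}{d_i}\ell(\mathcal D_i/\mathfrak q\mathcal D_i)\quad\text{for all } n\geqslant0.$$ (iii) There exists a good parameter ideal $\mathfrak q$ of $M$ such that $$\ell(M/\mathfrak q^{n+1}M)=\sum_{i=0}^t\binom{n+d_i}{d_i}\ell(\mathcal D_i/\mathfrak q\mathcal D_i)\quad\text{for all } n\geqslant0.$$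
   Context: $\ell$ denotes length of an $R$-module. Dimension filtration: the (unique) filtration $H^0_{\mathfrak m}(M)=D_0\subset D_1\subset\cdots\subset D_t=M$ of submodules of $M$ such that $D_{i-1}$ is the largest submodule of $D_i$ with $\dim D_{i-1}<\dim D_i$ for all $i=t,t-1,\ldots,1$. Put $d_i=\dim D_i$, with the convention $d_0=0$ also when $D_0=0$. Here $H^0_{\mathfrak m}(M)$ is the $0$th local cohomology module, i.e. the largest submodule of $M$ of finite length. $M$ is called sequentially Cohen-Macaulay if $D_i/D_{i-1}$ is Cohen-Macaulay for all $i=1,\ldots,t$. A system of parameters $x_1,\ldots,x_d$ of $M$ is called good if $D_i\cap(x_{d_i+1},\ldots,x_d)M=0$ for all $i=0,\ldots,t-1$. A good parameter ideal of $M$ is an ideal $\mathfrak q=(x_1,\ldots,x_d)$ of $R$ generated by a good system of parameters of $M$. *)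

theory Defs
  imports "HOL-Algebra.QuotRing" "HOL-Algebra.Ideal_Product" "HOL-Algebra.Ring_Divisibility"
    "HOL-Algebra.Module" "HOL-Library.Extended_Nat"
begin

text \<open>
  A submodule \<open>N\<close> of \<open>M\<close> is a set with \<open>submodule N R M\<close>; regarded as a module in its own right
  it is \<open>M\<lparr>carrier := N\<rparr>\<close>.
\<close>

locale noetherian_local_ring = cring R + noetherian_ring R for R (structure) and \<mm> +
  assumes maximal: "maximalideal \<mm> R"
    and unique_maximal: "maximalideal J R \<Longrightarrow> J = \<mm>"


section \<open>Submodules, quotients and length\<close>

definition span_module :: "('a, 'r) ring_scheme \<Rightarrow> ('a, 'b, 'm) module_scheme \<Rightarrow> 'b set \<Rightarrow> 'b set"
  where "span_module R M S = \<Inter>{N. submodule N R M \<and> S \<subseteq> N}"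

definition fg_module :: "('a, 'r) ring_scheme \<Rightarrow> ('a, 'b, 'm) module_scheme \<Rightarrow> bool"
  where "fg_module R M \<longleftrightarrow>
    module R M \<and> (\<exists>S \<subseteq> carrier M. finite S \<and> span_module R M S = carrier M)"

definition nonzero_module :: "('a, 'b, 'm) module_scheme \<Rightarrow> bool"
  where "nonzero_module M \<longleftrightarrow> carrier M \<noteq> {\<zero>\<^bsub>M\<^esub>}"

definition ideal_smult ::
    "('a, 'r) ring_scheme \<Rightarrow> 'a set \<Rightarrow> ('a, 'b, 'm) module_scheme \<Rightarrow> 'b set"
  where "ideal_smult R I M = span_module R M {a \<odot>\<^bsub>M\<^esub> x | a x. a \<in> I \<and> x \<in> carrier M}"

text \<open>
  The record type of modules extends that of rings; its fields \<^const>\<open>monoid.mult\<close> and \<^const>\<open>monoid.one\<close> play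
  no role for modules and are left unspecified.
\<close>

definition quotient_module :: "('a, 'b, 'm) module_scheme \<Rightarrow> 'b set \<Rightarrow> ('a, 'b set) module"
  where "quotient_module M N =
    \<lparr>carrier = a_rcosets\<^bsub>M\<^esub> N, monoid.mult = undefined, one = undefined, zero = N, add = set_add M,
     smult = (\<lambda>a X. \<Union>x\<in>X. N +>\<^bsub>M\<^esub> (a \<odot>\<^bsub>M\<^esub> x))\<rparr>"

lemma quotient_module_smult:
  assumes "module R M" "submodule N R M" "a \<in> carrier R" "x \<in> carrier M"
  shows "a \<odot>\<^bsub>quotient_module M N\<^esub> (N +>\<^bsub>M\<^esub> x) = N +>\<^bsub>M\<^esub> (a \<odot>\<^bsub>M\<^esub> x)"
proof -
  interpret module R M by fact
  interpret N: submodule N R M by fact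
  have sub: "additive_subgroup N M" by (simp add: additive_subgroup.intro N.subgroup_axioms)
  interpret A: abelian_subgroup N M
    by (rule abelian_subgroupI3[OF sub M.abelian_group_axioms])
  have eq: "N +>\<^bsub>M\<^esub> (a \<odot>\<^bsub>M\<^esub> y) = N +>\<^bsub>M\<^esub> (a \<odot>\<^bsub>M\<^esub> x)" if yy: "y \<in> N +>\<^bsub>M\<^esub> x" for y
  proof -
    obtain h where h: "h \<in> N" "y = h \<oplus>\<^bsub>M\<^esub> x"
      using yy by (auto simp: a_r_coset_defs)
    then have "a \<odot>\<^bsub>M\<^esub> y = a \<odot>\<^bsub>M\<^esub> h \<oplus>\<^bsub>M\<^esub> a \<odot>\<^bsub>M\<^esub> x"
      using assms A.a_Hcarr by (simp add: smult_r_distr)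
    moreover have "a \<odot>\<^bsub>M\<^esub> h \<in> N" using h assms by simp
    ultimately have "a \<odot>\<^bsub>M\<^esub> y \<in> N +>\<^bsub>M\<^esub> (a \<odot>\<^bsub>M\<^esub> x)"
      by (auto simp: a_r_coset_defs)
    then show ?thesis
      using M.a_repr_independence[OF _ smult_closed[OF assms(3,4)] N.subgroup_axioms] by blast
  qed
  have "x \<in> N +>\<^bsub>M\<^esub> x" using assms A.a_rcos_self by blast
  then have "(\<Union>y\<in>N +>\<^bsub>M\<^esub> x. N +>\<^bsub>M\<^esub> (a \<odot>\<^bsub>M\<^esub> y)) = N +>\<^bsub>M\<^esub> (a \<odot>\<^bsub>M\<^esub> x)"
    using SUP_eq_const[of "N +>\<^bsub>M\<^esub> x" "\<lambda>y. N +>\<^bsub>M\<^esub> (a \<odot>\<^bsub>M\<^esub> y)"] eq by blast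
  then show ?thesis by (simp add: quotient_module_def)
qed

lemma quotient_module_is_module:
  assumes "module R M" "submodule N R M"
  shows "module R (quotient_module M N)"
proof -
  interpret module R M by fact
  interpret N: submodule N R M by fact
  have sub: "additive_subgroup N M" by (simp add: additive_subgroup.intro N.subgroup_axioms)
  interpret A: abelian_subgroup N M
    by (rule abelian_subgroupI3[OF sub M.abelian_group_axioms])
  let ?Q = "quotient_module M N"
  note sm = quotient_module_smult[OF assms]
  have car: "X \<in> carrier ?Q \<longleftrightarrow> (\<exists>x \<in> carrier M. X = N +>\<^bsub>M\<^esub> x)" for X
    by (auto simp: quotient_module_def A_RCOSETS_def RCOSETS_def a_r_coset_def)
  have add: "(N +>\<^bsub>M\<^esub> x) \<oplus>\<^bsub>?Q\<^esub> (N +>\<^bsub>M\<^esub> y) = N +>\<^bsub>M\<^esub> (x \<oplus>\<^bsub>M\<^esub> y)"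
    if "x \<in> carrier M" "y \<in> carrier M" for x y
    using that A.a_rcos_sum by (simp add: quotient_module_def)
  have zero: "\<zero>\<^bsub>?Q\<^esub> = N +>\<^bsub>M\<^esub> \<zero>\<^bsub>M\<^esub>"
    using A.a_rcos_const[of "\<zero>\<^bsub>M\<^esub>"] by (simp add: quotient_module_def)
  have "abelian_group ?Q"
  proof (intro abelian_groupI)
    fix X assume "X \<in> carrier ?Q"
    then obtain x where x: "x \<in> carrier M" "X = N +>\<^bsub>M\<^esub> x" by (auto simp: car)
    have "(N +>\<^bsub>M\<^esub> (\<ominus>\<^bsub>M\<^esub> x)) \<oplus>\<^bsub>?Q\<^esub> X = \<zero>\<^bsub>?Q\<^esub>"
      using x by (simp add: add zero M.l_neg)
    moreover have "N +>\<^bsub>M\<^esub> (\<ominus>\<^bsub>M\<^esub> x) \<in> carrier ?Q" unfolding car using x by blast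
    ultimately show "\<exists>Y \<in> carrier ?Q. Y \<oplus>\<^bsub>?Q\<^esub> X = \<zero>\<^bsub>?Q\<^esub>" by blast
  next
    show "\<zero>\<^bsub>?Q\<^esub> \<in> carrier ?Q" unfolding car zero by blast
  next
    fix X Y assume "X \<in> carrier ?Q" "Y \<in> carrier ?Q"
    then show "X \<oplus>\<^bsub>?Q\<^esub> Y \<in> carrier ?Q" unfolding car using add by (metis M.a_closed)
  qed (auto simp: car add zero M.a_ac)
  then show ?thesis
    
  proof (intro moduleI)
    fix a X assume "a \<in> carrier R" "X \<in> carrier ?Q"
    then show "a \<odot>\<^bsub>?Q\<^esub> X \<in> carrier ?Q" unfolding car using sm smult_closed by metis
  qed (auto simp: car sm add smult_l_distr smult_r_distr smult_assoc1 R.is_cring)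
qed

definition module_length :: "('a, 'r) ring_scheme \<Rightarrow> ('a, 'b, 'm) module_scheme \<Rightarrow> enat"
  where "module_length R M =
    Sup {enat n | n. \<exists>N :: nat \<Rightarrow> 'b set.
      (\<forall>i\<le>n. submodule (N i) R M) \<and> (\<forall>i<n. N i \<subset> N (Suc i))}"


section \<open>Dimension, depth and Cohen-Macaulay modules\<close>

definition krull_dim :: "('a, 'r) ring_scheme \<Rightarrow> enat"
  where "krull_dim R =
    Sup {enat n | n. \<exists>P :: nat \<Rightarrow> 'a set.
      (\<forall>i\<le>n. primeideal (P i) R) \<and> (\<forall>i<n. P i \<subset> P (Suc i))}"

definition annihilator :: "('a, 'r) ring_scheme \<Rightarrow> ('a, 'b, 'm) module_scheme \<Rightarrow> 'a set"
  where "annihilator R M = {a \<in> carrier R. \<forall>x \<in> carrier M. a \<odot>\<^bsub>M\<^esub> x = \<zero>\<^bsub>M\<^esub>}"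

text \<open>
  Since \<^term>\<open>Sup {} = (0 :: enat)\<close>, the zero module gets dimension 0. This is the convention
  \<open>d\<^sub>0 = 0\<close> for \<open>D\<^sub>0 = 0\<close> below, and it does not affect the dimension filtration:
  its step condition can only hold with \<open>dim D\<^sub>i > 0\<close>, where the zero submodule has smaller
  dimension under any convention, and with dimension \<open>-\<infinity>\<close> for the zero module a step from
  \<open>dim D\<^sub>i = 0\<close> would lead below \<open>H\<^sup>0\<^sub>\<mm>(M)\<close>.
\<close>

definition module_dim :: "('a, 'r) ring_scheme \<Rightarrow> ('a, 'b, 'm) module_scheme \<Rightarrow> enat"
  where "module_dim R M = krull_dim (R Quot (annihilator R M))"

definition regular_sequence ::
    "('a, 'r) ring_scheme \<Rightarrow> ('a, 'b, 'm) module_scheme \<Rightarrow> 'a list \<Rightarrow> bool"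
  where "regular_sequence R M xs \<longleftrightarrow> set xs \<subseteq> carrier R \<and>
    (\<forall>i < length xs.
      let Q = quotient_module M (ideal_smult R (Idl\<^bsub>R\<^esub> (set (take i xs))) M)
      in \<forall>y \<in> carrier Q. (xs ! i) \<odot>\<^bsub>Q\<^esub> y = \<zero>\<^bsub>Q\<^esub> \<longrightarrow> y = \<zero>\<^bsub>Q\<^esub>) \<and>
    nonzero_module (quotient_module M (ideal_smult R (Idl\<^bsub>R\<^esub> (set xs)) M))"

definition depth :: "('a, 'r) ring_scheme \<Rightarrow> 'a set \<Rightarrow> ('a, 'b, 'm) module_scheme \<Rightarrow> enat"
  where "depth R \<mm> M = Sup {enat (length xs) | xs. set xs \<subseteq> \<mm> \<and> regular_sequence R M xs}"

definition cohen_macaulay ::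
    "('a, 'r) ring_scheme \<Rightarrow> 'a set \<Rightarrow> ('a, 'b, 'm) module_scheme \<Rightarrow> bool"
  where "cohen_macaulay R \<mm> M \<longleftrightarrow> fg_module R M \<and> depth R \<mm> M = module_dim R M"


section \<open>The dimension filtration\<close>

definition is_largest :: "('b set \<Rightarrow> bool) \<Rightarrow> 'b set \<Rightarrow> bool"
  where "is_largest P N \<longleftrightarrow> P N \<and> (\<forall>N'. P N' \<longrightarrow> N' \<subseteq> N)"

text \<open>
  \<open>D 0 \<subset> \<dots> \<subset> D t\<close> is the dimension filtration; the values \<open>D i\<close> for \<open>i > t\<close> are irrelevant.
  The first condition says \<open>D 0 = H\<^sup>0\<^sub>\<mm>(M)\<close>, the largest submodule of finite length. Strictness of
  the inclusions follows from the dimensions being strictly increasing.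
\<close>

definition dimension_filtration ::
    "('a, 'r) ring_scheme \<Rightarrow> ('a, 'b, 'm) module_scheme \<Rightarrow> nat \<Rightarrow> (nat \<Rightarrow> 'b set) \<Rightarrow> bool"
  where "dimension_filtration R M t D \<longleftrightarrow>
    is_largest (\<lambda>N. submodule N R M \<and> module_length R (M\<lparr>carrier := N\<rparr>) < \<infinity>) (D 0) \<and>
    D t = carrier M \<and>
    (\<forall>i \<in> {1..t}.
      is_largest
        (\<lambda>N. submodule N R (M\<lparr>carrier := D i\<rparr>) \<and>
             module_dim R (M\<lparr>carrier := N\<rparr>) < module_dim R (M\<lparr>carrier := D i\<rparr>))
        (D (i - 1)))"

definition filtration_dim ::
    "('a, 'r) ring_scheme \<Rightarrow> ('a, 'b, 'm) module_scheme \<Rightarrow> (nat \<Rightarrow> 'b set) \<Rightarrow> nat \<Rightarrow> nat"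
  where "filtration_dim R M D i = the_enat (module_dim R (M\<lparr>carrier := D i\<rparr>))"

definition filtration_quotient ::
    "('a, 'b, 'm) module_scheme \<Rightarrow> (nat \<Rightarrow> 'b set) \<Rightarrow> nat \<Rightarrow> ('a, 'b set) module"
  where "filtration_quotient M D i = quotient_module (M\<lparr>carrier := D i\<rparr>) (D (i - 1))"

text \<open>
  A finitely generated module over a Noetherian local ring has exactly one dimension filtration
  (\<open>t\<close> and \<open>D 0, \<dots>, D t\<close> are determined), so quantifying over it existentially or universally
  makes no difference, here and in the definition of good systems of parameters.
\<close>

definition sequentially_cohen_macaulay ::
    "('a, 'r) ring_scheme \<Rightarrow> 'a set \<Rightarrow> ('a, 'b, 'm) module_scheme \<Rightarrow> bool"
  where "sequentially_cohen_macaulay R \<mm> M \<longleftrightarrow>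
    (\<exists>t D. dimension_filtration R M t D \<and>
      (\<forall>i \<in> {1..t}. cohen_macaulay R \<mm> (filtration_quotient M D i)))"

text \<open>
  The length of \<open>\<D>\<^sub>i / \<qq>\<D>\<^sub>i\<close>, where \<open>\<D>\<^sub>0 = D\<^sub>0\<close> and \<open>\<D>\<^sub>i = D\<^sub>i / D\<^bsub>i-1\<^esub>\<close> for \<open>i \<ge> 1\<close>; the case
  distinction is made here because the two kinds of modules have different types.
\<close>

definition filtration_quotient_length ::
    "('a, 'r) ring_scheme \<Rightarrow> ('a, 'b, 'm) module_scheme \<Rightarrow> (nat \<Rightarrow> 'b set) \<Rightarrow> 'a set \<Rightarrow> nat \<Rightarrow> enat"
  where "filtration_quotient_length R M D \<qq> i =
    (if i = 0 then
       module_length R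
         (quotient_module (M\<lparr>carrier := D 0\<rparr>) (ideal_smult R \<qq> (M\<lparr>carrier := D 0\<rparr>)))
     else
       module_length R
         (quotient_module (filtration_quotient M D i)
            (ideal_smult R \<qq> (filtration_quotient M D i))))"


section \<open>Good parameter ideals\<close>

definition system_of_parameters ::
    "('a, 'r) ring_scheme \<Rightarrow> 'a set \<Rightarrow> ('a, 'b, 'm) module_scheme \<Rightarrow> 'a list \<Rightarrow> bool"
  where "system_of_parameters R \<mm> M xs \<longleftrightarrow>
    set xs \<subseteq> \<mm> \<and> enat (length xs) = module_dim R M \<and>
    module_length R (quotient_module M (ideal_smult R (Idl\<^bsub>R\<^esub> (set xs)) M)) < \<infinity>"

text \<open>For \<open>xs = [x\<^sub>1, \<dots>, x\<^sub>d]\<close>, \<open>drop k xs\<close> is \<open>[x\<^bsub>k+1\<^esub>, \<dots>, x\<^sub>d]\<close>.\<close>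

definition good_system_of_parameters ::
    "('a, 'r) ring_scheme \<Rightarrow> 'a set \<Rightarrow> ('a, 'b, 'm) module_scheme \<Rightarrow> 'a list \<Rightarrow> bool"
  where "good_system_of_parameters R \<mm> M xs \<longleftrightarrow> system_of_parameters R \<mm> M xs \<and>
    (\<exists>t D. dimension_filtration R M t D \<and>
      (\<forall>i<t. D i \<inter> ideal_smult R (Idl\<^bsub>R\<^esub> (set (drop (filtration_dim R M D i) xs))) M
              = {\<zero>\<^bsub>M\<^esub>}))"

definition good_parameter_ideal ::
    "('a, 'r) ring_scheme \<Rightarrow> 'a set \<Rightarrow> ('a, 'b, 'm) module_scheme \<Rightarrow> 'a set \<Rightarrow> bool"
  where "good_parameter_ideal R \<mm> M \<qq> \<longleftrightarrow>
    (\<exists>xs. good_system_of_parameters R \<mm> M xs \<and> \<qq> = Idl\<^bsub>R\<^esub> (set xs))"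

end

theory Submission
  imports Defs
begin

text \<open>
  Write \<open>\<D>\<^sub>i = D\<^sub>i / D\<^sub>i\<^sub>-\<^sub>1\<close> and let \<open>\<qq> = (x\<^sub>1, \<dots>, x\<^sub>d)\<close> be a good parameter ideal. It acts on \<open>D\<^sub>i\<close> through its first \<open>d\<^sub>i\<close>
  generators. Multiplication by \<open>x\<^sub>1\<close> and induction along Pascal's rule bound the length of \<open>N / \<qq>\<^sup>n\<^sup>+\<^sup>1 N\<close> by
  \<open>(n + d choose d)\<close> times the length of \<open>N / \<qq> N\<close>, with equality for all \<open>n\<close> iff the \<open>d\<close> generators form a regular
  sequence on \<open>N\<close>; Krull's intersection theorem gives the only-if part. Applied to all \<open>\<D>\<^sub>i\<close> this yields
  the inequality \<open>\<le>\<close> in the formula, with equality for all \<open>n\<close> iff \<open>x\<^sub>1, \<dots>, x\<^bsub>d\<^sub>i\<^esub>\<close> is regular on every \<open>\<D>\<^sub>i\<close>: regularity on \<open>\<D>\<^sub>i\<close> implies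
  \<open>\<qq>\<^sup>n D\<^sub>i \<inter> D\<^sub>i\<^sub>-\<^sub>1 = \<qq>\<^sup>n D\<^sub>i\<^sub>-\<^sub>1\<close>, so that the lengths add up. Since \<open>x\<^sub>1, \<dots>, x\<^bsub>d\<^sub>i\<^esub>\<close> is a system of parameters of \<open>\<D>\<^sub>i\<close>,
  its regularity is equivalent to \<open>\<D>\<^sub>i\<close> being Cohen-Macaulay, whatever \<open>\<qq>\<close> is. Hence all three statements are
  equivalent as soon as one good parameter ideal exists.
\<close>

section \<open>Submodules, colon ideals and saturation\<close>

text \<open>Three obstacles shape the development. A quotient of a quotient changes the element
  type, so an induction that passes from N/L to N/(L + xN) varies L inside one ambient module;
  quotient modules appear only when the result is translated back into the definitions. Associated
  graded modules are likewise replaced by explicit statements about colon submodules. Finally,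
  lengths are extended naturals, so that comparing two sums term by term requires every term to be
  finite; this is obtained from the fact that \<mm> is the only prime over Ann M and the parameters.

  For i < t the generators after the d_i-th annihilate D_i, because x D_i lies both in D_i and in
  (x_{d_i+1}, ..., x_d)M, which meet in 0; goodness enters the formula in no other way. The
  dimensions d_i are natural numbers only because R has finite dimension, which is why Krull's
  height theorem is developed from the principal ideal theorem.\<close>

text \<open>
  All arguments about a quotient \<open>N / L\<close> are carried out inside the ambient module with the pair
  \<open>L \<subseteq> N\<close>: \<open>colon R M L N\<close> is the annihilator of \<open>N / L\<close>. Localization at a prime \<open>P\<close> is replaced by
  passing to \<open>P\<close>-saturated submodules, so that \<open>sat_len R M P L N\<close> is the length of \<open>(N / L)\<^sub>P\<close> for
  saturated \<open>L\<close> and \<open>N\<close>. If \<open>P\<close> is the maximal ideal of a local ring, then all submodules are saturated.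
\<close>

definition colon :: "('a, 'r) ring_scheme \<Rightarrow> ('a, 'b, 'm) module_scheme \<Rightarrow> 'b set \<Rightarrow> 'b set \<Rightarrow> 'a set"
  where "colon R M L N = {a \<in> carrier R. \<forall>n\<in>N. a \<odot>\<^bsub>M\<^esub> n \<in> L}"

definition saturated :: "('a, 'r) ring_scheme \<Rightarrow> ('a, 'b, 'm) module_scheme \<Rightarrow> 'a set \<Rightarrow> 'b set \<Rightarrow> bool"
  where "saturated R M P L \<longleftrightarrow> (\<forall>s\<in>carrier R - P. \<forall>n\<in>carrier M. s \<odot>\<^bsub>M\<^esub> n \<in> L \<longrightarrow> n \<in> L)"

definition saturation :: "('a, 'r) ring_scheme \<Rightarrow> ('a, 'b, 'm) module_scheme \<Rightarrow> 'a set \<Rightarrow> 'b set \<Rightarrow> 'b set"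
  where "saturation R M P L = {n \<in> carrier M. \<exists>s\<in>carrier R - P. s \<odot>\<^bsub>M\<^esub> n \<in> L}"

definition sat_len :: "('a, 'r) ring_scheme \<Rightarrow> ('a, 'b, 'm) module_scheme \<Rightarrow> 'a set \<Rightarrow> 'b set \<Rightarrow> 'b set \<Rightarrow> enat"
  where "sat_len R M P L N = Sup {enat n | n. \<exists>C :: nat \<Rightarrow> 'b set.
     (\<forall>i\<le>n. submodule (C i) R M \<and> saturated R M P (C i) \<and> L \<subseteq> C i \<and> C i \<subseteq> N) \<and>
     (\<forall>i<n. C i \<subset> C (Suc i))}"

lemma (in cring) primeE:
  assumes "primeideal p R"
  shows "\<one> \<notin> p" "p \<subseteq> carrier R" "\<zero> \<in> p"
    "\<And>a b. a \<in> carrier R \<Longrightarrow> b \<in> carrier R \<Longrightarrow> a \<otimes> b \<in> p \<longleftrightarrow> a \<in> p \<or> b \<in> p"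
    "\<And>a b. a \<in> p \<Longrightarrow> b \<in> p \<Longrightarrow> a \<oplus> b \<in> p"
    "\<And>a b. a \<in> p \<Longrightarrow> b \<in> p \<Longrightarrow> a \<ominus> b \<in> p"
    "\<And>a. a \<in> p \<Longrightarrow> \<ominus> a \<in> p"
proof -
  interpret primeideal p R by fact
  show "\<one> \<notin> p" using I_notcarr one_imp_carrier by auto
  show sub: "p \<subseteq> carrier R" by (rule a_subset)
  show "\<zero> \<in> p" by simp
  show "a \<otimes> b \<in> p \<longleftrightarrow> a \<in> p \<or> b \<in> p" if "a \<in> carrier R" "b \<in> carrier R" for a b
    using that I_prime I_l_closed I_r_closed by blast
  show "a \<oplus> b \<in> p" if "a \<in> p" "b \<in> p" for a b using that by simp
  show neg: "\<ominus> a \<in> p" if "a \<in> p" for a using that by simp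
  show "a \<ominus> b \<in> p" if "a \<in> p" "b \<in> p" for a b
    using that neg by (simp add: a_minus_def)
qed

lemma (in cring) prime_pow:
  assumes "primeideal p R" "a \<in> carrier R" "a [^] (k::nat) \<in> p"
  shows "a \<in> p"
  using assms(3) by (induction k) (use assms primeE[OF assms(1)] in auto)

lemma (in cring) ideal_closed:
  assumes "ideal J R"
  shows "J \<subseteq> carrier R" "\<zero> \<in> J" "\<And>a b. a \<in> J \<Longrightarrow> b \<in> J \<Longrightarrow> a \<oplus> b \<in> J"
    "\<And>a b. a \<in> carrier R \<Longrightarrow> b \<in> J \<Longrightarrow> a \<otimes> b \<in> J"
    "\<And>a b. a \<in> carrier R \<Longrightarrow> b \<in> J \<Longrightarrow> b \<otimes> a \<in> J"
    "\<And>a. a \<in> J \<Longrightarrow> \<ominus> a \<in> J"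
proof -
  interpret ideal J R by fact
  show "J \<subseteq> carrier R" by (rule a_subset)
qed (use assms in \<open>auto simp: ideal.axioms additive_subgroup.zero_closed additive_subgroup.a_closed
      ideal.I_l_closed ideal.I_r_closed additive_subgroup.a_inv_closed\<close>)

lemma (in cring) cr_idealI:
  assumes "J \<subseteq> carrier R" "\<zero> \<in> J" "\<And>a b. a \<in> J \<Longrightarrow> b \<in> J \<Longrightarrow> a \<oplus> b \<in> J"
    "\<And>a b. a \<in> carrier R \<Longrightarrow> b \<in> J \<Longrightarrow> a \<otimes> b \<in> J"
  shows "ideal J R"
proof (rule idealI[OF ring_axioms])
  have "\<ominus> a \<in> J" if "a \<in> J" for a
    using assms(4)[of "\<ominus> \<one>" a] that assms(1) l_minus[of \<one> a] by auto
  then show "subgroup J (add_monoid R)"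
    using assms by (intro add.subgroupI) (auto simp: a_inv_def)
  show "x \<otimes> a \<in> J" if "a \<in> J" "x \<in> carrier R" for a x using assms(4) that by blast
  show "a \<otimes> x \<in> J" if "a \<in> J" "x \<in> carrier R" for a x
    using assms(1,4) that m_comm[of a x] by auto
qed

context module
begin

abbreviation sub :: "'c set \<Rightarrow> bool" where "sub N \<equiv> submodule N R M"
abbreviation madd (infixl "+\<^sub>M" 65) where "x +\<^sub>M y \<equiv> x \<oplus>\<^bsub>M\<^esub> y"
abbreviation mminus (infixl "-\<^sub>M" 65) where "x -\<^sub>M y \<equiv> x \<ominus>\<^bsub>M\<^esub> y"
abbreviation msmult (infixr "*\<^sub>M" 70) where "a *\<^sub>M x \<equiv> a \<odot>\<^bsub>M\<^esub> x"
abbreviation mzero ("0\<^sub>M") where "0\<^sub>M \<equiv> \<zero>\<^bsub>M\<^esub>"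
abbreviation ssum (infixl "+\<^sub>S" 65) where "N +\<^sub>S K \<equiv> N <+>\<^bsub>M\<^esub> K"
definition scale (infixr "*\<^sub>S" 70) where "a *\<^sub>S N = (\<lambda>n. a *\<^sub>M n) ` N"

lemma subD:
  assumes "sub N"
  shows "N \<subseteq> carrier M" "0\<^sub>M \<in> N" "\<And>x y. x \<in> N \<Longrightarrow> y \<in> N \<Longrightarrow> x +\<^sub>M y \<in> N"
    "\<And>x y. x \<in> N \<Longrightarrow> y \<in> N \<Longrightarrow> x -\<^sub>M y \<in> N" "\<And>a x. a \<in> carrier R \<Longrightarrow> x \<in> N \<Longrightarrow> a *\<^sub>M x \<in> N"
  using submoduleE[OF assms] subgroup.one_closed[OF submodule.axioms(1)[OF assms]]
  by (auto simp: a_minus_def)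

lemma sub_carr: "sub N \<Longrightarrow> x \<in> N \<Longrightarrow> x \<in> carrier M"
  using subD(1) by blast

lemma subI:
  assumes "N \<subseteq> carrier M" "0\<^sub>M \<in> N" "\<And>x y. x \<in> N \<Longrightarrow> y \<in> N \<Longrightarrow> x +\<^sub>M y \<in> N"
    "\<And>a x. a \<in> carrier R \<Longrightarrow> x \<in> N \<Longrightarrow> a *\<^sub>M x \<in> N"
  shows "sub N"
proof (rule submoduleI)
  show "\<ominus>\<^bsub>M\<^esub> x \<in> N" if "x \<in> N" for x
    using assms(4)[of "\<ominus> \<one>" x] that assms(1) smult_l_minus[of \<one> x] by auto
qed (use assms in auto)

lemma smult_minus:
  assumes "a \<in> carrier R" "x \<in> carrier M" "y \<in> carrier M"
  shows "a *\<^sub>M (x -\<^sub>M y) = a *\<^sub>M x -\<^sub>M a *\<^sub>M y"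
  using assms by (simp add: a_minus_def smult_r_distr smult_r_minus)

lemma smult_minus_l:
  assumes "a \<in> carrier R" "b \<in> carrier R" "y \<in> carrier M"
  shows "(a \<ominus> b) *\<^sub>M y = a *\<^sub>M y -\<^sub>M b *\<^sub>M y"
  using assms by (simp add: a_minus_def smult_l_distr smult_l_minus)

lemma smult_commute:
  assumes "a \<in> carrier R" "b \<in> carrier R" "y \<in> carrier M"
  shows "a *\<^sub>M b *\<^sub>M y = b *\<^sub>M a *\<^sub>M y"
  using assms by (metis m_comm smult_assoc1)

lemma madd_minus_cancel:
  assumes "x \<in> carrier M" "y \<in> carrier M"
  shows "x +\<^sub>M y -\<^sub>M x = y" "x +\<^sub>M y -\<^sub>M y = x" "x +\<^sub>M (y -\<^sub>M x) = y" "(y -\<^sub>M x) +\<^sub>M x = y"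
  using assms M.a_ac M.r_neg M.l_neg M.a_lcomm[of x y "\<ominus>\<^bsub>M\<^esub> x"]
  by (auto simp: a_minus_def M.a_assoc)

lemma sub_diff1: "sub N \<Longrightarrow> x \<in> N \<Longrightarrow> x +\<^sub>M y \<in> N \<Longrightarrow> y \<in> carrier M \<Longrightarrow> y \<in> N"
  using subD(4)[of N "x +\<^sub>M y" x] sub_carr[of N x] madd_minus_cancel(1)[of x y] by simp

lemma sub_diff2: "sub N \<Longrightarrow> x \<in> N \<Longrightarrow> y +\<^sub>M x \<in> N \<Longrightarrow> y \<in> carrier M \<Longrightarrow> y \<in> N"
  using sub_diff1[of N x y] sub_carr[of N x] M.a_comm[of x y] by simp

lemma sub_zero: "sub {0\<^sub>M}"
  by (rule subI) auto

lemma sub_Int: "sub N \<Longrightarrow> sub K \<Longrightarrow> sub (N \<inter> K)"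
  using subD[of N] subD[of K] by (intro subI) auto

lemma zero_le: "sub N \<Longrightarrow> {0\<^sub>M} \<subseteq> N"
  using subD(2) by auto

lemma ssum_iff: "x \<in> N +\<^sub>S K \<longleftrightarrow> (\<exists>n\<in>N. \<exists>k\<in>K. x = n +\<^sub>M k)"
  by (auto simp: set_add_def')

lemma sub_ssum:
  assumes "sub N" "sub K"
  shows "sub (N +\<^sub>S K)"
proof (rule subI)
  show "N +\<^sub>S K \<subseteq> carrier M" using assms sub_carr by (auto simp: ssum_iff)
  have "0\<^sub>M = 0\<^sub>M +\<^sub>M 0\<^sub>M" by simp
  then show "0\<^sub>M \<in> N +\<^sub>S K" unfolding ssum_iff using assms subD(2) by blast
next
  fix x y assume "x \<in> N +\<^sub>S K" "y \<in> N +\<^sub>S K"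
  then obtain n k n' k' where *: "n \<in> N" "k \<in> K" "x = n +\<^sub>M k" "n' \<in> N" "k' \<in> K" "y = n' +\<^sub>M k'"
    by (auto simp: ssum_iff)
  then have "x +\<^sub>M y = (n +\<^sub>M n') +\<^sub>M (k +\<^sub>M k')"
    using assms sub_carr by (simp add: M.a_ac)
  then show "x +\<^sub>M y \<in> N +\<^sub>S K" unfolding ssum_iff using * assms subD(3) by blast
next
  fix a x assume a: "a \<in> carrier R" and "x \<in> N +\<^sub>S K"
  then obtain n k where *: "n \<in> N" "k \<in> K" "x = n +\<^sub>M k"
    by (auto simp: ssum_iff)
  then have "a *\<^sub>M x = a *\<^sub>M n +\<^sub>M a *\<^sub>M k"
    using assms sub_carr a by (simp add: smult_r_distr)
  then show "a *\<^sub>M x \<in> N +\<^sub>S K" unfolding ssum_iff using * a assms subD(5) by blast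
qed

lemma ssum_ge:
  assumes "sub N" "sub K"
  shows "N \<subseteq> N +\<^sub>S K" "K \<subseteq> N +\<^sub>S K"
proof -
  show "N \<subseteq> N +\<^sub>S K"
  proof
    fix x assume "x \<in> N"
    then have "x = x +\<^sub>M 0\<^sub>M" using assms sub_carr by simp
    then show "x \<in> N +\<^sub>S K" unfolding ssum_iff using \<open>x \<in> N\<close> assms subD(2) by blast
  qed
  show "K \<subseteq> N +\<^sub>S K"
  proof
    fix x assume "x \<in> K"
    then have "x = 0\<^sub>M +\<^sub>M x" using assms sub_carr by simp
    then show "x \<in> N +\<^sub>S K" unfolding ssum_iff using \<open>x \<in> K\<close> assms subD(2) by blast
  qed
qed

lemma ssum_le: "sub L \<Longrightarrow> N \<subseteq> L \<Longrightarrow> K \<subseteq> L \<Longrightarrow> N +\<^sub>S K \<subseteq> L"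
  using subD(3)[of L] by (auto simp: ssum_iff subset_iff)

lemma ssum_mono: "N \<subseteq> N' \<Longrightarrow> K \<subseteq> K' \<Longrightarrow> N +\<^sub>S K \<subseteq> N' +\<^sub>S K'"
  by (fastforce simp: ssum_iff)

lemma ssum_comm: "N \<subseteq> carrier M \<Longrightarrow> K \<subseteq> carrier M \<Longrightarrow> N +\<^sub>S K = K +\<^sub>S N"
  unfolding set_eq_iff ssum_iff using M.a_comm by (metis subsetD)

lemma ssum_assoc:
  assumes "N \<subseteq> carrier M" "K \<subseteq> carrier M" "L \<subseteq> carrier M"
  shows "(N +\<^sub>S K) +\<^sub>S L = N +\<^sub>S (K +\<^sub>S L)"
  unfolding set_add_def using assms by (intro M.add.set_mult_assoc) auto

lemma ssum_absorb: "sub N \<Longrightarrow> sub K \<Longrightarrow> K \<subseteq> N \<Longrightarrow> N +\<^sub>S K = N"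
  using ssum_le[of N N K] ssum_ge(1)[of N K] by blast

lemma ssum_zero: "sub N \<Longrightarrow> N +\<^sub>S {0\<^sub>M} = N"
  by (rule ssum_absorb) (use sub_zero subD(2) in auto)

lemma modular_law:
  assumes "sub A" "sub B" "sub C" "B \<subseteq> C"
  shows "(A +\<^sub>S B) \<inter> C \<subseteq> (A \<inter> C) +\<^sub>S B"
proof
  fix x assume "x \<in> (A +\<^sub>S B) \<inter> C"
  then obtain a b where ab: "a \<in> A" "b \<in> B" "x = a +\<^sub>M b" "x \<in> C" by (auto simp: ssum_iff)
  then have "a \<in> C" using sub_diff2[of C b a] assms sub_carr by blast
  then show "x \<in> (A \<inter> C) +\<^sub>S B" using ab by (auto simp: ssum_iff)
qed

lemma sub_scale:
  assumes "sub N" "a \<in> carrier R"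
  shows "sub (a *\<^sub>S N)"
proof (rule subI)
  show "a *\<^sub>S N \<subseteq> carrier M" using assms sub_carr by (auto simp: scale_def)
  show "0\<^sub>M \<in> a *\<^sub>S N" unfolding scale_def using assms subD(2)
    by (intro image_eqI[of _ _ "0\<^sub>M"]) auto
  fix x y assume "x \<in> a *\<^sub>S N" "y \<in> a *\<^sub>S N"
  then obtain n n' where *: "n \<in> N" "n' \<in> N" "x = a *\<^sub>M n" "y = a *\<^sub>M n'" by (auto simp: scale_def)
  then have "x +\<^sub>M y = a *\<^sub>M (n +\<^sub>M n')" using assms sub_carr by (simp add: smult_r_distr)
  then show "x +\<^sub>M y \<in> a *\<^sub>S N" using * assms subD(3) by (auto simp: scale_def)
next
  fix b x assume b: "b \<in> carrier R" and "x \<in> a *\<^sub>S N"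
  then obtain n where *: "n \<in> N" "x = a *\<^sub>M n" by (auto simp: scale_def)
  then have "b *\<^sub>M x = a *\<^sub>M (b *\<^sub>M n)" using assms b sub_carr smult_commute by simp
  then show "b *\<^sub>M x \<in> a *\<^sub>S N" using * assms b subD(5) by (auto simp: scale_def)
qed

lemma scale_le: "sub N \<Longrightarrow> a \<in> carrier R \<Longrightarrow> a *\<^sub>S N \<subseteq> N"
  using subD(5) by (auto simp: scale_def)

lemma scale_mono: "N \<subseteq> K \<Longrightarrow> a *\<^sub>S N \<subseteq> a *\<^sub>S K"
  by (auto simp: scale_def)

lemma scale_ssum:
  assumes "N \<subseteq> carrier M" "K \<subseteq> carrier M" "a \<in> carrier R"
  shows "a *\<^sub>S (N +\<^sub>S K) = a *\<^sub>S N +\<^sub>S a *\<^sub>S K"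
proof -
  have *: "a *\<^sub>M (n +\<^sub>M k) = a *\<^sub>M n +\<^sub>M a *\<^sub>M k" if "n \<in> N" "k \<in> K" for n k
    using that assms smult_r_distr by blast
  show ?thesis
  proof (intro equalityI subsetI)
    fix x assume "x \<in> a *\<^sub>S (N +\<^sub>S K)"
    then obtain n k where nk: "n \<in> N" "k \<in> K" "x = a *\<^sub>M (n +\<^sub>M k)" by (auto simp: scale_def ssum_iff)
    then show "x \<in> a *\<^sub>S N +\<^sub>S a *\<^sub>S K" using *[OF nk(1,2)] by (auto simp: scale_def ssum_iff)
  next
    fix x assume "x \<in> a *\<^sub>S N +\<^sub>S a *\<^sub>S K"
    then obtain n k where nk: "n \<in> N" "k \<in> K" "x = a *\<^sub>M n +\<^sub>M a *\<^sub>M k" by (auto simp: scale_def ssum_iff)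
    then have "n +\<^sub>M k \<in> N +\<^sub>S K" by (auto simp: ssum_iff)
    then show "x \<in> a *\<^sub>S (N +\<^sub>S K)" unfolding scale_def using nk(3) *[OF nk(1,2)] by (metis imageI)
  qed
qed

lemma scale_scale_commute:
  assumes "N \<subseteq> carrier M" "a \<in> carrier R" "b \<in> carrier R"
  shows "a *\<^sub>S b *\<^sub>S N = b *\<^sub>S a *\<^sub>S N"
  unfolding scale_def image_image using assms smult_commute by (intro image_cong) auto

lemma sub_pre:
  assumes "sub N" "sub L" "a \<in> carrier R"
  shows "sub {n \<in> N. a *\<^sub>M n \<in> L}"
proof (rule subI)
  show "{n \<in> N. a *\<^sub>M n \<in> L} \<subseteq> carrier M" using assms sub_carr by auto
  show "0\<^sub>M \<in> {n \<in> N. a *\<^sub>M n \<in> L}" using assms subD(2) by auto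
  show "x +\<^sub>M y \<in> {n \<in> N. a *\<^sub>M n \<in> L}" if "x \<in> {n \<in> N. a *\<^sub>M n \<in> L}" "y \<in> {n \<in> N. a *\<^sub>M n \<in> L}" for x y
    using that assms subD(3)[OF assms(1)] subD(3)[OF assms(2)] smult_r_distr[of a x y] sub_carr[OF assms(1)] by simp
  show "b *\<^sub>M x \<in> {n \<in> N. a *\<^sub>M n \<in> L}" if "b \<in> carrier R" "x \<in> {n \<in> N. a *\<^sub>M n \<in> L}" for b x
    using that assms subD(5)[OF assms(1)] subD(5)[OF assms(2)] smult_commute[of a b x] sub_carr[OF assms(1)] by simp
qed

lemma colon_ideal:
  assumes "sub L" "N \<subseteq> carrier M"
  shows "ideal (colon R M L N) R"
proof (rule R.cr_idealI)
  have "(a \<oplus> b) *\<^sub>M n = a *\<^sub>M n +\<^sub>M b *\<^sub>M n" if "a \<in> carrier R" "b \<in> carrier R" "n \<in> N" for a b n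
    using that assms smult_l_distr by blast
  then show "a \<oplus> b \<in> colon R M L N" if "a \<in> colon R M L N" "b \<in> colon R M L N" for a b
    using that subD(3)[OF assms(1)] by (simp add: colon_def)
  have "(a \<otimes> b) *\<^sub>M n = a *\<^sub>M b *\<^sub>M n" if "a \<in> carrier R" "b \<in> carrier R" "n \<in> N" for a b n
    using that assms smult_assoc1 by blast
  then show "a \<otimes> b \<in> colon R M L N" if "a \<in> carrier R" "b \<in> colon R M L N" for a b
    using that subD(5)[OF assms(1)] by (simp add: colon_def)
qed (use assms subD(2)[OF assms(1)] smult_l_null in \<open>auto simp: colon_def subset_iff\<close>)

lemma colon_mono: "L \<subseteq> L' \<Longrightarrow> N' \<subseteq> N \<Longrightarrow> colon R M L N \<subseteq> colon R M L' N'"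
  by (auto simp: colon_def)

lemma saturatedD: "saturated R M P L \<Longrightarrow> s \<in> carrier R \<Longrightarrow> s \<notin> P \<Longrightarrow> n \<in> carrier M \<Longrightarrow> s *\<^sub>M n \<in> L \<Longrightarrow> n \<in> L"
  by (auto simp: saturated_def)

lemma saturationD: "n \<in> saturation R M P L \<Longrightarrow> \<exists>s\<in>carrier R. s \<notin> P \<and> n \<in> carrier M \<and> s *\<^sub>M n \<in> L"
  by (auto simp: saturation_def)

lemma saturationI: "s \<in> carrier R \<Longrightarrow> s \<notin> P \<Longrightarrow> n \<in> carrier M \<Longrightarrow> s *\<^sub>M n \<in> L \<Longrightarrow> n \<in> saturation R M P L"
  by (auto simp: saturation_def)

lemma sub_saturation:
  assumes P: "primeideal P R" and L: "sub L"
  shows "sub (saturation R M P L)"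
proof (rule subI)
  note P = R.primeE[OF P]
  show "saturation R M P L \<subseteq> carrier M" by (auto simp: saturation_def)
  show "0\<^sub>M \<in> saturation R M P L" using P(1) subD(2)[OF L] by (intro saturationI[of \<one>]) auto
  fix x y assume "x \<in> saturation R M P L" "y \<in> saturation R M P L"
  then obtain s t where *: "s \<in> carrier R" "s \<notin> P" "x \<in> carrier M" "s *\<^sub>M x \<in> L"
     "t \<in> carrier R" "t \<notin> P" "y \<in> carrier M" "t *\<^sub>M y \<in> L" by (auto simp: saturation_def)
  have "(s \<otimes> t) *\<^sub>M (x +\<^sub>M y) = t *\<^sub>M s *\<^sub>M x +\<^sub>M s *\<^sub>M t *\<^sub>M y"
    using * by (simp add: smult_r_distr smult_assoc1 smult_commute)
  then show "x +\<^sub>M y \<in> saturation R M P L" using * subD(3,5)[OF L] P by (intro saturationI[of "s \<otimes> t"]) auto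
next
  fix a x assume a: "a \<in> carrier R" and "x \<in> saturation R M P L"
  then obtain s where *: "s \<in> carrier R" "s \<notin> P" "x \<in> carrier M" "s *\<^sub>M x \<in> L" by (auto simp: saturation_def)
  then show "a *\<^sub>M x \<in> saturation R M P L" using a subD(5)[OF L a *(4)]
    by (intro saturationI[of s]) (auto simp: smult_commute)
qed

lemma saturation_ge:
  assumes P: "primeideal P R" and L: "sub L"
  shows "L \<subseteq> saturation R M P L"
proof
  fix x assume x: "x \<in> L"
  then show "x \<in> saturation R M P L" using R.primeE(1)[OF P] sub_carr[OF L x] by (intro saturationI[of \<one>]) auto
qed

lemma saturated_saturation:
  assumes P: "primeideal P R"
  shows "saturated R M P (saturation R M P L)"
  unfolding saturated_def
proof (intro ballI impI)
  fix s n assume s: "s \<in> carrier R - P" "n \<in> carrier M" "s *\<^sub>M n \<in> saturation R M P L"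
  then obtain t where "t \<in> carrier R" "t \<notin> P" "t *\<^sub>M s *\<^sub>M n \<in> L" by (auto simp: saturation_def)
  then show "n \<in> saturation R M P L" using s R.primeE(4)[OF P, of t s] smult_assoc1[of t s n]
    by (intro saturationI[of "t \<otimes> s"]) auto
qed

lemma saturation_le: "saturated R M P L \<Longrightarrow> K \<subseteq> L \<Longrightarrow> saturation R M P K \<subseteq> L"
  by (auto simp: saturated_def saturation_def)

lemma saturated_Int: "saturated R M P L \<Longrightarrow> saturated R M P K \<Longrightarrow> saturated R M P (L \<inter> K)"
  by (auto simp: saturated_def)

definition cyclic where "cyclic x = (\<lambda>a. a *\<^sub>M x) ` carrier R"

lemma sub_cyclic:
  assumes "x \<in> carrier M"
  shows "sub (cyclic x)"
proof (rule subI)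
  show "cyclic x \<subseteq> carrier M" using assms by (auto simp: cyclic_def)
  show "0\<^sub>M \<in> cyclic x" using assms unfolding cyclic_def
    by (intro image_eqI[of _ _ \<zero>]) auto
  show "u +\<^sub>M v \<in> cyclic x" if uv: "u \<in> cyclic x" "v \<in> cyclic x" for u v
  proof -
    obtain a b where "a \<in> carrier R" "b \<in> carrier R" "u = a *\<^sub>M x" "v = b *\<^sub>M x"
      using uv by (auto simp: cyclic_def)
    then show ?thesis unfolding cyclic_def using assms
      by (intro image_eqI[of _ _ "a \<oplus> b"]) (auto simp: smult_l_distr)
  qed
  show "c *\<^sub>M u \<in> cyclic x" if c: "c \<in> carrier R" "u \<in> cyclic x" for u c
  proof -
    obtain a where "a \<in> carrier R" "u = a *\<^sub>M x" using c by (auto simp: cyclic_def)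
    then show ?thesis unfolding cyclic_def using assms c(1)
      by (intro image_eqI[of _ _ "c \<otimes> a"]) (auto simp: smult_assoc1)
  qed
qed

lemma cyclic_self: "x \<in> carrier M \<Longrightarrow> x \<in> cyclic x"
  unfolding cyclic_def by (intro image_eqI[of _ _ \<one>]) auto

lemma cyclic_le: "sub N \<Longrightarrow> x \<in> N \<Longrightarrow> cyclic x \<subseteq> N"
  using subD(5) by (auto simp: cyclic_def)

end

section \<open>Length\<close>

definition len_chain :: "('a, 'r) ring_scheme \<Rightarrow> ('a, 'b, 'm) module_scheme \<Rightarrow> 'a set \<Rightarrow> 'b set \<Rightarrow> 'b set \<Rightarrow>
    nat \<Rightarrow> (nat \<Rightarrow> 'b set) \<Rightarrow> bool"
  where "len_chain R M P L N n C \<longleftrightarrow>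
     (\<forall>i\<le>n. submodule (C i) R M \<and> saturated R M P (C i) \<and> L \<subseteq> C i \<and> C i \<subseteq> N) \<and>
     (\<forall>i<n. C i \<subset> C (Suc i))"

lemma len_chainD:
  assumes "len_chain R M P L N n C"
  shows "i \<le> n \<Longrightarrow> submodule (C i) R M" "i \<le> n \<Longrightarrow> saturated R M P (C i)"
    "i \<le> n \<Longrightarrow> L \<subseteq> C i" "i \<le> n \<Longrightarrow> C i \<subseteq> N" "i < n \<Longrightarrow> C i \<subset> C (Suc i)"
  using assms by (simp_all add: len_chain_def)

lemma len_chainI:
  assumes "\<And>i. i \<le> n \<Longrightarrow> submodule (C i) R M" "\<And>i. i \<le> n \<Longrightarrow> saturated R M P (C i)"
    "\<And>i. i \<le> n \<Longrightarrow> L \<subseteq> C i" "\<And>i. i \<le> n \<Longrightarrow> C i \<subseteq> N" "\<And>i. i < n \<Longrightarrow> C i \<subset> C (Suc i)"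
  shows "len_chain R M P L N n C"
  using assms by (simp add: len_chain_def)

lemma len_ge: "len_chain R M P L N n C \<Longrightarrow> enat n \<le> sat_len R M P L N"
  unfolding sat_len_def len_chain_def[symmetric] by (intro Sup_upper) auto

lemma len_le: "(\<And>n C. len_chain R M P L N n C \<Longrightarrow> enat n \<le> b) \<Longrightarrow> sat_len R M P L N \<le> b"
  unfolding sat_len_def len_chain_def[symmetric] by (intro Sup_least) auto

text \<open>An infinite set of extended naturals has supremum infinity, so a finite supremum is a
  maximum. This is how a longest chain, or a regular sequence realizing the depth, is obtained from
  a supremum.\<close>

lemma Sup_enat_mem:
  assumes "Sup A = enat n" "A \<noteq> {}"
  shows "enat n \<in> A"
proof -
  have "finite A" using assms by (auto simp: Sup_enat_def split: if_splits)
  then show ?thesis using assms Max_in[of A] by (auto simp: Sup_enat_def)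
qed

lemma len_attained:
  assumes "sat_len R M P L N = enat n" "submodule L R M" "saturated R M P L" "L \<subseteq> N"
  obtains C where "len_chain R M P L N n C"
proof -
  have "len_chain R M P L N 0 (\<lambda>_. L)" using assms by (intro len_chainI) auto
  then have "enat n \<in> {enat n | n. \<exists>C. len_chain R M P L N n C}"
    using assms(1) unfolding sat_len_def len_chain_def[symmetric] by (intro Sup_enat_mem) auto
  then show ?thesis using that by auto
qed

text \<open>Common tool for comparing lengths: the isomorphism theorems, restrictions and quotients
  all enter through strictly monotone maps between intervals of submodules, so that module
  isomorphisms are never formed.\<close>

lemma len_map:
  assumes "\<And>K. submodule K R M \<Longrightarrow> saturated R M P K \<Longrightarrow> L \<subseteq> K \<Longrightarrow> K \<subseteq> N \<Longrightarrow>
      submodule (f K) R M' \<and> saturated R M' P' (f K) \<and> L' \<subseteq> f K \<and> f K \<subseteq> N'"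
    and "\<And>K K'. submodule K R M \<Longrightarrow> L \<subseteq> K \<Longrightarrow> K \<subseteq> N \<Longrightarrow> submodule K' R M \<Longrightarrow> L \<subseteq> K' \<Longrightarrow> K' \<subseteq> N \<Longrightarrow>
      K \<subset> K' \<Longrightarrow> f K \<subset> f K'"
  shows "sat_len R M P L N \<le> sat_len R M' P' L' N'"
proof (rule len_le)
  fix n C assume C: "len_chain R M P L N n C"
  note C = len_chainD[OF C]
  have f: "submodule (f (C i)) R M' \<and> saturated R M' P' (f (C i)) \<and> L' \<subseteq> f (C i) \<and> f (C i) \<subseteq> N'" if "i \<le> n" for i
    using C(1-4)[OF that] by (rule assms(1))
  have "len_chain R M' P' L' N' n (\<lambda>i. f (C i))"
  proof (rule len_chainI)
    fix i assume i: "i < n"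
    then have i': "i \<le> n" "Suc i \<le> n" by auto
    show "f (C i) \<subset> f (C (Suc i))"
      by (rule assms(2)) (use C i i' in auto)
  qed (use f in auto)
  then show "enat n \<le> sat_len R M' P' L' N'" by (rule len_ge)
qed

lemma len_mono:
  assumes "L' \<subseteq> L" "N \<subseteq> N'"
  shows "sat_len R M P L N \<le> sat_len R M P L' N'"
  by (rule len_map[where f = "\<lambda>K. K"]) (use assms in blast)+

lemma len_self: "sat_len R M P N N = 0"
proof -
  have "sat_len R M P N N \<le> 0"
  proof (rule len_le)
    fix n C assume C: "len_chain R M P N N n C"
    show "enat n \<le> 0"
    proof (cases n)
      case (Suc m)
      then have "C 0 = N" "C 1 = N" "C 0 \<subset> C 1"
        using len_chainD(3-5)[OF C, of 0] len_chainD(3,4)[OF C, of 1] by auto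
      then show ?thesis by simp
    qed (simp add: zero_enat_def)
  qed
  then show ?thesis by simp
qed

lemma len_concat:
  assumes "submodule L R M" "saturated R M P L" "submodule K R M" "saturated R M P K" "L \<subseteq> K" "K \<subseteq> N"
  shows "sat_len R M P L K + sat_len R M P K N \<le> sat_len R M P L N"
proof (cases "sat_len R M P L N")
  case (enat k)
  have le: "sat_len R M P L K \<le> enat k" "sat_len R M P K N \<le> enat k"
    using assms len_mono[of L L K N R M P] len_mono[of L K N N R M P] enat by auto
  then obtain n m where n: "sat_len R M P L K = enat n" and m: "sat_len R M P K N = enat m"
    by (metis enat_ile)
  obtain C where C: "len_chain R M P L K n C" using len_attained[OF n assms(1,2,5)] by blast
  obtain D where D: "len_chain R M P K N m D" using len_attained[OF m assms(3,4,6)] by blast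
  define E where "E i = (if i \<le> n then C i else D (i - n))" for i
  note C = len_chainD[OF C] and D = len_chainD[OF D]
  have "len_chain R M P L N (n + m) E"
  proof (rule len_chainI)
    fix i assume i: "i < n + m"
    show "E i \<subset> E (Suc i)"
    proof (cases "i < n")
      case False
      then have *: "D (i - n) \<subset> D (Suc (i - n))" using D(5) i by auto
      \<comment> \<open>At the seam i = n the term \<open>E n\<close> is \<open>C n\<close>, which
        lies below K and hence below \<open>D 0\<close>; strictness comes from the first step of
        D.\<close>
      moreover have "E i \<subseteq> D (i - n)"
      proof (cases "i = n")
        case True
        then show ?thesis using C(4)[of n] D(3)[of 0] by (auto simp: E_def)
      qed (use False in \<open>auto simp: E_def\<close>)
      ultimately show ?thesis using False by (auto simp: E_def Suc_diff_le)
    qed (use C(5) in \<open>auto simp: E_def\<close>)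
  next
    fix i assume i: "i \<le> n + m"
    show "submodule (E i) R M" "saturated R M P (E i)"
      using C(1,2)[of i] D(1,2)[of "i - n"] i by (auto simp: E_def)
    show "L \<subseteq> E i" using C(3)[of i] D(3)[of "i - n"] i assms(5) by (cases "i \<le> n") (force simp: E_def)+
    show "E i \<subseteq> N" using C(4)[of i] D(4)[of "i - n"] i assms(6) by (cases "i \<le> n") (force simp: E_def)+
  qed
  then have "enat (n + m) \<le> sat_len R M P L N" by (rule len_ge)
  then show ?thesis using n m by simp
qed simp

lemma len_ge1:
  assumes "submodule L R M" "saturated R M P L" "submodule N R M" "saturated R M P N" "L \<subset> N"
  shows "1 \<le> sat_len R M P L N"
proof -
  have "len_chain R M P L N 1 (\<lambda>i. if i = 0 then L else N)"
    using assms by (intro len_chainI) auto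
  then show ?thesis using len_ge by (metis one_enat_def)
qed

lemma len_eq_0:
  assumes "submodule L R M" "saturated R M P L" "submodule N R M" "saturated R M P N" "L \<subseteq> N" "sat_len R M P L N = 0"
  shows "L = N"
  using len_ge1[OF assms(1-4)] assms(5,6) by (auto simp: psubset_eq)

context module
begin

text \<open>Only the upper bound needs an argument. A chain C from L to N leaves traces
  \<open>C i \<inter> K\<close> below K and saturated sums of \<open>C i\<close> and K above K. By
  the modular law, up to a multiplier outside P, a step that changes neither of them is an equality;
  so each step of C is strict in at least one of the two chains. This takes the place of the
  Jordan-Hoelder theorem and covers infinite lengths as well.\<close>

lemma len_add:
  assumes P: "primeideal P R" and L: "sub L" "saturated R M P L" and K: "sub K" "saturated R M P K"
    and N: "sub N" "saturated R M P N" and LK: "L \<subseteq> K" "K \<subseteq> N"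
  shows "sat_len R M P L N = sat_len R M P L K + sat_len R M P K N"
proof (rule antisym)
  show "sat_len R M P L K + sat_len R M P K N \<le> sat_len R M P L N"
    by (rule len_concat[OF L K LK])
  show "sat_len R M P L N \<le> sat_len R M P L K + sat_len R M P K N"
  proof (rule len_le)
    fix n C assume "len_chain R M P L N n C"
    note C = len_chainD[OF this]
    define A where "A i = C i \<inter> K" for i
    define B where "B i = saturation R M P (C i +\<^sub>S K)" for i
    have A: "sub (A i)" "saturated R M P (A i)" "L \<subseteq> A i" "A i \<subseteq> K" if "i \<le> n" for i
      using C(1-4)[OF that] K LK by (auto simp: A_def sub_Int saturated_Int)
    have B: "sub (B i)" "saturated R M P (B i)" "K \<subseteq> B i" "B i \<subseteq> N" if "i \<le> n" for i
    proof -
      have Ci: "sub (C i)" "C i \<subseteq> N" using C(1,4)[OF that] .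
      show "sub (B i)" "saturated R M P (B i)" unfolding B_def using P Ci K by (auto intro: sub_saturation saturated_saturation sub_ssum)
      have "C i +\<^sub>S K \<subseteq> N" using ssum_le[OF N(1)] Ci LK by blast
      then show "B i \<subseteq> N" unfolding B_def using N saturation_le by blast
      show "K \<subseteq> B i" unfolding B_def using ssum_ge(2)[OF Ci(1) K(1)] saturation_ge[OF P sub_ssum[OF Ci(1) K(1)]] by blast
    qed
    have mono: "A i \<subseteq> A (Suc i)" "B i \<subseteq> B (Suc i)" if "i < n" for i
    proof -
      have "C i \<subseteq> C (Suc i)" using C(5)[OF that] by blast
      then have "C i +\<^sub>S K \<subseteq> C (Suc i) +\<^sub>S K" by (intro ssum_mono) auto
      then show "A i \<subseteq> A (Suc i)" "B i \<subseteq> B (Suc i)" using \<open>C i \<subseteq> C (Suc i)\<close>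
        by (auto simp: A_def B_def saturation_def)
    qed
    have strict: "A i \<subset> A (Suc i) \<or> B i \<subset> B (Suc i)" if i: "i < n" for i
    proof (rule ccontr)
      assume "\<not> ?thesis"
      then have eq: "A i = A (Suc i)" "B i = B (Suc i)" using mono[OF i] by auto
      have Ci: "sub (C i)" "saturated R M P (C i)" "sub (C (Suc i))" "C i \<subset> C (Suc i)"
        using C(1,2,5)[of i] C(1)[of "Suc i"] i by auto
      have "C (Suc i) \<subseteq> C i"
      proof
        fix c assume c: "c \<in> C (Suc i)"
        then have "c \<in> B (Suc i)" unfolding B_def
          using ssum_ge(1)[OF Ci(3) K(1)] saturation_ge[OF P sub_ssum[OF Ci(3) K(1)]] by blast
        then have "c \<in> saturation R M P (C i +\<^sub>S K)" using eq unfolding B_def by simp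
        then obtain s where s: "s \<in> carrier R" "s \<notin> P" "s *\<^sub>M c \<in> C i +\<^sub>S K" by (auto simp: saturation_def)
        then obtain c' k where ck: "c' \<in> C i" "k \<in> K" "s *\<^sub>M c = c' +\<^sub>M k" by (auto simp: ssum_iff)
        have "c' \<in> C (Suc i)" using Ci ck by auto
        moreover have "c' +\<^sub>M k \<in> C (Suc i)" using ck(3) c s subD(5)[OF Ci(3)] by metis
        ultimately have "k \<in> C (Suc i)" using sub_diff1[OF Ci(3)] ck(2) sub_carr[OF K(1)] by blast
        then have "k \<in> A i" using eq ck by (auto simp: A_def)
        then have "s *\<^sub>M c \<in> C i" using ck subD(3)[OF Ci(1)] by (auto simp: A_def)
        then show "c \<in> C i" using saturatedD[OF Ci(2) s(1,2)] sub_carr[OF Ci(3) c] by blast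
      qed
      then show False using Ci by auto
    qed
    have "enat i \<le> sat_len R M P L (A i) + sat_len R M P K (B i)" if "i \<le> n" for i
      using that
    proof (induction i)
      case 0 then show ?case by (simp add: zero_enat_def[symmetric])
    next
      case (Suc i)
      then have i: "i < n" "i \<le> n" by auto
      have st: "sat_len R M P L (A i) + 1 \<le> sat_len R M P L (A (Suc i))" if "A i \<subset> A (Suc i)"
        using len_concat[OF L A(1,2)[OF i(2)] A(3)[OF i(2)] mono(1)[OF i(1)]]
          len_ge1[OF A(1,2)[OF i(2)] A(1,2)[OF Suc.prems] that] add_left_mono order_trans by blast
      have st': "sat_len R M P K (B i) + 1 \<le> sat_len R M P K (B (Suc i))" if "B i \<subset> B (Suc i)"
        using len_concat[OF K B(1,2)[OF i(2)] B(3)[OF i(2)] mono(2)[OF i(1)]]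
          len_ge1[OF B(1,2)[OF i(2)] B(1,2)[OF Suc.prems] that] add_left_mono order_trans by blast
      have m: "sat_len R M P L (A i) \<le> sat_len R M P L (A (Suc i))" "sat_len R M P K (B i) \<le> sat_len R M P K (B (Suc i))"
        using mono[OF i(1)] by (auto intro: len_mono)
      have "enat (Suc i) \<le> sat_len R M P L (A i) + sat_len R M P K (B i) + 1"
        using Suc.IH[OF i(2)] by (metis Suc_eq_plus1 add_right_mono one_enat_def plus_enat_simps(1))
      also have "\<dots> \<le> sat_len R M P L (A (Suc i)) + sat_len R M P K (B (Suc i))"
        using strict[OF i(1)]
      proof
        assume "A i \<subset> A (Suc i)"
        from add_mono[OF st[OF this] m(2)] show ?thesis by (simp add: ac_simps)
      next
        assume "B i \<subset> B (Suc i)"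
        from add_mono[OF m(1) st'[OF this]] show ?thesis by (simp add: ac_simps)
      qed
      finally show ?case .
    qed
    from this[of n] have "enat n \<le> sat_len R M P L (A n) + sat_len R M P K (B n)" by simp
    also have "\<dots> \<le> sat_len R M P L K + sat_len R M P K N"
      using A(4)[of n] B(4)[of n] by (intro add_mono len_mono) auto
    finally show "enat n \<le> sat_len R M P L K + sat_len R M P K N" .
  qed
qed

text \<open>Each strict step consumes at least one unit of length. A single repetition is the form
  in which the principal ideal theorem and the nilpotency of \<mm> on modules of finite length use
  this.\<close>

lemma dcc:
  assumes A: "\<And>n. sub (A n)" "\<And>n. saturated R M P (A n)" "\<And>n. A (Suc n) \<subseteq> A n" "\<And>n. L \<subseteq> A n"
    and L: "sub L" "saturated R M P L" and fin: "sat_len R M P L (A 0) < \<infinity>"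
  shows "\<exists>n. A (Suc n) = A n"
proof (rule ccontr)
  assume "\<not> ?thesis"
  then have st: "A (Suc n) \<subset> A n" for n using A(3) by blast
  have "enat n + sat_len R M P L (A n) \<le> sat_len R M P L (A 0)" for n
  proof (induction n)
    case 0 then show ?case by (simp add: zero_enat_def[symmetric])
  next
    case (Suc n)
    have "sat_len R M P L (A (Suc n)) + 1 \<le> sat_len R M P L (A (Suc n)) + sat_len R M P (A (Suc n)) (A n)"
      by (intro add_left_mono len_ge1 A st)
    also have "\<dots> \<le> sat_len R M P L (A n)"
      by (intro len_concat A L)
    finally have "enat n + (sat_len R M P L (A (Suc n)) + 1) \<le> sat_len R M P L (A 0)"
      using Suc add_left_mono order_trans by blast
    moreover have e: "enat (Suc n) + sat_len R M P L (A (Suc n)) = enat n + (sat_len R M P L (A (Suc n)) + 1)"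
      by (simp add: plus_1_eSuc iadd_Suc_right iadd_Suc flip: eSuc_enat)
    ultimately show ?case by (simp only: e)
  qed
  then have "enat n \<le> sat_len R M P L (A 0)" for n
    by (rule order_trans[rotated, of "enat n + sat_len R M P L (A n)"]) simp
  then show False using fin
    by (metis Suc_ile_eq less_infinityE order_less_irrefl)
qed

text \<open>Since P annihilates v modulo L, the localized quotient is a vector space of dimension at
  most one over the residue field of P. In terms of submodules: a saturated K strictly above L
  contains some rv up to an element of L, with r outside P, and therefore v itself.\<close>

lemma len_simple:
  assumes P: "primeideal P R" and L: "sub L" "saturated R M P L" and v: "v \<in> carrier M"
    and Pv: "\<And>p. p \<in> P \<Longrightarrow> p *\<^sub>M v \<in> L"
  shows "sat_len R M P L (saturation R M P (L +\<^sub>S cyclic v)) \<le> 1"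
proof (rule len_le)
  let ?N = "saturation R M P (L +\<^sub>S cyclic v)"
  fix n C assume C: "len_chain R M P L ?N n C"
  have max: "K = ?N" if K: "sub K" "saturated R M P K" "L \<subset> K" "K \<subseteq> ?N" for K
  proof -
    obtain k where k: "k \<in> K" "k \<notin> L" using K by blast
    then obtain s where s: "s \<in> carrier R" "s \<notin> P" "s *\<^sub>M k \<in> L +\<^sub>S cyclic v" using K by (auto simp: saturation_def)
    then obtain l r where lr: "l \<in> L" "r \<in> carrier R" "s *\<^sub>M k = l +\<^sub>M r *\<^sub>M v"
      by (auto simp: ssum_iff cyclic_def)
    have "r \<notin> P"
    proof
      assume "r \<in> P"
      then have "s *\<^sub>M k \<in> L" using lr Pv subD(3)[OF L(1)] by auto
      then show False using saturatedD[OF L(2) s(1,2)] k sub_carr[OF K(1)] by blast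
    qed
    have "l +\<^sub>M r *\<^sub>M v \<in> K" using subD(5)[OF K(1) s(1) k(1)] lr(3) by simp
    then have "r *\<^sub>M v \<in> K" using sub_diff1[OF K(1)] lr v K by blast
    then have "v \<in> K" using saturatedD[OF K(2) lr(2) \<open>r \<notin> P\<close> v] by blast
    then have "L +\<^sub>S cyclic v \<subseteq> K" using K cyclic_le by (intro ssum_le) auto
    then show ?thesis using saturation_le[OF K(2)] K(4) by blast
  qed
  show "enat n \<le> 1"
  proof (rule ccontr)
    assume "\<not> ?thesis"
    then have n: "n \<ge> 2" by (auto simp: one_enat_def)
    then have "C 0 \<subset> C 1" "C 1 \<subset> C 2" "L \<subseteq> C 0"
      using len_chainD(5)[OF C, of 0] len_chainD(5)[OF C, of 1] len_chainD(3)[OF C, of 0]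
      by (auto simp: numeral_2_eq_2)
    moreover have "sub (C 1)" "saturated R M P (C 1)" "C 1 \<subseteq> ?N" "C 2 \<subseteq> ?N"
      using len_chainD(1,2,4)[OF C, of 1] len_chainD(4)[OF C, of 2] n by auto
    ultimately show False using max[of "C 1"] by blast
  qed
qed

text \<open>The classical source of associated primes: if bv is nonzero modulo L, its annihilator
  contains that of v, hence equals it, and ab killing v means that a kills bv.\<close>

lemma max_ann_prime:
  assumes "sub L" "sub N" "v \<in> N" "v \<notin> L"
    and max: "\<And>w. w \<in> N \<Longrightarrow> w \<notin> L \<Longrightarrow> colon R M L {v} \<subseteq> colon R M L {w} \<Longrightarrow> colon R M L {w} = colon R M L {v}"
  shows "primeideal (colon R M L {v}) R"
proof (rule primeidealI)
  have v: "v \<in> carrier M" using assms sub_carr by blast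
  show "ideal (colon R M L {v}) R" using colon_ideal assms v by simp
  show "cring R" ..
  show "carrier R \<noteq> colon R M L {v}"
  proof
    assume "carrier R = colon R M L {v}"
    then have "\<one> \<in> colon R M L {v}" by blast
    then show False using assms v by (simp add: colon_def)
  qed
  fix a b assume ab: "a \<in> carrier R" "b \<in> carrier R" "a \<otimes> b \<in> colon R M L {v}"
  then have abv: "a *\<^sub>M b *\<^sub>M v \<in> L" using v by (simp add: colon_def smult_assoc1)
  show "a \<in> colon R M L {v} \<or> b \<in> colon R M L {v}"
  proof (rule disjCI)
    assume "b \<notin> colon R M L {v}"
    then have bv: "b *\<^sub>M v \<notin> L" using ab by (simp add: colon_def)
    have "colon R M L {v} \<subseteq> colon R M L {b *\<^sub>M v}"
      using ab v subD(5)[OF assms(1)] smult_commute[of _ b v] by (auto simp: colon_def)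
    then have "colon R M L {b *\<^sub>M v} = colon R M L {v}"
      using max[of "b *\<^sub>M v"] bv ab subD(5)[OF assms(2)] assms(3) by blast
    moreover have "a \<in> colon R M L {b *\<^sub>M v}" using abv ab by (simp add: colon_def)
    ultimately show "a \<in> colon R M L {v}" by simp
  qed
qed

end

section \<open>Noetherian rings and modules, associated primes, finite length at minimal
  primes\<close>

locale noeth_cring = cring R for R (structure) +
  assumes wf_ideals: "wf {(J, I). ideal I R \<and> ideal J R \<and> I \<subset> J}"
begin

lemma max_ideal:
  assumes "Q N0" "\<And>N. Q N \<Longrightarrow> ideal N R"
  obtains N where "Q N" "\<And>K. Q K \<Longrightarrow> N \<subseteq> K \<Longrightarrow> K = N"
proof -
  obtain N where "N \<in> Collect Q" "\<And>K. (K, N) \<in> {(J, I). ideal I R \<and> ideal J R \<and> I \<subset> J} \<Longrightarrow> K \<notin> Collect Q"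
    using wfE_min[OF wf_ideals, of N0 "Collect Q"] assms(1) by blast
  then show ?thesis using that[of N] assms(2) by auto
qed

end

locale noeth_module = module R M + noeth_cring R for R (structure) and M (structure) +
  assumes wf_subs: "wf {(K, N). submodule N R M \<and> submodule K R M \<and> N \<subset> K}"
begin

lemma max_sub:
  assumes "Q N0" "\<And>N. Q N \<Longrightarrow> sub N"
  obtains N where "Q N" "\<And>K. Q K \<Longrightarrow> N \<subseteq> K \<Longrightarrow> K = N"
proof -
  obtain N where "N \<in> Collect Q" "\<And>K. (K, N) \<in> {(K, N). sub N \<and> sub K \<and> N \<subset> K} \<Longrightarrow> K \<notin> Collect Q"
    using wfE_min[OF wf_subs, of N0 "Collect Q"] assms(1) by blast
  then show ?thesis using that[of N] assms(2) by auto
qed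

text \<open>Provides an associated prime of N/L above the annihilator of any given nonzero element.
  Maximality is returned too, because \<open>zero_divisor_primes\<close> collects exactly the
  elements with maximal annihilator.\<close>

lemma max_ann_above:
  assumes "sub L" "sub N" "u \<in> N" "u \<notin> L"
  obtains v where "v \<in> N" "v \<notin> L" "colon R M L {u} \<subseteq> colon R M L {v}" "primeideal (colon R M L {v}) R"
    "\<And>w. w \<in> N \<Longrightarrow> w \<notin> L \<Longrightarrow> colon R M L {v} \<subseteq> colon R M L {w} \<Longrightarrow> colon R M L {w} = colon R M L {v}"
proof -
  obtain J where J: "\<exists>v\<in>N - L. J = colon R M L {v} \<and> colon R M L {u} \<subseteq> J"
    and max: "\<And>K. \<exists>v\<in>N - L. K = colon R M L {v} \<and> colon R M L {u} \<subseteq> K \<Longrightarrow> J \<subseteq> K \<Longrightarrow> K = J"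
  proof (rule max_ideal[of "\<lambda>J. \<exists>v\<in>N - L. J = colon R M L {v} \<and> colon R M L {u} \<subseteq> J"])
    show "\<exists>v\<in>N - L. colon R M L {u} = colon R M L {v} \<and> colon R M L {u} \<subseteq> colon R M L {u}"
      using assms by blast
    show "ideal J R" if "\<exists>v\<in>N - L. J = colon R M L {v} \<and> colon R M L {u} \<subseteq> J" for J
      using that colon_ideal[OF assms(1)] sub_carr[OF assms(2)] by auto
  qed blast
  obtain v where v: "v \<in> N" "v \<notin> L" "J = colon R M L {v}" "colon R M L {u} \<subseteq> J" using J by blast
  have m: "colon R M L {w} = colon R M L {v}" if "w \<in> N" "w \<notin> L" "colon R M L {v} \<subseteq> colon R M L {w}" for w
    using max[of "colon R M L {w}"] that v by auto
  show ?thesis using that[OF v(1,2)] v(3,4) max_ann_prime[OF assms(1,2) v(1,2) m] m by blast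
qed

text \<open>Noetherian induction on L, for P minimal over Ann (N/L). An associated prime of N/L lies
  in P because L is saturated and contains Ann (N/L), so it is P. Adjoining the element it belongs
  to raises L at the cost of length at most one, and minimality of P persists because the
  annihilator only grows.\<close>

lemma len_finite:
  assumes P: "primeideal P R" and L: "sub L" "saturated R M P L" and N: "sub N" "saturated R M P N" "L \<subseteq> N"
    and pr: "\<And>p. primeideal p R \<Longrightarrow> colon R M L N \<subseteq> p \<Longrightarrow> p \<subseteq> P \<Longrightarrow> p = P"
  shows "sat_len R M P L N < \<infinity>"
proof (rule ccontr)
  assume inf: "\<not> ?thesis"
  define Q where "Q L \<longleftrightarrow> sub L \<and> saturated R M P L \<and> L \<subseteq> N \<and>
    (\<forall>p. primeideal p R \<longrightarrow> colon R M L N \<subseteq> p \<longrightarrow> p \<subseteq> P \<longrightarrow> p = P) \<and> \<not> sat_len R M P L N < \<infinity>" for L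
  have "Q L" using assms inf by (auto simp: Q_def)
  moreover have "sub K" if "Q K" for K using that by (simp add: Q_def)
  ultimately obtain L where "Q L" and max: "\<And>K. Q K \<Longrightarrow> L \<subseteq> K \<Longrightarrow> K = L"
    using max_sub[of Q L] by blast
  then have L: "sub L" "saturated R M P L" "L \<subseteq> N" "\<not> sat_len R M P L N < \<infinity>"
    and pr: "\<And>p. primeideal p R \<Longrightarrow> colon R M L N \<subseteq> p \<Longrightarrow> p \<subseteq> P \<Longrightarrow> p = P" by (auto simp: Q_def)
  have "L \<noteq> N" using L(4) len_self[of R M P N] by auto
  then obtain u where u: "u \<in> N" "u \<notin> L" using L by blast
  obtain v where v: "v \<in> N" "v \<notin> L" "primeideal (colon R M L {v}) R"
    using max_ann_above[OF L(1) N(1) u] by metis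
  have vc: "v \<in> carrier M" using v N sub_carr by blast
  have "colon R M L {v} = P"
  proof (rule pr[OF v(3)])
    show "colon R M L N \<subseteq> colon R M L {v}" using v by (intro colon_mono) auto
    show "colon R M L {v} \<subseteq> P" using saturatedD[OF L(2) _ _ vc] v(2) by (auto simp: colon_def)
  qed
  then have Pv: "p *\<^sub>M v \<in> L" if "p \<in> P" for p using that by (auto simp: colon_def)
  let ?K = "saturation R M P (L +\<^sub>S cyclic v)"
  have subs: "sub (L +\<^sub>S cyclic v)" using L sub_cyclic[OF vc] sub_ssum by blast
  have K: "sub ?K" "saturated R M P ?K" using sub_saturation[OF P subs] saturated_saturation[OF P] by auto
  have "v \<in> ?K" using saturation_ge[OF P subs] ssum_ge(2)[OF L(1) sub_cyclic[OF vc]] cyclic_self[OF vc] by blast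
  moreover have LK: "L \<subseteq> ?K" using saturation_ge[OF P subs] ssum_ge(1)[OF L(1) sub_cyclic[OF vc]] by blast
  ultimately have "?K \<noteq> L" using v by blast
  then have nQ: "\<not> Q ?K" using max LK by blast
  have KN: "?K \<subseteq> N"
    by (rule saturation_le[OF N(2)]) (use ssum_le[OF N(1) L(3) cyclic_le[OF N(1) v(1)]] in blast)
  have "\<forall>p. primeideal p R \<longrightarrow> colon R M ?K N \<subseteq> p \<longrightarrow> p \<subseteq> P \<longrightarrow> p = P"
    using pr colon_mono[OF LK, of N N] by blast
  then have fin: "sat_len R M P ?K N < \<infinity>" using nQ K KN by (auto simp: Q_def)
  have "sat_len R M P L N = sat_len R M P L ?K + sat_len R M P ?K N"
    by (rule len_add) (use P L K N LK KN in auto)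
  also have "\<dots> \<le> 1 + sat_len R M P ?K N" using len_simple[OF P L(1,2) vc Pv] by (intro add_right_mono)
  also have "\<dots> < \<infinity>" using fin by (auto simp: one_enat_def)
  finally show False using L by simp
qed

end

section \<open>Nakayama's lemma and the principal ideal theorem\<close>

lemma (in ring) add_minus_cancel:
  assumes "a \<in> carrier R" "b \<in> carrier R"
  shows "(a \<oplus> b) \<ominus> a = b"
  using assms by (simp add: a_minus_def a_comm[of a b] a_assoc r_neg)

text \<open>
  The assumption \<open>step\<close> expresses \<open>K \<subseteq> L + P K\<close> up to saturation. A maximal saturated submodule \<open>L'\<close> above \<open>L\<close>
  not containing \<open>K\<close> makes \<open>K / L'\<close> locally cyclic, and then the case of one generator suffices.
\<close>

lemma (in noeth_module) nakayama:
  assumes P: "primeideal P R" and L: "sub L" "saturated R M P L" and K: "K \<subseteq> carrier M"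
    and step: "\<And>T. sub T \<Longrightarrow> saturated R M P T \<Longrightarrow> L \<subseteq> T \<Longrightarrow> (\<And>p k. p \<in> P \<Longrightarrow> k \<in> K \<Longrightarrow> p *\<^sub>M k \<in> T) \<Longrightarrow> K \<subseteq> T"
  shows "K \<subseteq> L"
proof (rule ccontr)
  assume KL: "\<not> ?thesis"
  define Q where "Q L' \<longleftrightarrow> sub L' \<and> saturated R M P L' \<and> L \<subseteq> L' \<and> \<not> K \<subseteq> L'" for L'
  have "Q L" using KL L by (auto simp: Q_def)
  moreover have "sub K" if "Q K" for K using that by (simp add: Q_def)
  ultimately obtain L' where "Q L'" and max: "\<And>K. Q K \<Longrightarrow> L' \<subseteq> K \<Longrightarrow> K = L'"
    using max_sub[of Q L] by blast
  then have L': "sub L'" "saturated R M P L'" "L \<subseteq> L'" "\<not> K \<subseteq> L'" by (auto simp: Q_def)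
  then obtain k where k: "k \<in> K" "k \<notin> L'" by blast
  have kc: "k \<in> carrier M" using k K by blast
  note pP = R.primeE[OF P]
  have subk: "sub (L' +\<^sub>S cyclic k)" by (intro sub_ssum L' sub_cyclic kc)
  have Kin: "K \<subseteq> saturation R M P (L' +\<^sub>S cyclic k)"
  proof (rule ccontr)
    assume n: "\<not> ?thesis"
    have ge: "L' \<subseteq> saturation R M P (L' +\<^sub>S cyclic k)" "cyclic k \<subseteq> saturation R M P (L' +\<^sub>S cyclic k)"
      using saturation_ge[OF P subk] ssum_ge[OF L'(1) sub_cyclic[OF kc]] by auto
    have "Q (saturation R M P (L' +\<^sub>S cyclic k))"
      unfolding Q_def using n sub_saturation[OF P subk] saturated_saturation[OF P] ge L' by blast
    then have "saturation R M P (L' +\<^sub>S cyclic k) = L'" using max ge by blast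
    then show False using ge(2) cyclic_self[OF kc] k by blast
  qed
  define Pk where "Pk = (\<lambda>p. p *\<^sub>M k) ` P"
  have Pk: "sub Pk"
  proof (rule subI)
    show "Pk \<subseteq> carrier M" using pP kc by (auto simp: Pk_def)
    show "0\<^sub>M \<in> Pk" unfolding Pk_def using pP kc by (intro image_eqI[of _ _ \<zero>]) auto
    show "x +\<^sub>M y \<in> Pk" if xy: "x \<in> Pk" "y \<in> Pk" for x y
    proof -
      obtain p q where pq: "p \<in> P" "q \<in> P" "x = p *\<^sub>M k" "y = q *\<^sub>M k" using xy by (auto simp: Pk_def)
      then have "x +\<^sub>M y = (p \<oplus> q) *\<^sub>M k" using pP(2) kc by (simp add: smult_l_distr subset_iff)
      then show ?thesis using pP(5) pq by (auto simp: Pk_def)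
    qed
    show "a *\<^sub>M x \<in> Pk" if ax: "a \<in> carrier R" "x \<in> Pk" for a x
    proof -
      obtain p where p: "p \<in> P" "x = p *\<^sub>M k" using ax by (auto simp: Pk_def)
      then have "a *\<^sub>M x = (a \<otimes> p) *\<^sub>M k" using pP(2) kc ax by (simp add: smult_assoc1 subset_iff)
      moreover have "a \<otimes> p \<in> P" using p ax pP(2,4) by blast
      ultimately show ?thesis by (auto simp: Pk_def)
    qed
  qed
  have subT: "sub (L' +\<^sub>S Pk)" by (intro sub_ssum L' Pk)
  let ?T = "saturation R M P (L' +\<^sub>S Pk)"
  have "K \<subseteq> ?T"
  proof (rule step)
    show "sub ?T" "saturated R M P ?T" using sub_saturation[OF P subT] saturated_saturation[OF P] by auto
    show "L \<subseteq> ?T" using L'(3) ssum_ge(1)[OF L'(1) Pk] saturation_ge[OF P subT] by blast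
    fix p k' assume p: "p \<in> P" and k': "k' \<in> K"
    then obtain s where s: "s \<in> carrier R" "s \<notin> P" "k' \<in> carrier M" "s *\<^sub>M k' \<in> L' +\<^sub>S cyclic k"
      using Kin by (auto simp: saturation_def)
    then obtain l r where lr: "l \<in> L'" "r \<in> carrier R" "s *\<^sub>M k' = l +\<^sub>M r *\<^sub>M k"
      by (auto simp: ssum_iff cyclic_def)
    have pc: "p \<in> carrier R" using p pP by blast
    have lc: "l \<in> carrier M" using lr L' sub_carr by blast
    have "s *\<^sub>M p *\<^sub>M k' = p *\<^sub>M s *\<^sub>M k'" using s pc by (simp add: smult_commute)
    also have "\<dots> = p *\<^sub>M l +\<^sub>M (r \<otimes> p) *\<^sub>M k"
      using lr pc kc lc by (simp add: smult_r_distr smult_assoc1 smult_commute)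
    finally have eq: "s *\<^sub>M p *\<^sub>M k' = p *\<^sub>M l +\<^sub>M (r \<otimes> p) *\<^sub>M k" .
    have "p *\<^sub>M l \<in> L'" using lr L' pc subD(5) by blast
    moreover have "r \<otimes> p \<in> P" using p pc lr pP(4) by blast
    ultimately have "s *\<^sub>M p *\<^sub>M k' \<in> L' +\<^sub>S Pk" unfolding eq ssum_iff Pk_def by blast
    then show "p *\<^sub>M k' \<in> ?T" using s pc by (intro saturationI[of s]) auto
  qed
  then obtain s where s: "s \<in> carrier R" "s \<notin> P" "s *\<^sub>M k \<in> L' +\<^sub>S Pk"
    using k by (auto simp: saturation_def)
  then obtain l p where lpk: "l \<in> L'" "p \<in> P" "s *\<^sub>M k = l +\<^sub>M p *\<^sub>M k" by (auto simp: ssum_iff Pk_def)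
  have lc: "l \<in> carrier M" and pc: "p \<in> carrier R" using lpk L' sub_carr pP by blast+
  \<comment> \<open>The case of one generator: sk = l + pk means (s - p)k = l, and s - p is outside
    P, so saturation of \<open>L'\<close> puts k into \<open>L'\<close>.\<close>
  have "(s \<ominus> p) *\<^sub>M k = l"
    using s lpk pc kc lc madd_minus_cancel(2)[of l "p *\<^sub>M k"] by (simp add: smult_minus_l)
  moreover have "s \<ominus> p \<notin> P"
  proof
    assume "s \<ominus> p \<in> P"
    then have "(s \<ominus> p) \<oplus> p \<in> P" using lpk pP by blast
    moreover have "(s \<ominus> p) \<oplus> p = s" using s pc by (simp add: a_minus_def R.a_assoc R.l_neg)
    ultimately show False using s by simp
  qed
  ultimately show False using saturatedD[OF L'(2) _ _ kc, of "s \<ominus> p"] lpk s pc k by simp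
qed

text \<open>Regarding R as a module over itself makes saturation and length available for ideals, as
  the principal ideal theorem requires.\<close>

definition self_module :: "('a, 'r) ring_scheme \<Rightarrow> ('a, 'a) module" where
  "self_module R = \<lparr>carrier = carrier R, monoid.mult = monoid.mult R, one = one R, zero = zero R,
     add = add R, smult = monoid.mult R\<rparr>"

lemma self_module_simps [simp]:
  "carrier (self_module R) = carrier R" "zero (self_module R) = zero R" "add (self_module R) = add R"
  "smult (self_module R) = monoid.mult R"
  by (auto simp: self_module_def)

context noeth_cring
begin

lemma self_module_is_module: "module R (self_module R)"
proof (rule moduleI)
  show "abelian_group (self_module R)"
    by (rule abelian_groupI) (auto simp: a_ac intro: l_neg exI[of _ "\<ominus> _"] bexI[of _ "\<ominus> _"])
qed (auto simp: l_distr r_distr m_assoc is_cring)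

lemma self_submodule_iff: "submodule I R (self_module R) \<longleftrightarrow> ideal I R"
proof
  interpret S: module R "self_module R" by (rule self_module_is_module)
  show "ideal I R" if "submodule I R (self_module R)"
    using S.subD[OF that] by (intro cr_idealI) auto
  show "submodule I R (self_module R)" if "ideal I R"
    using ideal_closed[OF that] by (intro S.subI) auto
qed

lemma self_noeth_module: "noeth_module R (self_module R)"
  using self_module_is_module noeth_cring_axioms wf_ideals
  by (simp add: noeth_module_def noeth_module_axioms_def self_submodule_iff)

text \<open>
  In place of the symbolic powers of \<open>Q\<close> in Krull's proof it suffices to take the \<open>Q\<close>-saturations of the powers
  of a single element \<open>y \<in> Q - P\<^sub>0\<close>.
\<close>

lemma principal_ideal_theorem:
  assumes pr: "primeideal P\<^sub>0 R" "primeideal Q R" "primeideal P R"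
    and lt: "P\<^sub>0 \<subset> Q" "Q \<subset> P" and x: "x \<in> P"
  shows "\<exists>p. primeideal p R \<and> P\<^sub>0 \<subset> p \<and> p \<subset> P \<and> x \<in> p"
proof (rule ccontr)
  assume contra: "\<not> ?thesis"
  interpret S: noeth_module R "self_module R" by (rule self_noeth_module)
  let ?S = "self_module R"
  note p0 = primeE[OF pr(1)] and q = primeE[OF pr(2)] and p = primeE[OF pr(3)]
  have xQ: "x \<notin> Q" using contra pr lt by blast
  have xc: "x \<in> carrier R" using x p by blast
  obtain y where y: "y \<in> Q" "y \<notin> P\<^sub>0" using lt by blast
  have yc: "y \<in> carrier R" using y q by blast
  define B where "B n = S.cyclic (y [^] (n::nat)) <+>\<^bsub>?S\<^esub> P\<^sub>0" for n
  define Qn where "Qn n = saturation R ?S Q (B n)" for n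
  define J where "J = saturation R ?S P (P\<^sub>0 <+>\<^bsub>?S\<^esub> S.cyclic x)"
  define A where "A n = saturation R ?S P (Qn n <+>\<^bsub>?S\<^esub> S.cyclic x)" for n
  have subs: "S.sub P\<^sub>0" "S.sub Q" "S.sub P" using pr by (auto simp: self_submodule_iff primeideal.axioms)
  have subc: "S.sub (S.cyclic x)" "S.sub (S.cyclic (y [^] (n::nat)))" for n using xc yc by (auto intro: S.sub_cyclic)
  have subB: "S.sub (B n)" for n unfolding B_def by (intro S.sub_ssum subs subc)
  have Qn: "S.sub (Qn n)" "saturated R ?S Q (Qn n)" for n
    unfolding Qn_def using S.sub_saturation[OF pr(2) subB] S.saturated_saturation[OF pr(2)] by auto
  have QnP: "saturated R ?S P (Qn n)" for n using Qn(2)[of n] lt by (auto simp: saturated_def)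
  have subQx: "S.sub (Qn n <+>\<^bsub>?S\<^esub> S.cyclic x)" for n by (intro S.sub_ssum Qn subc)
  have subPx: "S.sub (P\<^sub>0 <+>\<^bsub>?S\<^esub> S.cyclic x)" by (intro S.sub_ssum subs subc)
  have A: "S.sub (A n)" "saturated R ?S P (A n)" for n
    unfolding A_def using S.sub_saturation[OF pr(3) subQx] S.saturated_saturation[OF pr(3)] by auto
  have J: "S.sub J" "saturated R ?S P J"
    unfolding J_def using S.sub_saturation[OF pr(3) subPx] S.saturated_saturation[OF pr(3)] by auto
  have clo_mono: "saturation R ?S P' X \<subseteq> saturation R ?S P' Y" if "X \<subseteq> Y" for X Y P' using that by (auto simp: saturation_def)
  have "B (Suc n) \<subseteq> B n" for n
  proof -
    have "S.cyclic (y [^] (Suc n)) \<subseteq> S.cyclic (y [^] n)"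
      using S.subD(5)[OF subc(2)[of n] yc S.cyclic_self[of "y [^] n"]] yc
      by (intro S.cyclic_le subc) (simp add: m_comm)
    then show ?thesis unfolding B_def by (intro S.ssum_mono) auto
  qed
  then have QnS: "Qn (Suc n) \<subseteq> Qn n" for n unfolding Qn_def by (rule clo_mono)
  have AS: "A (Suc n) \<subseteq> A n" for n
    unfolding A_def by (intro clo_mono S.ssum_mono QnS subset_refl)
  have "P\<^sub>0 \<subseteq> Qn n" for n
    unfolding Qn_def B_def using S.ssum_ge(2)[OF subc(2) subs(1)] S.saturation_ge[OF pr(2) subB, unfolded B_def] by blast
  then have JA: "J \<subseteq> A n" for n
    unfolding J_def A_def by (intro clo_mono S.ssum_mono) auto
  have PxJ: "P\<^sub>0 \<subseteq> J" "x \<in> J"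
    unfolding J_def using S.ssum_ge[OF subs(1) subc(1)] S.saturation_ge[OF pr(3) subPx] S.cyclic_self[of x] xc by auto
  \<comment> \<open>P is minimal over J: a prime inside P that contains J contains x and therefore
    differs from \<open>P\<^sub>0\<close>, and then the assumed failure of the theorem leaves only
    P.\<close>
  have "sat_len R ?S P J (carrier R) < \<infinity>"
  proof (rule S.len_finite[OF pr(3) J])
    show "S.sub (carrier R)" using S.carrier_is_submodule by simp
    show "saturated R ?S P (carrier R)" by (auto simp: saturated_def)
    show "J \<subseteq> carrier R" using S.subD(1)[OF J(1)] by simp
    fix p assume p': "primeideal p R" "colon R ?S J (carrier R) \<subseteq> p" "p \<subseteq> P"
    have "J \<subseteq> colon R ?S J (carrier R)"
      using S.subD(1,5)[OF J(1)] m_comm by (fastforce simp: colon_def subset_iff)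
    then have "P\<^sub>0 \<subseteq> p" "x \<in> p" using PxJ p' by auto
    moreover have "x \<notin> P\<^sub>0" using xQ lt by blast
    ultimately show "p = P" using contra p' by blast
  qed
  moreover have "A 0 \<subseteq> carrier R" using S.subD(1)[OF A(1)] by simp
  ultimately have "sat_len R ?S P J (A 0) < \<infinity>"
    by (intro order_le_less_trans[OF len_mono[of J J "A 0" "carrier R"]]) auto
  then obtain n where n: "A (Suc n) = A n" using S.dcc[of A P J] A AS JA J by blast
  \<comment> \<open>From \<open>A (Suc n) = A n\<close>, every t in \<open>Qn n\<close> satisfies st
    = u + rx with s outside P and u in \<open>Qn (Suc n)\<close>. As x is outside Q and
    \<open>Qn n\<close> is Q-saturated, r is again in \<open>Qn n\<close>. Locally at P this reads
    \<open>Qn n\<close> = \<open>Qn (Suc n)\<close> + x \<open>Qn n\<close>, the situation of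
    Nakayama's lemma.\<close>
  have "Qn n \<subseteq> Qn (Suc n)"
  proof (rule S.nakayama[OF pr(3) Qn(1) QnP])
    show "Qn n \<subseteq> carrier ?S" using S.subD(1)[OF Qn(1)] .
    fix T assume T: "S.sub T" "saturated R ?S P T" "Qn (Suc n) \<subseteq> T"
      "\<And>p k. p \<in> P \<Longrightarrow> k \<in> Qn n \<Longrightarrow> p \<odot>\<^bsub>?S\<^esub> k \<in> T"
    show "Qn n \<subseteq> T"
    proof
      fix t assume t: "t \<in> Qn n"
      have tc: "t \<in> carrier R" using t S.subD(1)[OF Qn(1)] by auto
      have "Qn n \<subseteq> A n" unfolding A_def
        using S.ssum_ge(1)[OF Qn(1) subc(1)] S.saturation_ge[OF pr(3) subQx] by blast
      then have "t \<in> saturation R ?S P (Qn (Suc n) <+>\<^bsub>?S\<^esub> S.cyclic x)" using n t by (auto simp: A_def)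
      then obtain s where s: "s \<in> carrier R" "s \<notin> P" "s \<otimes> t \<in> Qn (Suc n) <+>\<^bsub>?S\<^esub> S.cyclic x"
        by (auto simp: saturation_def)
      then obtain u r where ur: "u \<in> Qn (Suc n)" "r \<in> carrier R" "s \<otimes> t = u \<oplus> r \<otimes> x"
        by (auto simp: S.ssum_iff S.cyclic_def)
      have uc: "u \<in> carrier R" using ur(1) S.subD(1)[OF Qn(1)] by auto
      have "u \<oplus> r \<otimes> x \<in> Qn n" using S.subD(5)[OF Qn(1) s(1) t] ur(3) by simp
      then have "r \<otimes> x \<in> Qn n" using S.sub_diff1[OF Qn(1), of u n "r \<otimes> x"] QnS ur xc by auto
      then have "r \<in> Qn n" using S.saturatedD[OF Qn(2) xc xQ, of r n] ur xc by (simp add: m_comm)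
      then have "x \<otimes> r \<in> T" using T(4)[OF x] by simp
      then have "u \<oplus> r \<otimes> x \<in> T" using S.subD(3)[OF T(1)] T(3) ur xc by (auto simp: m_comm)
      then have "s \<odot>\<^bsub>?S\<^esub> t \<in> T" using ur(3) by simp
      then show "t \<in> T" using S.saturatedD[OF T(2) s(1,2)] tc by simp
    qed
  qed
  moreover have "y [^] n \<in> Qn n"
  proof -
    have "y [^] n \<in> B n" unfolding B_def
      using S.ssum_ge(1)[OF subc(2) subs(1)] S.cyclic_self[of "y [^] n"] yc by auto
    then show ?thesis unfolding Qn_def using S.saturation_ge[OF pr(2) subB] by blast
  qed
  ultimately have "y [^] n \<in> Qn (Suc n)" by blast
  then obtain s where s: "s \<in> carrier R" "s \<notin> Q" "s \<otimes> y [^] n \<in> B (Suc n)" by (auto simp: Qn_def saturation_def)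
  then obtain r w where rw: "r \<in> carrier R" "w \<in> P\<^sub>0" "s \<otimes> y [^] n = r \<otimes> y [^] (Suc n) \<oplus> w"
    unfolding B_def by (auto simp: S.ssum_iff S.cyclic_def)
  have wc: "w \<in> carrier R" using rw p0 by blast
  \<comment> \<open>Cancelling y^n, which is outside the prime \<open>P\<^sub>0\<close>, puts s - ry
    into \<open>P\<^sub>0\<close> and hence s into Q, against the choice of s.\<close>
  have "(s \<ominus> r \<otimes> y) \<otimes> y [^] n = s \<otimes> y [^] n \<ominus> r \<otimes> y [^] (Suc n)"
    using s rw yc by (simp add: a_minus_def l_distr l_minus m_assoc m_comm[of "y [^] n" y])
  also have "\<dots> = w" using rw(1,3) wc yc by (simp add: add_minus_cancel)
  finally have "(s \<ominus> r \<otimes> y) \<otimes> y [^] n \<in> P\<^sub>0" using rw by simp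
  moreover have "y [^] n \<notin> P\<^sub>0" using prime_pow[OF pr(1) yc] y by blast
  ultimately have "s \<ominus> r \<otimes> y \<in> P\<^sub>0" using p0(4)[of "s \<ominus> r \<otimes> y" "y [^] n"] s rw yc by simp
  then have "s \<ominus> r \<otimes> y \<in> Q" using lt by blast
  moreover have "r \<otimes> y \<in> Q" using y rw yc q(4) by blast
  ultimately have "(s \<ominus> r \<otimes> y) \<oplus> r \<otimes> y \<in> Q" using q(5) by blast
  moreover have "(s \<ominus> r \<otimes> y) \<oplus> r \<otimes> y = s" using s rw yc by (simp add: a_minus_def a_assoc l_neg)
  ultimately show False using s by simp
qed

end

section \<open>Prime avoidance and chains of primes\<close>

context cring
begin

text \<open>A product of elements of the \<open>I f\<close>, each outside p, is outside p.
  Equivalently, a prime containing a finite intersection of ideals contains one of them.\<close>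

lemma prime_separation:
  assumes "finite F" "primeideal p R" "\<And>f. f \<in> F \<Longrightarrow> ideal (I f) R" "\<And>f. f \<in> F \<Longrightarrow> \<not> I f \<subseteq> p"
  shows "\<exists>a\<in>carrier R. a \<notin> p \<and> (\<forall>f\<in>F. a \<in> I f)"
  using assms(1,3,4)
proof (induction F rule: finite_induct)
  case empty
  then show ?case using primeE(1)[OF assms(2)] by blast
next
  case (insert g F)
  then obtain a where a: "a \<in> carrier R" "a \<notin> p" "\<forall>f\<in>F. a \<in> I f" by auto
  obtain b where b: "b \<in> I g" "b \<notin> p" using insert.prems(2)[of g] by auto
  have bc: "b \<in> carrier R" using b insert.prems(1)[of g] ideal_closed(1) by auto
  have "a \<otimes> b \<notin> p" using primeE(4)[OF assms(2)] a b bc by blast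
  moreover have "a \<otimes> b \<in> I f" if "f \<in> insert g F" for f
    using that ideal_closed(4,5)[OF insert.prems(1)[OF that]] a b bc by auto
  ultimately show ?case using a bc by (intro bexI[of _ "a \<otimes> b"]) auto
qed

text \<open>Ordinary prime avoidance is the case \<open>x = 0\<close>.\<close>

lemma prime_avoidance_coset:
  assumes "finite \<P>" "\<And>p. p \<in> \<P> \<Longrightarrow> primeideal p R" "ideal J R" "x \<in> carrier R"
    and "\<And>p. p \<in> \<P> \<Longrightarrow> x \<in> p \<Longrightarrow> \<not> J \<subseteq> p"
  shows "\<exists>c\<in>J. \<forall>p\<in>\<P>. x \<oplus> c \<notin> p"
  using assms(1,2,5)
proof (induction "card \<P>" arbitrary: \<P>)
  case 0
  then show ?case using ideal_closed(2)[OF assms(3)] by auto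
next
  case (Suc k)
  then have "\<P> \<noteq> {}" by auto
  \<comment> \<open>A minimal member contains no other member, so that some element lies in all the
    others and outside p.\<close>
  then obtain p where p: "p \<in> \<P>" and min: "\<And>q. q \<in> \<P> \<Longrightarrow> q \<subseteq> p \<Longrightarrow> q = p"
    using finite_has_minimal[OF Suc.prems(1)] by metis
  have pp: "primeideal p R" using Suc.prems p by blast
  have "card (\<P> - {p}) = k" using Suc.hyps(2) p Suc.prems(1) by simp
  then obtain c where c: "c \<in> J" "\<forall>q\<in>\<P> - {p}. x \<oplus> c \<notin> q" using Suc.hyps(1)[of "\<P> - {p}"] Suc.prems by auto
  have Jc: "J \<subseteq> carrier R" using ideal_closed(1)[OF assms(3)] .
  show ?case
  proof (cases "x \<oplus> c \<in> p")
    case False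
    then show ?thesis using c by auto
  next
    case True
    have "\<not> J \<subseteq> p"
    proof
      assume J: "J \<subseteq> p"
      then have "(x \<oplus> c) \<ominus> c \<in> p" using c primeE(6)[OF pp True] by blast
      moreover have "(x \<oplus> c) \<ominus> c = x" using c Jc assms(4) by (auto simp: a_minus_def a_assoc r_neg subset_iff)
      ultimately show False using Suc.prems(3)[OF p] J by simp
    qed
    then obtain b where b: "b \<in> J" "b \<notin> p" by blast
    have "\<exists>a\<in>carrier R. a \<notin> p \<and> (\<forall>q\<in>\<P> - {p}. a \<in> q)"
      by (rule prime_separation) (use Suc.prems(1,2) pp min in \<open>auto intro: primeideal.axioms(1)\<close>)
    then obtain a where a: "a \<in> carrier R" "a \<notin> p" "\<forall>q\<in>\<P> - {p}. a \<in> q" by blast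
    have bc: "b \<in> carrier R" "c \<in> carrier R" using b c Jc by auto
    \<comment> \<open>The correction ab lies in every other member and outside p: it moves x + c out
      of p and keeps its class modulo the other primes.\<close>
    have e: "a \<otimes> b \<in> J" using a b ideal_closed(4)[OF assms(3)] by blast
    have "x \<oplus> (c \<oplus> a \<otimes> b) \<notin> q" if q: "q \<in> \<P>" for q
    proof
      have qp: "primeideal q R" using Suc.prems q by blast
      have eq: "x \<oplus> (c \<oplus> a \<otimes> b) = (x \<oplus> c) \<oplus> a \<otimes> b" using a bc assms(4) by (simp add: a_assoc)
      assume "x \<oplus> (c \<oplus> a \<otimes> b) \<in> q"
      then have in_q: "(x \<oplus> c) \<oplus> a \<otimes> b \<in> q" using eq by simp
      show False
      proof (cases "q = p")
        case True
        then have "((x \<oplus> c) \<oplus> a \<otimes> b) \<ominus> (x \<oplus> c) \<in> p" using \<open>x \<oplus> c \<in> p\<close> in_q primeE(6)[OF pp] by blast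
        moreover have "((x \<oplus> c) \<oplus> a \<otimes> b) \<ominus> (x \<oplus> c) = a \<otimes> b" using a bc assms(4)
          by (simp add: add_minus_cancel)
        ultimately show False using primeE(4)[OF pp] a b bc by auto
      next
        case False
        then have "a \<otimes> b \<in> q" using a q primeE(4)[OF qp] bc by blast
        then have "((x \<oplus> c) \<oplus> a \<otimes> b) \<ominus> a \<otimes> b \<in> q" using in_q primeE(6)[OF qp] by blast
        moreover have "((x \<oplus> c) \<oplus> a \<otimes> b) \<ominus> a \<otimes> b = x \<oplus> c" using a bc assms(4)
          by (simp add: a_minus_def a_assoc r_neg)
        ultimately show False using c False q by auto
      qed
    qed
    then show ?thesis using e c ideal_closed(3)[OF assms(3)] by (intro bexI[of _ "c \<oplus> a \<otimes> b"]) auto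
  qed
qed

lemma Idl_le: "ideal J R \<Longrightarrow> S \<subseteq> J \<Longrightarrow> Idl S \<subseteq> J"
  by (rule genideal_minimal)

text \<open>The factors are treated one at a time: the elements multiplying b into I form an ideal
  containing I and a, and for each such x the elements multiplied into I by x form an ideal
  containing I and b.\<close>

lemma ideal_prod_insert_subset:
  assumes I: "ideal I R" and a: "a \<in> carrier R" and b: "b \<in> carrier R" and ab: "a \<otimes> b \<in> I"
    and xy: "x \<in> Idl (insert a I)" "y \<in> Idl (insert b I)"
  shows "x \<otimes> y \<in> I"
proof -
  note I' = ideal_closed[OF I]
  let ?A = "{u \<in> carrier R. u \<otimes> b \<in> I}"
  have "ideal ?A R"
  proof (rule cr_idealI)
    show "u \<oplus> v \<in> ?A" if "u \<in> ?A" "v \<in> ?A" for u v using that b I'(3) by (simp add: l_distr)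
    show "u \<otimes> v \<in> ?A" if "u \<in> carrier R" "v \<in> ?A" for u v using that b I'(4) by (simp add: m_assoc)
  qed (use b I' in auto)
  moreover have "insert a I \<subseteq> ?A" using a b ab I' by auto
  ultimately have xA: "x \<in> ?A" using xy(1) Idl_le by blast
  let ?B = "{u \<in> carrier R. x \<otimes> u \<in> I}"
  have "ideal ?B R"
  proof (rule cr_idealI)
    show "u \<oplus> v \<in> ?B" if "u \<in> ?B" "v \<in> ?B" for u v using that xA I'(3) by (simp add: r_distr)
    show "u \<otimes> v \<in> ?B" if "u \<in> carrier R" "v \<in> ?B" for u v
      using that xA I'(4) m_lcomm[of x u v] by simp
  qed (use xA I' in auto)
  moreover have "insert b I \<subseteq> ?B" using b xA I' by auto
  ultimately show ?thesis using xy(2) Idl_le by blast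
qed

end

context noeth_cring
begin

text \<open>Noetherian induction. A largest counterexample is neither prime nor the whole ring, so
  it contains some ab with a and b outside. Every prime over it contains a or b, and the finite sets
  for the two enlarged ideals unite to one for I. The set obtained contains all minimal primes over
  I.\<close>

lemma finite_primes_below:
  assumes "ideal I R"
  shows "\<exists>\<P>. finite \<P> \<and> (\<forall>p\<in>\<P>. primeideal p R \<and> I \<subseteq> p) \<and>
    (\<forall>p. primeideal p R \<longrightarrow> I \<subseteq> p \<longrightarrow> (\<exists>q\<in>\<P>. q \<subseteq> p))"
proof (rule ccontr)
  let ?G = "\<lambda>I. \<exists>\<P>. finite \<P> \<and> (\<forall>p\<in>\<P>. primeideal p R \<and> I \<subseteq> p) \<and>
    (\<forall>p. primeideal p R \<longrightarrow> I \<subseteq> p \<longrightarrow> (\<exists>q\<in>\<P>. q \<subseteq> p))"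
  assume "\<not> ?thesis"
  then have "ideal I R \<and> \<not> ?G I" using assms by blast
  then obtain I where I: "ideal I R \<and> \<not> ?G I"
    and max: "\<And>K. ideal K R \<and> \<not> ?G K \<Longrightarrow> I \<subseteq> K \<Longrightarrow> K = I"
    by (rule max_ideal[of "\<lambda>I. ideal I R \<and> \<not> ?G I"]) auto
  then have I: "ideal I R" "\<not> ?G I" by blast+
  have np: "\<not> primeideal I R"
  proof
    assume "primeideal I R"
    then have "?G I" by (intro exI[of _ "{I}"]) auto
    then show False using I by blast
  qed
  have nc: "carrier R \<noteq> I"
  proof
    assume "carrier R = I"
    then have "\<not> I \<subseteq> p" if "primeideal p R" for p
      using primeE(1)[OF that] by auto
    then have "?G I" by (intro exI[of _ "{}"]) auto
    then show False using I by simp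
  qed
  obtain a b where ab: "a \<in> carrier R" "b \<in> carrier R" "a \<otimes> b \<in> I" "a \<notin> I" "b \<notin> I"
    using ideal.primeidealCE[OF I(1) is_cring np] nc by metis
  have sub: "insert a I \<subseteq> carrier R" "insert b I \<subseteq> carrier R" using ab ideal_closed(1)[OF I(1)] by auto
  have id: "ideal (Idl (insert a I)) R" "ideal (Idl (insert b I)) R" using sub genideal_ideal by blast+
  have ge: "insert a I \<subseteq> Idl (insert a I)" "insert b I \<subseteq> Idl (insert b I)" using sub genideal_self by blast+
  have "?G (Idl (insert a I))" using max[of "Idl (insert a I)"] id(1) ge(1) ab by blast
  then obtain A where A: "finite A" "\<forall>p\<in>A. primeideal p R \<and> Idl (insert a I) \<subseteq> p"
      "\<forall>p. primeideal p R \<longrightarrow> Idl (insert a I) \<subseteq> p \<longrightarrow> (\<exists>q\<in>A. q \<subseteq> p)" by blast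
  have "?G (Idl (insert b I))" using max[of "Idl (insert b I)"] id(2) ge(2) ab by blast
  then obtain B where B: "finite B" "\<forall>p\<in>B. primeideal p R \<and> Idl (insert b I) \<subseteq> p"
      "\<forall>p. primeideal p R \<longrightarrow> Idl (insert b I) \<subseteq> p \<longrightarrow> (\<exists>q\<in>B. q \<subseteq> p)" by blast
  have "?G I"
  proof (intro exI conjI allI impI ballI)
    show "finite (A \<union> B)" using A B by simp
    show "primeideal p R" if "p \<in> A \<union> B" for p using that A(2) B(2) by blast
    show "I \<subseteq> p" if "p \<in> A \<union> B" for p
    proof -
      from that have "Idl (insert a I) \<subseteq> p \<or> Idl (insert b I) \<subseteq> p" using A(2) B(2) by blast
      then show ?thesis using ge by blast
    qed
    fix p assume p: "primeideal p R" "I \<subseteq> p"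
    then have "a \<in> p \<or> b \<in> p" using primeE(4)[OF p(1) ab(1,2)] ab by blast
    then have "Idl (insert a I) \<subseteq> p \<or> Idl (insert b I) \<subseteq> p"
      using p Idl_le primeideal.axioms(1)[OF p(1)] by (metis insert_subset)
    then show "\<exists>q\<in>A \<union> B. q \<subseteq> p" using A(3)[rule_format, OF p(1)] B(3)[rule_format, OF p(1)] by (elim disjE) auto
  qed
  then show False using I by blast
qed

text \<open>An ideal maximal among those above I and disjoint from S is prime: adjoining either of
  two elements outside it reaches S, and the product of the two elements of S found this way would
  lie in the ideal.\<close>

lemma prime_in_multiplicative_complement:
  assumes I: "ideal I R" and S: "S \<subseteq> carrier R" "\<one> \<in> S" "\<And>s t. s \<in> S \<Longrightarrow> t \<in> S \<Longrightarrow> s \<otimes> t \<in> S" "I \<inter> S = {}"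
  obtains p where "primeideal p R" "I \<subseteq> p" "p \<inter> S = {}"
proof -
  have "ideal I R \<and> I \<subseteq> I \<and> I \<inter> S = {}" using I S by blast
  then obtain p where p: "ideal p R \<and> I \<subseteq> p \<and> p \<inter> S = {}"
    and max: "\<And>K. ideal K R \<and> I \<subseteq> K \<and> K \<inter> S = {} \<Longrightarrow> p \<subseteq> K \<Longrightarrow> K = p"
    by (rule max_ideal[of "\<lambda>J. ideal J R \<and> I \<subseteq> J \<and> J \<inter> S = {}"]) auto
  then have p: "ideal p R" "I \<subseteq> p" "p \<inter> S = {}" by blast+
  have meets: "\<exists>s\<in>S. s \<in> Idl (insert a p)" if a: "a \<in> carrier R" "a \<notin> p" for a
  proof -
    have sub: "insert a p \<subseteq> carrier R" using a ideal_closed(1)[OF p(1)] by auto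
    have "Idl (insert a p) \<noteq> p" "p \<subseteq> Idl (insert a p)" using genideal_self[OF sub] a by auto
    then show ?thesis using max[of "Idl (insert a p)"] genideal_ideal[OF sub] p by blast
  qed
  have "primeideal p R"
  proof (rule primeidealI[OF p(1) is_cring])
    show "carrier R \<noteq> p" using p S by blast
    fix a b assume ab: "a \<in> carrier R" "b \<in> carrier R" "a \<otimes> b \<in> p"
    show "a \<in> p \<or> b \<in> p"
    proof (rule ccontr)
      assume "\<not> ?thesis"
      then obtain s t where "s \<in> S" "t \<in> S" "s \<in> Idl (insert a p)" "t \<in> Idl (insert b p)"
        using meets[of a] meets[of b] ab by blast
      then have "s \<otimes> t \<in> p" "s \<otimes> t \<in> S" using ideal_prod_insert_subset[OF p(1) ab] S by blast+
      then show False using p by blast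
    qed
  qed
  then show ?thesis using that p by blast
qed

end

section \<open>Chains of primes and the dimension of a local ring\<close>

fun up_chain :: "('a, 'r) ring_scheme \<Rightarrow> nat \<Rightarrow> 'a set \<Rightarrow> bool" where
  "up_chain R 0 p \<longleftrightarrow> primeideal p R"
| "up_chain R (Suc n) p \<longleftrightarrow> primeideal p R \<and> (\<exists>q. p \<subset> q \<and> up_chain R n q)"

lemma up_chain_prime: "up_chain R n p \<Longrightarrow> primeideal p R"
  by (cases n) auto

locale noeth_local = noeth_cring R for R (structure) and \<mm> +
  assumes max_prime: "primeideal \<mm> R" and le_max: "primeideal p R \<Longrightarrow> p \<subseteq> \<mm>"
begin

lemma unit_outside:
  assumes "s \<in> carrier R" "s \<notin> \<mm>"
  obtains t where "t \<in> carrier R" "t \<otimes> s = \<one>"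
proof (cases "\<one> \<in> Idl {s}")
  case True
  have "Idl {s} = PIdl s" using cgenideal_eq_genideal assms by simp
  then show ?thesis using True that by (auto simp: cgenideal_def)
next
  case False
  have sub: "{s} \<subseteq> carrier R" using assms by simp
  have "Idl {s} \<inter> {\<one>} = {}" using False by simp
  then obtain p where "primeideal p R" "Idl {s} \<subseteq> p"
    using prime_in_multiplicative_complement[OF genideal_ideal[OF sub], of "{\<one>}"] by auto
  then show ?thesis using genideal_self[OF sub] le_max assms by blast
qed

text \<open>The principal ideal theorem pulls x down along the chain: once the prime two levels
  above p contains x, the one between can be exchanged for a prime that contains x. The price is one
  step of the chain.\<close>

lemma up_chain_push:
  assumes "up_chain R (Suc n) p" "x \<in> \<mm>"
  shows "\<exists>q. p \<subset> q \<and> x \<in> q \<and> up_chain R n q"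
  using assms(1)
proof (induction n arbitrary: p)
  case 0
  then obtain q where "p \<subset> q" "primeideal q R" by auto
  then have "p \<subset> \<mm>" using le_max by blast
  then show ?case using assms(2) max_prime by auto
next
  case (Suc n)
  then obtain q where q: "p \<subset> q" "up_chain R (Suc n) q" by auto
  have pp: "primeideal p R" using Suc.prems up_chain_prime by blast
  obtain r where r: "q \<subset> r" "x \<in> r" "up_chain R n r" using Suc.IH[OF q(2)] by blast
  obtain q' where "primeideal q' R" "p \<subset> q'" "q' \<subset> r" "x \<in> q'"
    using principal_ideal_theorem[OF pp up_chain_prime[OF q(2)] up_chain_prime[OF r(3)] q(1) r(1,2)] by blast
  then show ?case using r pp by (intro exI[of _ q']) auto
qed

text \<open>Krull's height theorem in the form dim R/I \<le> length xs. Each entry of xs is absorbed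
  into I at the cost of one step, until \<mm> is the only prime left and no step remains.\<close>

lemma up_chain_bound:
  assumes "set xs \<subseteq> \<mm>" "\<And>p. primeideal p R \<Longrightarrow> I \<union> set xs \<subseteq> p \<Longrightarrow> p = \<mm>" "I \<subseteq> p" "up_chain R n p"
  shows "n \<le> length xs"
  using assms
proof (induction xs arbitrary: I n p)
  case Nil
  then have p: "p = \<mm>" by (intro Nil(2) up_chain_prime[OF Nil(4)]) (use Nil(3) in simp)
  show ?case
  proof (cases n)
    case (Suc k)
    then obtain q where "p \<subset> q" "up_chain R k q" using Nil by auto
    then show ?thesis using p le_max up_chain_prime by blast
  qed simp
next
  case (Cons x xs)
  show ?case
  proof (cases n)
    case (Suc k)
    then obtain q where q: "p \<subset> q" "x \<in> q" "up_chain R k q"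
      using up_chain_push[of k p x] Cons.prems by auto
    have "k \<le> length xs"
    proof (rule Cons.IH[of "insert x I" q])
      show "set xs \<subseteq> \<mm>" using Cons.prems by simp
      show "insert x I \<subseteq> q" using q Cons.prems by auto
      show "p' = \<mm>" if "primeideal p' R" "insert x I \<union> set xs \<subseteq> p'" for p'
        using Cons.prems(2)[OF that(1)] that(2) by auto
    qed (use q in auto)
    then show ?thesis using Suc by simp
  qed simp
qed

text \<open>The bound is a number of generators of \<mm>: a largest finitely generated ideal inside
  \<mm> must be \<mm>. Through this, \<open>the_enat\<close> in \<open>filtration_dim\<close> never
  meets an infinite value.\<close>

lemma finite_dimension: "\<exists>s. \<forall>n p. up_chain R n p \<longrightarrow> n \<le> s"
proof -
  have mm: "ideal \<mm> R" "\<mm> \<subseteq> carrier R" using max_prime primeideal.axioms(1) primeE(2) by auto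
  obtain J where J: "\<exists>xs. set xs \<subseteq> \<mm> \<and> J = Idl (set xs)"
    and max: "\<And>K. \<exists>xs. set xs \<subseteq> \<mm> \<and> K = Idl (set xs) \<Longrightarrow> J \<subseteq> K \<Longrightarrow> K = J"
  proof (rule max_ideal[of "\<lambda>J. \<exists>xs. set xs \<subseteq> \<mm> \<and> J = Idl (set xs)"])
    show "\<exists>xs. set xs \<subseteq> \<mm> \<and> Idl {} = Idl (set xs)" by (intro exI[of _ "[]"]) simp
    show "ideal J R" if "\<exists>xs. set xs \<subseteq> \<mm> \<and> J = Idl (set xs)" for J
    proof -
      from that obtain xs where "set xs \<subseteq> \<mm>" "J = Idl (set xs)" by blast
      then show ?thesis using genideal_ideal[of "set xs"] mm by simp
    qed
  qed blast
  from J obtain xs where xs: "set xs \<subseteq> \<mm>" "J = Idl (set xs)" by blast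
  have "\<mm> \<subseteq> J"
  proof
    fix x assume x: "x \<in> \<mm>"
    have sub: "set (x # xs) \<subseteq> carrier R" using x xs mm by auto
    have "J \<subseteq> Idl (set (x # xs))"
      unfolding xs(2) using genideal_self[OF sub] by (intro Idl_le genideal_ideal sub) auto
    then have "Idl (set (x # xs)) = J" using x xs max[of "Idl (set (x # xs))"] by (metis set_ConsD subset_code(1))
    then show "x \<in> J" using genideal_self[OF sub] by auto
  qed
  have "p = \<mm>" if p: "primeideal p R" "{} \<union> set xs \<subseteq> p" for p
  proof -
    have "J \<subseteq> p" unfolding xs(2) using p primeideal.axioms(1) by (intro Idl_le) auto
    then show ?thesis using \<open>\<mm> \<subseteq> J\<close> le_max[OF p(1)] by blast
  qed
  then show ?thesis using up_chain_bound[OF xs(1), of "{}"] by blast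
qed

text \<open>The condition on the j-th ideal concerns only primes p with dim R/p \<ge> j, so the j-th
  entry has to be chosen while the dimension is still j. Hence the entries are found from the last
  to the first; after k choices the remaining dimension is at most d - k.\<close>

lemma parameters_exist:
  assumes I: "I \<subseteq> carrier R" and a: "\<And>j. j \<in> {1..d} \<Longrightarrow> ideal (\<aa> j) R"
    and na: "\<And>j p. j \<in> {1..d} \<Longrightarrow> I \<subseteq> p \<Longrightarrow> up_chain R j p \<Longrightarrow> \<not> \<aa> j \<subseteq> p"
    and top: "\<And>p. I \<subseteq> p \<Longrightarrow> \<not> up_chain R (Suc d) p"
  shows "\<exists>xs. length xs = d \<and> (\<forall>j<d. xs ! j \<in> \<aa> (Suc j)) \<and> (\<forall>p. I \<union> set xs \<subseteq> p \<longrightarrow> \<not> up_chain R 1 p)"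
proof -
  have "\<exists>zs. length zs = k \<and> (\<forall>i<k. zs ! i \<in> \<aa> (Suc (d - k + i))) \<and>
      (\<forall>p. I \<union> set zs \<subseteq> p \<longrightarrow> \<not> up_chain R (Suc (d - k)) p)" if "k \<le> d" for k
    using that
  proof (induction k)
    case 0
    then show ?case using top by simp
  next
    case (Suc k)
    then obtain zs where zs: "length zs = k" "\<forall>i<k. zs ! i \<in> \<aa> (Suc (d - k + i))"
      "\<forall>p. I \<union> set zs \<subseteq> p \<longrightarrow> \<not> up_chain R (Suc (d - k)) p" by auto
    define j where "j = d - k"
    have j: "j \<in> {1..d}" "Suc (d - Suc k) = j" using Suc.prems by (auto simp: j_def)
    have "set zs \<subseteq> carrier R"
    proof
      fix z assume "z \<in> set zs"
      then obtain i where i: "i < k" "z = zs ! i" using zs(1) by (auto simp: in_set_conv_nth)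
      moreover have "Suc (d - k + i) \<in> {1..d}" using i Suc.prems by auto
      ultimately show "z \<in> carrier R" using zs(2) a ideal_closed(1) by blast
    qed
    then have sub: "I \<union> set zs \<subseteq> carrier R" using I by auto
    obtain \<P> where P: "finite \<P>" "\<forall>p\<in>\<P>. primeideal p R \<and> Idl (I \<union> set zs) \<subseteq> p"
      "\<forall>p. primeideal p R \<longrightarrow> Idl (I \<union> set zs) \<subseteq> p \<longrightarrow> (\<exists>q\<in>\<P>. q \<subseteq> p)"
      using finite_primes_below[OF genideal_ideal[OF sub]] by blast
    have P': "I \<union> set zs \<subseteq> p" if "p \<in> \<P>" for p using P(2) that genideal_self[OF sub] by blast
    have "\<exists>c\<in>\<aa> j. \<forall>p\<in>{p \<in> \<P>. up_chain R j p}. \<zero> \<oplus> c \<notin> p"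
      by (rule prime_avoidance_coset) (use P a na j P' in auto)
    moreover have "\<zero> \<oplus> c = c" if "c \<in> \<aa> j" for c using that ideal_closed(1)[OF a[OF j(1)]] by auto
    ultimately obtain c where c: "c \<in> \<aa> j" "\<And>p. p \<in> \<P> \<Longrightarrow> up_chain R j p \<Longrightarrow> c \<notin> p" by fastforce
    show ?case
    proof (intro exI[of _ "c # zs"] conjI allI impI)
      show "length (c # zs) = Suc k" using zs by simp
      fix i assume "i < Suc k"
      then show "(c # zs) ! i \<in> \<aa> (Suc (d - Suc k + i))"
        using zs(2) c(1) j Suc.prems by (cases i) (auto simp: Suc_diff_Suc)
    next
      fix p assume p: "I \<union> set (c # zs) \<subseteq> p"
      show "\<not> up_chain R (Suc (d - Suc k)) p"
      proof
        assume "up_chain R (Suc (d - Suc k)) p"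
        then have up: "up_chain R j p" using j by simp
        have "Idl (I \<union> set zs) \<subseteq> p"
          using p primeideal.axioms(1)[OF up_chain_prime[OF up]] by (intro Idl_le) auto
        then obtain q where q: "q \<in> \<P>" "q \<subseteq> p" using P(3) up_chain_prime[OF up] by blast
        \<comment> \<open>Either p is one of the finitely many primes, which c avoids, or it lies
          strictly above one of them, whose chain would then be longer than the invariant
          permits.\<close>
        show False
        proof (cases "q = p")
          case True
          then show False using c(2)[OF q(1)] up p by auto
        next
          case False
          then have "up_chain R (Suc j) q" using q up P(2) by auto
          then show False using zs(3) P'[OF q(1)] j_def by blast
        qed
      qed
    qed
  qed
  from this[of d] show ?thesis by simp
qed

end

section \<open>Regular sequences on a quotient\<close>

context module
begin

text \<open>For \<open>xs = [x\<^sub>1, \<dots>, x\<^sub>d]\<close>, these are \<open>(x\<^sub>1, \<dots>, x\<^sub>d) N\<close> and \<open>(x\<^sub>1, \<dots>, x\<^sub>d)\<^sup>k N\<close>.\<close>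

fun seq_smult :: "'a list \<Rightarrow> 'c set \<Rightarrow> 'c set" where
  "seq_smult [] N = {0\<^sub>M}"
| "seq_smult (x # xs) N = x *\<^sub>S N +\<^sub>S seq_smult xs N"

fun seq_power :: "'a list \<Rightarrow> nat \<Rightarrow> 'c set \<Rightarrow> 'c set" where
  "seq_power xs 0 N = N"
| "seq_power xs (Suc k) N = seq_smult xs (seq_power xs k N)"

lemma sub_seq_smult: "set xs \<subseteq> carrier R \<Longrightarrow> sub N \<Longrightarrow> sub (seq_smult xs N)"
  by (induction xs) (auto intro: sub_zero sub_ssum sub_scale)

lemma sub_seq_power: "set xs \<subseteq> carrier R \<Longrightarrow> sub N \<Longrightarrow> sub (seq_power xs k N)"
  by (induction k) (auto intro: sub_seq_smult)

lemma seq_smult_le_iff: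
  assumes "set xs \<subseteq> carrier R" "sub N" "sub T"
  shows "seq_smult xs N \<subseteq> T \<longleftrightarrow> (\<forall>x\<in>set xs. \<forall>n\<in>N. x *\<^sub>M n \<in> T)"
  using assms(1)
proof (induction xs)
  case Nil
  then show ?case using assms subD(2) by auto
next
  case (Cons x xs)
  have *: "x *\<^sub>S N \<subseteq> x *\<^sub>S N +\<^sub>S seq_smult xs N" "seq_smult xs N \<subseteq> x *\<^sub>S N +\<^sub>S seq_smult xs N"
    using ssum_ge[OF sub_scale[OF assms(2)] sub_seq_smult[OF _ assms(2)]] Cons.prems by auto
  have "seq_smult (x # xs) N \<subseteq> T \<longleftrightarrow> x *\<^sub>S N \<subseteq> T \<and> seq_smult xs N \<subseteq> T"
    using * ssum_le[OF assms(3), of "x *\<^sub>S N" "seq_smult xs N"] by auto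
  then show ?case using Cons by (auto simp: scale_def)
qed

lemma seq_smult_mem: "set xs \<subseteq> carrier R \<Longrightarrow> sub N \<Longrightarrow> x \<in> set xs \<Longrightarrow> n \<in> N \<Longrightarrow> x *\<^sub>M n \<in> seq_smult xs N"
  using seq_smult_le_iff[of xs N "seq_smult xs N"] sub_seq_smult[of xs N] by blast

lemma seq_smult_le: "set xs \<subseteq> carrier R \<Longrightarrow> sub N \<Longrightarrow> seq_smult xs N \<subseteq> N"
  using seq_smult_le_iff[of xs N N] subD(5)[of N] by blast

lemma seq_smult_mono: "set xs \<subseteq> set ys \<Longrightarrow> set ys \<subseteq> carrier R \<Longrightarrow> sub N \<Longrightarrow> sub K \<Longrightarrow> N \<subseteq> K \<Longrightarrow> seq_smult xs N \<subseteq> seq_smult ys K"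
  using seq_smult_le_iff[of xs N "seq_smult ys K"] sub_seq_smult[of ys K] seq_smult_mem[of ys K] by blast

lemma Idl_smult_mem:
  assumes "set xs \<subseteq> carrier R" "sub N" "c \<in> Idl (set xs)" "n \<in> N"
  shows "c *\<^sub>M n \<in> seq_smult xs N"
proof -
  have "Idl (set xs) \<subseteq> colon R M (seq_smult xs N) N"
    using assms(1) seq_smult_mem[OF assms(1,2)]
    by (intro R.Idl_le colon_ideal sub_seq_smult assms(1,2) subD(1)[OF assms(2)]) (auto simp: colon_def)
  then show ?thesis using assms(3,4) by (auto simp: colon_def)
qed

lemma seq_power_le: "set xs \<subseteq> carrier R \<Longrightarrow> sub N \<Longrightarrow> seq_power xs k N \<subseteq> N"
proof (induction k)
  case (Suc k)
  then show ?case using seq_smult_le[OF Suc.prems(1) sub_seq_power[OF Suc.prems]] by auto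
qed simp

lemma seq_power_dec: "set xs \<subseteq> carrier R \<Longrightarrow> sub N \<Longrightarrow> seq_power xs (Suc k) N \<subseteq> seq_power xs k N"
  using seq_smult_le sub_seq_power by simp

lemma seq_power_mono: "set xs \<subseteq> set ys \<Longrightarrow> set ys \<subseteq> carrier R \<Longrightarrow> sub N \<Longrightarrow> sub K \<Longrightarrow> N \<subseteq> K \<Longrightarrow> seq_power xs k N \<subseteq> seq_power ys k K"
proof (induction k)
  case (Suc k)
  then have "seq_smult xs (seq_power xs k N) \<subseteq> seq_smult ys (seq_power ys k K)" by (intro seq_smult_mono sub_seq_power) auto
  then show ?case by simp
qed simp

lemma seq_smult_carr: "set xs \<subseteq> carrier R \<Longrightarrow> sub N \<Longrightarrow> seq_smult xs N \<subseteq> carrier M"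
  using subD(1) sub_seq_smult by blast

lemma seq_smult_ssum:
  assumes "set xs \<subseteq> carrier R" "sub N" "sub K"
  shows "seq_smult xs (N +\<^sub>S K) = seq_smult xs N +\<^sub>S seq_smult xs K"
proof (rule equalityI)
  have s: "sub (seq_smult xs N)" "sub (seq_smult xs K)" using assms sub_seq_smult by auto
  show "seq_smult xs (N +\<^sub>S K) \<subseteq> seq_smult xs N +\<^sub>S seq_smult xs K"
    unfolding seq_smult_le_iff[OF assms(1) sub_ssum[OF assms(2,3)] sub_ssum[OF s]]
  proof (intro ballI)
    fix x n assume x: "x \<in> set xs" and "n \<in> N +\<^sub>S K"
    then obtain a b where ab: "a \<in> N" "b \<in> K" "n = a +\<^sub>M b" by (auto simp: ssum_iff)
    then have "x *\<^sub>M n = x *\<^sub>M a +\<^sub>M x *\<^sub>M b" using x assms sub_carr smult_r_distr by blast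
    then show "x *\<^sub>M n \<in> seq_smult xs N +\<^sub>S seq_smult xs K"
      unfolding ssum_iff using seq_smult_mem[OF assms(1,2) x ab(1)] seq_smult_mem[OF assms(1,3) x ab(2)] by blast
  qed
  show "seq_smult xs N +\<^sub>S seq_smult xs K \<subseteq> seq_smult xs (N +\<^sub>S K)"
    using assms by (intro ssum_le sub_seq_smult sub_ssum seq_smult_mono ssum_ge) auto
qed

lemma seq_smult_sc:
  assumes "set xs \<subseteq> carrier R" "sub N" "a \<in> carrier R"
  shows "seq_smult xs (a *\<^sub>S N) = a *\<^sub>S seq_smult xs N"
  using assms(1)
proof (induction xs)
  case Nil
  then show ?case using assms by (simp add: scale_def)
next
  case (Cons x xs)
  have "x *\<^sub>S N \<subseteq> carrier M" using assms Cons.prems subD(1) sub_scale by simp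
  then show ?case
    using Cons assms by (simp add: scale_ssum seq_smult_carr scale_scale_commute[of N x a] subD(1))
qed

lemma seq_smult_append:
  assumes "set xs \<subseteq> carrier R" "set ys \<subseteq> carrier R" "sub N"
  shows "seq_smult (xs @ ys) N = seq_smult xs N +\<^sub>S seq_smult ys N"
proof (rule equalityI)
  have s: "sub (seq_smult xs N)" "sub (seq_smult ys N)" using assms sub_seq_smult by auto
  show "seq_smult (xs @ ys) N \<subseteq> seq_smult xs N +\<^sub>S seq_smult ys N"
    by (subst seq_smult_le_iff)
      (use assms s ssum_ge[OF s] seq_smult_mem[OF assms(1,3)] seq_smult_mem[OF assms(2,3)] in \<open>auto intro: sub_ssum\<close>)
  show "seq_smult xs N +\<^sub>S seq_smult ys N \<subseteq> seq_smult (xs @ ys) N"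
    using assms by (intro ssum_le sub_seq_smult seq_smult_mono) auto
qed

text \<open>Separates the monomials of degree k + 1 divisible by x from those in xs alone. The
  inductions on the number of generators rest on this decomposition.\<close>

lemma seq_power_Cons:
  assumes "set (x # xs) \<subseteq> carrier R" "sub N"
  shows "seq_power (x # xs) (Suc k) N = x *\<^sub>S seq_power (x # xs) k N +\<^sub>S seq_power xs (Suc k) N"
proof (induction k)
  case (Suc k)
  let ?Q = "\<lambda>k. seq_power (x # xs) k N"
  have xs: "set xs \<subseteq> carrier R" "x \<in> carrier R" using assms by auto
  have Q: "sub (?Q k)" for k using sub_seq_power[OF assms] .
  have J: "sub (seq_power xs k N)" for k using sub_seq_power[OF xs(1) assms(2)] .
  have "?Q (Suc (Suc k)) = x *\<^sub>S ?Q (Suc k) +\<^sub>S seq_smult xs (x *\<^sub>S ?Q k +\<^sub>S seq_power xs (Suc k) N)"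
    using Suc by (metis seq_power.simps(2) seq_smult.simps(2))
  also have "seq_smult xs (x *\<^sub>S ?Q k +\<^sub>S seq_power xs (Suc k) N) = x *\<^sub>S seq_smult xs (?Q k) +\<^sub>S seq_power xs (Suc (Suc k)) N"
    unfolding seq_smult_ssum[OF xs(1) sub_scale[OF Q xs(2)] J] seq_smult_sc[OF xs(1) Q xs(2)] by (simp only: seq_power.simps)
  also have "x *\<^sub>S ?Q (Suc k) +\<^sub>S (x *\<^sub>S seq_smult xs (?Q k) +\<^sub>S seq_power xs (Suc (Suc k)) N) =
     (x *\<^sub>S ?Q (Suc k) +\<^sub>S x *\<^sub>S seq_smult xs (?Q k)) +\<^sub>S seq_power xs (Suc (Suc k)) N"
    by (intro ssum_assoc[symmetric] subD(1) sub_scale sub_seq_smult Q J xs)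
  also have "x *\<^sub>S ?Q (Suc k) +\<^sub>S x *\<^sub>S seq_smult xs (?Q k) = x *\<^sub>S ?Q (Suc k)"
  proof (rule ssum_absorb)
    have "seq_smult xs (?Q k) \<subseteq> seq_smult (x # xs) (?Q k)" using assms by (intro seq_smult_mono Q) auto
    then show "x *\<^sub>S seq_smult xs (?Q k) \<subseteq> x *\<^sub>S ?Q (Suc k)" by (intro scale_mono) simp
  qed (intro sub_scale sub_seq_smult Q xs)+
  finally show ?case .
qed simp

text \<open>
  \<open>xs\<close> is regular on \<open>N / L\<close>, except that \<open>N / (L + (xs) N)\<close> may vanish.
\<close>

fun regular_mod :: "'c set \<Rightarrow> 'c set \<Rightarrow> 'a list \<Rightarrow> bool" where
  "regular_mod L N [] \<longleftrightarrow> True"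
| "regular_mod L N (x # xs) \<longleftrightarrow> (\<forall>n\<in>N. x *\<^sub>M n \<in> L \<longrightarrow> n \<in> L) \<and> regular_mod (L +\<^sub>S x *\<^sub>S N) N xs"

lemma regular_mod_append:
  assumes "set xs \<subseteq> carrier R" "sub L" "sub N"
  shows "regular_mod L N (xs @ ys) \<longleftrightarrow> regular_mod L N xs \<and> regular_mod (L +\<^sub>S seq_smult xs N) N ys"
  using assms(1,2)
proof (induction xs arbitrary: L)
  case Nil
  then show ?case using ssum_zero by simp
next
  case (Cons x xs)
  have "L +\<^sub>S x *\<^sub>S N +\<^sub>S seq_smult xs N = L +\<^sub>S seq_smult (x # xs) N"
    using Cons.prems assms(3) sub_scale sub_seq_smult by (simp add: ssum_assoc subD(1))
  moreover have "sub (L +\<^sub>S x *\<^sub>S N)" using Cons.prems assms(3) sub_scale sub_ssum by simp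
  ultimately show ?case using Cons by simp
qed

end

section \<open>Nilpotency, Krull's intersection theorem and permutation of regular sequences over a
  local ring\<close>

locale local_module = module R M + noeth_local R \<mm> for R (structure) and M (structure) and \<mm>
begin

lemma mm_carr: "\<mm> \<subseteq> carrier R"
  using R.primeE(2)[OF max_prime] .

lemma saturated_max:
  assumes "sub L"
  shows "saturated R M \<mm> L"
  unfolding saturated_def
proof (intro ballI impI)
  fix s n assume s: "s \<in> carrier R - \<mm>" "n \<in> carrier M" "s *\<^sub>M n \<in> L"
  then obtain t where t: "t \<in> carrier R" "t \<otimes> s = \<one>" using unit_outside by blast
  have "t *\<^sub>M s *\<^sub>M n \<in> L" using subD(5)[OF assms t(1) s(3)] .
  then show "n \<in> L" using s t smult_assoc1[of t s n] by simp
qed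

end

locale noeth_local_module = noeth_module R M + local_module R M \<mm> for R (structure) and M (structure) and \<mm>
begin

lemma local_nakayama:
  assumes "sub L" "K \<subseteq> carrier M"
    and "\<And>T. sub T \<Longrightarrow> L \<subseteq> T \<Longrightarrow> (\<And>p k. p \<in> \<mm> \<Longrightarrow> k \<in> K \<Longrightarrow> p *\<^sub>M k \<in> T) \<Longrightarrow> K \<subseteq> T"
  shows "K \<subseteq> L"
  using nakayama[OF max_prime assms(1) saturated_max[OF assms(1)] assms(2)] assms(3) by blast

abbreviation qlen :: "'c set \<Rightarrow> 'c set \<Rightarrow> enat" where "qlen \<equiv> sat_len R M \<mm>"

lemma qlen_add: "sub L \<Longrightarrow> sub K \<Longrightarrow> sub N \<Longrightarrow> L \<subseteq> K \<Longrightarrow> K \<subseteq> N \<Longrightarrow> qlen L N = qlen L K + qlen K N"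
  by (rule len_add[OF max_prime]) (auto intro: saturated_max)

lemma qlen_finite:
  assumes "sub L" "sub N" "L \<subseteq> N" "\<And>p. primeideal p R \<Longrightarrow> colon R M L N \<subseteq> p \<Longrightarrow> p = \<mm>"
  shows "qlen L N < \<infinity>"
  by (rule len_finite[OF max_prime]) (use assms saturated_max in auto)

lemma qlen_eq_0: "sub L \<Longrightarrow> sub N \<Longrightarrow> L \<subseteq> N \<Longrightarrow> qlen L N = 0 \<Longrightarrow> L = N"
  by (rule len_eq_0) (auto intro: saturated_max)

lemma acc:
  assumes "\<And>n. sub (A n)" "\<And>n. A n \<subseteq> A (Suc n)"
  shows "\<exists>n. A (Suc n) = A (n::nat)"
proof -
  obtain N where N: "\<exists>n. N = A n" and max: "\<And>K. \<exists>n. K = A n \<Longrightarrow> N \<subseteq> K \<Longrightarrow> K = N"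
    using max_sub[of "\<lambda>N. \<exists>n. N = A n" "A 0"] assms(1) by metis
  then obtain n where "N = A n" by blast
  then show ?thesis using max[of "A (Suc n)"] assms(2)[of n] by auto
qed

text \<open>The descending submodules L + a^j N repeat at some j. Then a^j N is contained in L plus
  a times itself, and Nakayama's lemma puts it into L.\<close>

lemma finite_length_power:
  assumes "sub L" "sub N" "L \<subseteq> N" "qlen L N < \<infinity>" "a \<in> \<mm>"
  shows "\<exists>j::nat. \<forall>n\<in>N. a [^] j *\<^sub>M n \<in> L"
proof -
  have a: "a \<in> carrier R" using assms mm_carr by blast
  define A where "A j = L +\<^sub>S a [^] (j::nat) *\<^sub>S N" for j
  have subA: "sub (A j)" for j unfolding A_def using assms a by (intro sub_ssum sub_scale) auto
  have dec: "A (Suc j) \<subseteq> A j" for j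
  proof -
    have "a [^] Suc j *\<^sub>M n = a [^] j *\<^sub>M a *\<^sub>M n" if "n \<in> N" for n
      using a sub_carr[OF assms(2) that] by (simp add: smult_assoc1)
    then have "a [^] Suc j *\<^sub>S N \<subseteq> a [^] j *\<^sub>S N"
      unfolding scale_def using subD(5)[OF assms(2) a] by fastforce
    then show ?thesis unfolding A_def by (intro ssum_mono) auto
  qed
  have "A 0 \<subseteq> N" unfolding A_def using assms a scale_le[OF assms(2), of "a [^] (0::nat)"] by (intro ssum_le) auto
  then have fin: "qlen L (A 0) < \<infinity>" by (intro order_le_less_trans[OF len_mono assms(4)]) auto
  have LA: "L \<subseteq> A j" for j unfolding A_def using ssum_ge(1)[OF assms(1) sub_scale[OF assms(2)]] a by simp
  have "\<exists>j. A (Suc j) = A j"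
    by (rule dcc[of A \<mm> L]) (use subA saturated_max dec LA assms(1) fin in auto)
  then obtain j where j: "A (Suc j) = A j" ..
  have aN: "a [^] j *\<^sub>S N \<subseteq> carrier M" using sub_scale[OF assms(2)] a subD(1) by auto
  have "a [^] j *\<^sub>S N \<subseteq> L"
  proof (rule local_nakayama[OF assms(1) aN])
    fix T assume T: "sub T" "L \<subseteq> T" "\<And>p k. p \<in> \<mm> \<Longrightarrow> k \<in> a [^] j *\<^sub>S N \<Longrightarrow> p *\<^sub>M k \<in> T"
    have "a [^] Suc j *\<^sub>S N \<subseteq> T"
    proof
      fix y assume "y \<in> a [^] Suc j *\<^sub>S N"
      then obtain n where n: "n \<in> N" "y = a [^] Suc j *\<^sub>M n" by (auto simp: scale_def)
      then have "y = a *\<^sub>M a [^] j *\<^sub>M n" using a sub_carr[OF assms(2) n(1)]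
        by (simp add: smult_assoc1 smult_commute)
      then show "y \<in> T" using T(3)[OF assms(5)] n by (auto simp: scale_def)
    qed
    then have "A (Suc j) \<subseteq> T" unfolding A_def using T by (intro ssum_le) auto
    moreover have "a [^] j *\<^sub>S N \<subseteq> A j" unfolding A_def using ssum_ge(2)[OF assms(1) sub_scale[OF assms(2)]] a by simp
    ultimately show "a [^] j *\<^sub>S N \<subseteq> T" using j by simp
  qed
  then show ?thesis by (auto simp: scale_def)
qed

text \<open>
  This replaces the Artin-Rees lemma, both in Krull's intersection theorem and in the construction of good systems
  of parameters.
\<close>

lemma relative_complement_power:
  assumes "sub E" "sub G" "G \<inter> E = F"
    and max: "\<And>K. sub K \<Longrightarrow> G \<subseteq> K \<Longrightarrow> K \<inter> E = F \<Longrightarrow> K = G"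
    and a: "a \<in> carrier R" "\<And>e. e \<in> E \<Longrightarrow> a *\<^sub>M e \<in> F"
  shows "\<exists>k::nat. \<forall>n\<in>carrier M. a [^] k *\<^sub>M n \<in> G"
proof -
  define T where "T k = {n \<in> carrier M. a [^] (k::nat) *\<^sub>M n \<in> G}" for k
  have suc: "a [^] Suc k *\<^sub>M n = a *\<^sub>M a [^] k *\<^sub>M n" if "n \<in> carrier M" for k :: nat and n
    using a that by (simp add: smult_assoc1 smult_commute)
  have "sub (T k)" for k unfolding T_def using carrier_is_submodule assms(2) a by (intro sub_pre) auto
  moreover have "T k \<subseteq> T (Suc k)" for k
    unfolding T_def using suc subD(5)[OF assms(2) a(1)] by auto
  ultimately obtain k where k: "T (Suc k) = T k" using acc[of T] by blast
  have aN: "sub (a [^] k *\<^sub>S carrier M)" using carrier_is_submodule a by (intro sub_scale) auto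
  \<comment> \<open>At a repetition \<open>T (Suc k) = T k\<close> this enlargement of G still meets
    E in F: if e = g + a^k n is in E, then ae in F puts a^(k+1) n into G, hence also a^k n.
    Maximality of G now gives a^k M inside G.\<close>
  let ?K = "G +\<^sub>S a [^] k *\<^sub>S carrier M"
  have subK: "sub ?K" using assms(2) aN by (rule sub_ssum)
  have ge: "G \<subseteq> ?K" "a [^] k *\<^sub>S carrier M \<subseteq> ?K" using ssum_ge[OF assms(2) aN] .
  have "?K \<inter> E \<subseteq> F"
  proof
    fix e assume "e \<in> ?K \<inter> E"
    then obtain g n where gn: "g \<in> G" "n \<in> carrier M" "e = g +\<^sub>M a [^] k *\<^sub>M n" "e \<in> E"
      by (auto simp: ssum_iff scale_def)
    have gc: "g \<in> carrier M" using gn assms(2) sub_carr by blast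
    have "a *\<^sub>M e = a *\<^sub>M g +\<^sub>M a [^] Suc k *\<^sub>M n" using gn gc a suc by (simp add: smult_r_distr del: R.nat_pow_Suc)
    moreover have "a *\<^sub>M e \<in> G" using a gn assms(3) by blast
    moreover have "a *\<^sub>M g \<in> G" using subD(5)[OF assms(2) a(1) gn(1)] .
    ultimately have "a [^] Suc k *\<^sub>M n \<in> G" using sub_diff1[OF assms(2)] a gn(2)
      by (metis R.nat_pow_closed smult_closed)
    then have "n \<in> T k" using gn k by (auto simp: T_def)
    then have "e \<in> G" using gn subD(3)[OF assms(2)] by (auto simp: T_def)
    then show "e \<in> F" using gn assms(3) by blast
  qed
  then have "?K \<inter> E = F" using ge assms(3) by blast
  then have "?K = G" using max[OF subK ge(1)] by simp
  then show ?thesis using ge(2) by (auto simp: scale_def)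
qed

lemma relative_complement:
  assumes "sub E" "sub F" "F \<subseteq> E"
  obtains G where "sub G" "G \<inter> E = F" "\<And>K. sub K \<Longrightarrow> G \<subseteq> K \<Longrightarrow> K \<inter> E = F \<Longrightarrow> K = G"
proof (rule max_sub[of "\<lambda>G. sub G \<and> G \<inter> E = F" F])
  show "sub F \<and> F \<inter> E = F" using assms by blast
qed (use that in auto)

text \<open>Pigeonhole principle, one generator at a time: a monomial of degree m + j is divisible
  by x^j or has degree at least m in the remaining generators.\<close>

lemma seq_power_in_of_powers:
  assumes "set xs \<subseteq> carrier R" "sub G" "\<And>x. x \<in> set xs \<Longrightarrow> \<exists>k::nat. \<forall>n\<in>carrier M. x [^] k *\<^sub>M n \<in> G"
  shows "\<exists>m. seq_power xs m (carrier M) \<subseteq> G"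
  using assms(1,3)
proof (induction xs)
  case Nil
  have "seq_power [] 1 (carrier M) \<subseteq> G" using subD(2)[OF assms(2)] by simp
  then show ?case by blast
next
  case (Cons x xs)
  then obtain m where m: "seq_power xs m (carrier M) \<subseteq> G" by auto
  obtain k :: nat where k: "\<forall>n\<in>carrier M. x [^] k *\<^sub>M n \<in> G" using Cons.prems(2)[of x] by auto
  have x: "x \<in> carrier R" "set xs \<subseteq> carrier R" using Cons.prems by auto
  have M: "sub (carrier M)" by (rule carrier_is_submodule)
  have J: "sub (seq_power xs m (carrier M))" using x M by (intro sub_seq_power) auto
  have X: "sub (x [^] j *\<^sub>S carrier M)" for j :: nat using x M by (intro sub_scale) auto
  have le: "seq_power (x # xs) (m + j) (carrier M) \<subseteq> x [^] j *\<^sub>S carrier M +\<^sub>S seq_power xs m (carrier M)" for j :: nat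
  proof (induction j)
    case 0
    have "carrier M \<subseteq> x [^] (0::nat) *\<^sub>S carrier M" by (force simp: scale_def)
    then show ?case using ssum_ge(1)[OF X[of 0] J] seq_power_le[OF Cons.prems(1) M, of m] by auto
  next
    case (Suc j)
    have 1: "x *\<^sub>S x [^] j *\<^sub>S carrier M \<subseteq> x [^] Suc j *\<^sub>S carrier M"
    proof
      fix y assume "y \<in> x *\<^sub>S x [^] j *\<^sub>S carrier M"
      then obtain n where "n \<in> carrier M" "y = x *\<^sub>M x [^] j *\<^sub>M n" by (auto simp: scale_def)
      then show "y \<in> x [^] Suc j *\<^sub>S carrier M" using x
        by (auto simp: scale_def smult_assoc1 smult_commute)
    qed
    have 2: "x *\<^sub>S seq_power xs m (carrier M) \<subseteq> seq_power xs m (carrier M)" using scale_le[OF J x(1)] .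
    have 3: "seq_power xs (Suc (m + j)) (carrier M) \<subseteq> seq_power xs m (carrier M)"
    proof (induction j)
      case 0
      then show ?case using seq_power_dec[OF x(2) M, of m] by simp
    next
      case (Suc j)
      then show ?case using seq_power_dec[OF x(2) M, of "Suc (m + j)"] by simp
    qed
    let ?A = "x [^] Suc j *\<^sub>S carrier M +\<^sub>S seq_power xs m (carrier M)"
    have A: "sub ?A" using X J sub_ssum by blast
    have "x *\<^sub>S seq_power (x # xs) (m + j) (carrier M) \<subseteq> x *\<^sub>S (x [^] j *\<^sub>S carrier M +\<^sub>S seq_power xs m (carrier M))"
      using Suc by (rule scale_mono)
    also have "\<dots> = x *\<^sub>S x [^] j *\<^sub>S carrier M +\<^sub>S x *\<^sub>S seq_power xs m (carrier M)"
      using subD(1)[OF X] subD(1)[OF J] x by (intro scale_ssum) auto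
    also have "\<dots> \<subseteq> ?A" using 1 2 by (rule ssum_mono)
    finally have "x *\<^sub>S seq_power (x # xs) (m + j) (carrier M) \<subseteq> ?A" .
    moreover have "seq_power xs (Suc (m + j)) (carrier M) \<subseteq> ?A" using 3 ssum_ge(2)[OF X[of "Suc j"] J] by blast
    ultimately show ?case using seq_power_Cons[OF Cons.prems(1) M, of "m + j"] ssum_le[OF A] by simp
  qed
  have "x [^] k *\<^sub>S carrier M \<subseteq> G" using k by (auto simp: scale_def)
  then have "x [^] k *\<^sub>S carrier M +\<^sub>S seq_power xs m (carrier M) \<subseteq> G" using m ssum_le[OF assms(2)] by blast
  then show ?case using le[of k] by blast
qed

text \<open>Let E be the intersection and F = L + (xs)E. Choose G maximal with G \<inter> E = F.
  Every x in xs sends E into F, so powers of it send M into G, and hence a power of the whole ideal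
  does. Thus E lies in G and therefore in F, and Nakayama's lemma reduces E = L + (xs)E to E =
  L.\<close>

lemma krull_intersection:
  assumes xs: "set xs \<subseteq> \<mm>" and L: "sub L" and N: "sub N" and n: "\<And>k. n \<in> L +\<^sub>S seq_power xs k N"
  shows "n \<in> L"
proof -
  have xc: "set xs \<subseteq> carrier R" using xs mm_carr by blast
  define E where "E = (\<Inter>k. L +\<^sub>S seq_power xs k N)"
  have A: "sub (L +\<^sub>S seq_power xs k N)" for k using L N xc by (intro sub_ssum sub_seq_power) auto
  have E: "sub E"
  proof (rule subI)
    show "E \<subseteq> carrier M" unfolding E_def using subD(1)[OF A] by blast
  qed (use subD(2,3,5)[OF A] in \<open>auto simp: E_def\<close>)
  have LE: "L \<subseteq> E" unfolding E_def using ssum_ge(1)[OF L sub_seq_power[OF xc N]] by blast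
  define F where "F = L +\<^sub>S seq_smult xs E"
  have lE: "sub (seq_smult xs E)" using xc E by (rule sub_seq_smult)
  have F: "sub F" unfolding F_def using L lE by (rule sub_ssum)
  have FE: "F \<subseteq> E" unfolding F_def using LE seq_smult_le[OF xc E] by (intro ssum_le E)
  obtain G where G: "sub G" "G \<inter> E = F" "\<And>K. sub K \<Longrightarrow> G \<subseteq> K \<Longrightarrow> K \<inter> E = F \<Longrightarrow> K = G"
    using relative_complement[OF E F FE] by blast
  have "\<exists>k::nat. \<forall>n\<in>carrier M. x [^] k *\<^sub>M n \<in> G" if x: "x \<in> set xs" for x
  proof (rule relative_complement_power[OF E G])
    show "x *\<^sub>M e \<in> F" if "e \<in> E" for e
      unfolding F_def using ssum_ge(2)[OF L lE] seq_smult_mem[OF xc E x that] by blast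
  qed (use x xc in auto)
  then obtain m where m: "seq_power xs m (carrier M) \<subseteq> G" using seq_power_in_of_powers[OF xc G(1)] by blast
  have "seq_power xs m N \<subseteq> seq_power xs m (carrier M)"
    using xc N carrier_is_submodule subD(1)[OF N] by (intro seq_power_mono) auto
  moreover have "L \<subseteq> G" using G(2) ssum_ge(1)[OF L lE] by (auto simp: F_def)
  ultimately have "L +\<^sub>S seq_power xs m N \<subseteq> G" using m by (intro ssum_le G(1)) auto
  then have "E \<subseteq> G" by (auto simp: E_def)
  then have EF: "E \<subseteq> F" using G(2) by blast
  have "E \<subseteq> L"
  proof (rule local_nakayama[OF L subD(1)[OF E]])
    fix T assume T: "sub T" "L \<subseteq> T" "\<And>p k. p \<in> \<mm> \<Longrightarrow> k \<in> E \<Longrightarrow> p *\<^sub>M k \<in> T"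
    then have "seq_smult xs E \<subseteq> T" using seq_smult_le_iff[OF xc E T(1)] xs by blast
    then have "F \<subseteq> T" unfolding F_def using T by (intro ssum_le) auto
    then show "E \<subseteq> T" using EF by blast
  qed
  moreover have "n \<in> E" using n by (auto simp: E_def)
  ultimately show ?thesis by blast
qed

text \<open>Over a local ring regular sequences may be permuted. The delicate half is the regularity
  of y modulo L: the submodule K of elements that y sends into L satisfies K \<subseteq> L + xK, so
  it vanishes modulo L by Nakayama's lemma. The regularity of x modulo L + yN is a direct
  computation.\<close>

lemma regular_mod_swap:
  assumes xy: "x \<in> carrier R" "y \<in> \<mm>" "x \<in> \<mm>" and L: "sub L" and N: "sub N"  "L \<subseteq> N"
    and r: "regular_mod L N (x # y # zs)"
  shows "regular_mod L N (y # x # zs)"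
proof -
  have yc: "y \<in> carrier R" using xy mm_carr by blast
  have x: "n \<in> L" if "n \<in> N" "x *\<^sub>M n \<in> L" for n using r that by simp
  have y: "n \<in> L +\<^sub>S x *\<^sub>S N" if "n \<in> N" "y *\<^sub>M n \<in> L +\<^sub>S x *\<^sub>S N" for n using r that by simp
  have X: "sub (x *\<^sub>S N)" and Y: "sub (y *\<^sub>S N)" using N xy yc sub_scale by auto
  have LX: "L \<subseteq> L +\<^sub>S x *\<^sub>S N" using ssum_ge(1)[OF L X] .
  have Nc: "n \<in> carrier M" if "n \<in> N" for n using that N sub_carr by blast
  have Lc: "n \<in> carrier M" if "n \<in> L" for n using that L sub_carr by blast
  let ?K = "{n \<in> N. y *\<^sub>M n \<in> L}"
  have "?K \<subseteq> L"
  proof (rule local_nakayama[OF L])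
    show "?K \<subseteq> carrier M" using Nc by auto
    fix T assume T: "sub T" "L \<subseteq> T" "\<And>p k. p \<in> \<mm> \<Longrightarrow> k \<in> ?K \<Longrightarrow> p *\<^sub>M k \<in> T"
    show "?K \<subseteq> T"
    proof
      fix n assume n: "n \<in> ?K"
      then have "n \<in> L +\<^sub>S x *\<^sub>S N" using y[of n] LX by blast
      then obtain l w where lw: "l \<in> L" "w \<in> N" "n = l +\<^sub>M x *\<^sub>M w" by (auto simp: ssum_iff scale_def)
      have "y *\<^sub>M n = y *\<^sub>M l +\<^sub>M x *\<^sub>M y *\<^sub>M w"
        using lw xy yc Lc Nc by (simp add: smult_r_distr smult_commute)
      moreover have "y *\<^sub>M l \<in> L" using subD(5)[OF L yc lw(1)] .
      ultimately have "x *\<^sub>M y *\<^sub>M w \<in> L" using sub_diff1[OF L, of "y *\<^sub>M l"] n xy(1) yc Nc[OF lw(2)] by simp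
      then have "y *\<^sub>M w \<in> L" using x subD(5)[OF N(1) yc lw(2)] by blast
      then have "x *\<^sub>M w \<in> T" using T(3)[OF xy(3)] lw by blast
      then show "n \<in> T" using lw T subD(3)[OF T(1)] by blast
    qed
  qed
  moreover have "n \<in> L +\<^sub>S y *\<^sub>S N" if n: "n \<in> N" "x *\<^sub>M n \<in> L +\<^sub>S y *\<^sub>S N" for n
  proof -
    obtain l w where lw: "l \<in> L" "w \<in> N" "x *\<^sub>M n = l +\<^sub>M y *\<^sub>M w"
      using n(2) by (auto simp: ssum_iff scale_def)
    have "y *\<^sub>M w = \<ominus>\<^bsub>M\<^esub> l +\<^sub>M x *\<^sub>M n"
      using lw(3) Lc[OF lw(1)] Nc[OF lw(2)] yc by (simp add: M.r_neg1)
    moreover have "\<ominus>\<^bsub>M\<^esub> l \<in> L" using submoduleE(3)[OF L lw(1)] .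
    ultimately have "y *\<^sub>M w \<in> L +\<^sub>S x *\<^sub>S N" unfolding ssum_iff scale_def using n(1) by blast
    then obtain l' v where lv: "l' \<in> L" "v \<in> N" "w = l' +\<^sub>M x *\<^sub>M v"
      using y[OF lw(2)] by (auto simp: ssum_iff scale_def)
    have "x *\<^sub>M (n -\<^sub>M y *\<^sub>M v) = l +\<^sub>M y *\<^sub>M l'"
    proof -
      have "x *\<^sub>M n = (l +\<^sub>M y *\<^sub>M l') +\<^sub>M x *\<^sub>M y *\<^sub>M v"
        using lw lv xy yc Lc Nc by (simp add: smult_r_distr smult_commute M.a_assoc)
      then show ?thesis using lw lv xy yc Lc Nc n by (simp add: smult_minus madd_minus_cancel)
    qed
    moreover have "l +\<^sub>M y *\<^sub>M l' \<in> L" using L lw lv yc subD(3,5) by blast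
    moreover have "n -\<^sub>M y *\<^sub>M v \<in> N" using N n lv yc subD(4,5) by blast
    ultimately have "n -\<^sub>M y *\<^sub>M v \<in> L" using x by simp
    moreover have "n = (n -\<^sub>M y *\<^sub>M v) +\<^sub>M y *\<^sub>M v" using Nc[OF n(1)] Nc[OF lv(2)] yc
      by (simp add: madd_minus_cancel)
    ultimately show ?thesis unfolding ssum_iff scale_def using lv by blast
  qed
  moreover have "L +\<^sub>S x *\<^sub>S N +\<^sub>S y *\<^sub>S N = L +\<^sub>S y *\<^sub>S N +\<^sub>S x *\<^sub>S N"
    using ssum_assoc[OF subD(1)[OF L] subD(1)[OF X] subD(1)[OF Y]] ssum_assoc[OF subD(1)[OF L] subD(1)[OF Y] subD(1)[OF X]]
      ssum_comm[OF subD(1)[OF X] subD(1)[OF Y]] by simp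
  ultimately show ?thesis using r by auto
qed

text \<open>In the last position an element is regular modulo all the others at once, which is the
  form needed for exchanging parameters and for passing to powers.\<close>

lemma regular_mod_rotate1:
  assumes "x \<in> \<mm>" "set xs \<subseteq> \<mm>" "sub L" "sub N" "L \<subseteq> N" "regular_mod L N (x # xs)"
  shows "regular_mod L N (xs @ [x])"
  using assms
proof (induction xs arbitrary: L)
  case (Cons y xs)
  have yc: "y \<in> carrier R" "x \<in> carrier R" using Cons.prems mm_carr by auto
  have "regular_mod L N (y # x # xs)" using regular_mod_swap[of x y L N xs] Cons.prems yc by simp
  moreover have "sub (L +\<^sub>S y *\<^sub>S N)" "L +\<^sub>S y *\<^sub>S N \<subseteq> N"
    using Cons.prems yc scale_le[of N y] ssum_le[of N L "y *\<^sub>S N"] by (auto intro!: sub_ssum sub_scale)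
  ultimately show ?case using Cons by simp
qed simp

lemma regular_mod_rotate2:
  assumes "x \<in> \<mm>" "set xs \<subseteq> \<mm>" "sub L" "sub N" "L \<subseteq> N" "regular_mod L N (xs @ [x])"
  shows "regular_mod L N (x # xs)"
  using assms
proof (induction xs arbitrary: L)
  case (Cons y xs)
  have yc: "y \<in> carrier R" "x \<in> carrier R" using Cons.prems mm_carr by auto
  have "sub (L +\<^sub>S y *\<^sub>S N)" "L +\<^sub>S y *\<^sub>S N \<subseteq> N"
    using Cons.prems yc scale_le[of N y] ssum_le[of N L "y *\<^sub>S N"] by (auto intro!: sub_ssum sub_scale)
  then have "regular_mod L N (y # x # xs)" using Cons by simp
  then show ?case using regular_mod_swap[of y x L N xs] Cons.prems yc by simp
qed simp

end

lemma enat_Suc_0: "enat (Suc 0) = 1"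
  by (simp add: one_enat_def)

section \<open>Associated primes, parameters and the exchange of regular sequences\<close>

context noeth_local_module
begin

text \<open>A finiteness statement for an arbitrary set X, with F chosen inside X.
  \<open>T F\<close> consists of the elements annihilated modulo L by everything that annihilates F;
  it is a submodule and grows with F, so a maximal one already contains X.\<close>

lemma colon_eq_finite_Inter:
  assumes L: "sub L" and X: "X \<subseteq> carrier M"
  obtains F where "finite F" "F \<subseteq> X" "\<And>a x. a \<in> carrier R \<Longrightarrow> (\<And>f. f \<in> F \<Longrightarrow> a *\<^sub>M f \<in> L) \<Longrightarrow> x \<in> X \<Longrightarrow> a *\<^sub>M x \<in> L"
proof -
  define T where "T F = {n \<in> carrier M. \<forall>a\<in>carrier R. (\<forall>f\<in>F. a *\<^sub>M f \<in> L) \<longrightarrow> a *\<^sub>M n \<in> L}" for F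
  have subT: "sub (T F)" for F
  proof (rule subI)
    show "u +\<^sub>M v \<in> T F" if "u \<in> T F" "v \<in> T F" for u v
      using that subD(3)[OF L] by (auto simp: T_def smult_r_distr)
    show "b *\<^sub>M u \<in> T F" if "b \<in> carrier R" "u \<in> T F" for b u
      using that subD(5)[OF L] by (auto simp: T_def smult_commute[of _ b u])
  qed (use subD(2)[OF L] in \<open>auto simp: T_def\<close>)
  have ex: "\<exists>F. finite F \<and> F \<subseteq> X \<and> T {} = T F" by (intro exI[of _ "{}"]) auto
  obtain N where N: "\<exists>F. finite F \<and> F \<subseteq> X \<and> N = T F"
    and max: "\<And>K. \<exists>F. finite F \<and> F \<subseteq> X \<and> K = T F \<Longrightarrow> N \<subseteq> K \<Longrightarrow> K = N"
    by (rule max_sub[of "\<lambda>N. \<exists>F. finite F \<and> F \<subseteq> X \<and> N = T F"]) (use ex subT in auto)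
  from N obtain F where F: "finite F" "F \<subseteq> X" "N = T F" by blast
  show ?thesis
  proof (rule that[OF F(1,2)])
    fix a x assume a: "a \<in> carrier R" "\<And>f. f \<in> F \<Longrightarrow> a *\<^sub>M f \<in> L" and x: "x \<in> X"
    have "T (insert x F) = T F"
      using max[of "T (insert x F)"] F x by (auto simp: T_def)
    moreover have "x \<in> T (insert x F)" using x X by (auto simp: T_def)
    ultimately show "a *\<^sub>M x \<in> L" using a by (auto simp: T_def)
  qed
qed

text \<open>Finitely many associated primes cover all zero divisors on N/L. Let X collect the
  elements with maximal annihilator and let a finite F \<subseteq> X determine the common
  annihilator of X. The prime Ann v with v in X then contains the finite intersection of the Ann f,
  hence some Ann f, and maximality gives equality.\<close>

lemma zero_divisor_primes:
  assumes L: "sub L" and N: "sub N"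
  obtains \<P> where "finite \<P>" "\<And>p. p \<in> \<P> \<Longrightarrow> primeideal p R"
    "\<And>p. p \<in> \<P> \<Longrightarrow> \<exists>v\<in>N - L. p = colon R M L {v}"
    "\<And>u. u \<in> N \<Longrightarrow> u \<notin> L \<Longrightarrow> \<exists>p\<in>\<P>. colon R M L {u} \<subseteq> p"
proof -
  define X where "X = {v \<in> N - L. primeideal (colon R M L {v}) R \<and>
    (\<forall>w\<in>N - L. colon R M L {v} \<subseteq> colon R M L {w} \<longrightarrow> colon R M L {w} = colon R M L {v})}"
  have Xc: "X \<subseteq> carrier M" using N sub_carr by (auto simp: X_def)
  obtain F where F: "finite F" "F \<subseteq> X"
    "\<And>a x. a \<in> carrier R \<Longrightarrow> (\<And>f. f \<in> F \<Longrightarrow> a *\<^sub>M f \<in> L) \<Longrightarrow> x \<in> X \<Longrightarrow> a *\<^sub>M x \<in> L"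
    using colon_eq_finite_Inter[OF L Xc] by blast
  show ?thesis
  proof (rule that[of "(\<lambda>f. colon R M L {f}) ` F"])
    fix u assume u: "u \<in> N" "u \<notin> L"
    obtain v where v: "v \<in> N" "v \<notin> L" "colon R M L {u} \<subseteq> colon R M L {v}" "primeideal (colon R M L {v}) R"
      "\<And>w. w \<in> N \<Longrightarrow> w \<notin> L \<Longrightarrow> colon R M L {v} \<subseteq> colon R M L {w} \<Longrightarrow> colon R M L {w} = colon R M L {v}"
      using max_ann_above[OF L N u] by blast
    then have vX: "v \<in> X" by (auto simp: X_def)
    have "\<exists>f\<in>F. colon R M L {f} \<subseteq> colon R M L {v}"
    proof (rule ccontr)
      assume "\<not> ?thesis"
      then have "\<exists>a\<in>carrier R. a \<notin> colon R M L {v} \<and> (\<forall>f\<in>F. a \<in> colon R M L {f})"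
        using F(2) Xc by (intro R.prime_separation F v colon_ideal L) auto
      then obtain a where a: "a \<in> carrier R" "a \<notin> colon R M L {v}" "\<forall>f\<in>F. a \<in> colon R M L {f}" by blast
      have "a *\<^sub>M v \<in> L" by (rule F(3)[OF a(1) _ vX]) (use a in \<open>auto simp: colon_def\<close>)
      then show False using a by (auto simp: colon_def)
    qed
    then obtain f where f: "f \<in> F" "colon R M L {f} \<subseteq> colon R M L {v}" by blast
    then show "\<exists>p\<in>(\<lambda>f. colon R M L {f}) ` F. colon R M L {u} \<subseteq> p"
    proof (intro bexI[of _ "colon R M L {f}"] imageI)
      have "f \<in> N" "f \<notin> L" using f(1) F(2) by (auto simp: X_def)
      moreover have "v \<in> N - L" using v by blast
      ultimately have "colon R M L {v} = colon R M L {f}" using f F(2) by (auto simp: X_def)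
      then show "colon R M L {u} \<subseteq> colon R M L {f}" using v(3) by simp
    qed (rule f(1))
  qed (use F in \<open>auto simp: X_def\<close>)
qed

text \<open>Every a in \<mm> has a power that sends N into L + (xs)N. If a were outside p, then
  locally at p the module N/L would equal p times itself and vanish by Nakayama's lemma. As N is
  finitely generated, one element outside p would annihilate N/L, although Ann (N/L) \<subseteq>
  p.\<close>

lemma parameters_of_finite_length:
  assumes xs: "set xs \<subseteq> \<mm>" and L: "sub L" and N: "sub N" and LN: "L \<subseteq> N"
    and fin: "qlen (L +\<^sub>S seq_smult xs N) N < \<infinity>" and p: "primeideal p R" "colon R M L N \<union> set xs \<subseteq> p"
  shows "p = \<mm>"
proof (rule antisym)
  show "p \<subseteq> \<mm>" using le_max p by blast
  have xc: "set xs \<subseteq> carrier R" using xs mm_carr by blast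
  have J: "sub (seq_smult xs N)" using sub_seq_smult[OF xc N] .
  show "\<mm> \<subseteq> p"
  proof
    fix a assume a: "a \<in> \<mm>"
    have ac: "a \<in> carrier R" using a mm_carr by blast
    have "L +\<^sub>S seq_smult xs N \<subseteq> N" using LN seq_smult_le[OF xc N] by (intro ssum_le N) auto
    then obtain j :: nat where j: "\<forall>n\<in>N. a [^] j *\<^sub>M n \<in> L +\<^sub>S seq_smult xs N"
      using finite_length_power[OF sub_ssum[OF L J] N _ fin a] by blast
    show "a \<in> p"
    proof (rule ccontr)
      assume "a \<notin> p"
      then have aj: "a [^] j \<notin> p" using R.prime_pow[OF p(1) ac] by blast
      have Nclo: "N \<subseteq> saturation R M p L"
      proof (rule nakayama[OF p(1) sub_saturation[OF p(1) L] saturated_saturation[OF p(1)] subD(1)[OF N]])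
        fix T assume T: "sub T" "saturated R M p T" "saturation R M p L \<subseteq> T" "\<And>b k. b \<in> p \<Longrightarrow> k \<in> N \<Longrightarrow> b *\<^sub>M k \<in> T"
        have "seq_smult xs N \<subseteq> T" using seq_smult_le_iff[OF xc N T(1)] T(4) p(2) by blast
        moreover have "L \<subseteq> T" using saturation_ge[OF p(1) L] T(3) by blast
        ultimately have "L +\<^sub>S seq_smult xs N \<subseteq> T" by (intro ssum_le T)
        then show "N \<subseteq> T" using saturatedD[OF T(2) _ aj] j ac sub_carr[OF N] by blast
      qed
      obtain F where F: "finite F" "F \<subseteq> N"
        "\<And>a x. a \<in> carrier R \<Longrightarrow> (\<And>f. f \<in> F \<Longrightarrow> a *\<^sub>M f \<in> L) \<Longrightarrow> x \<in> N \<Longrightarrow> a *\<^sub>M x \<in> L"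
        using colon_eq_finite_Inter[OF L subD(1)[OF N]] by blast
      have nf: "\<not> colon R M L {f} \<subseteq> p" if "f \<in> F" for f
      proof -
        have "f \<in> saturation R M p L" using that F(2) Nclo by blast
        then obtain s where s: "s \<in> carrier R" "s \<notin> p" "s *\<^sub>M f \<in> L" using saturationD by blast
        then have "s \<in> colon R M L {f}" by (simp add: colon_def)
        then show ?thesis using s(2) by blast
      qed
      have "\<exists>b\<in>carrier R. b \<notin> p \<and> (\<forall>f\<in>F. b \<in> colon R M L {f})"
        using F(2) subD(1)[OF N] by (intro R.prime_separation F p colon_ideal L nf) auto
      then obtain b where b: "b \<in> carrier R" "b \<notin> p" "\<forall>f\<in>F. b \<in> colon R M L {f}" by blast
      then have "b \<in> colon R M L N" using F(3)[OF b(1)] by (auto simp: colon_def)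
      then show False using b p by blast
    qed
  qed
qed

text \<open>
  Exchange argument: some \<open>z = x + c\<close> with \<open>c\<close> in the ideal of the remaining parameters avoids the associated primes
  of \<open>N\<close> modulo \<open>L\<close> and all of \<open>ys\<close> but one, hence can replace this one. Modulo \<open>z\<close> there is one parameter less, and modulo
  the remaining parameters \<open>x\<close> and \<open>z\<close> agree.
\<close>

lemma parameters_regular:
  assumes "set xs \<subseteq> \<mm>" "set ys \<subseteq> \<mm>" "length ys = length xs" "sub L" "sub N" "L \<subseteq> N" "regular_mod L N ys"
    and "\<And>p. primeideal p R \<Longrightarrow> colon R M L N \<union> set xs \<subseteq> p \<Longrightarrow> p = \<mm>"
  shows "regular_mod L N xs"
  using assms
proof (induction xs arbitrary: ys L)
  case (Cons x xs)
  note L = Cons.prems(4) and N = Cons.prems(5)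
  obtain y ys' where ys: "ys = y # ys'" using Cons.prems(3) by (cases ys) auto
  have mem: "x \<in> \<mm>" "set xs \<subseteq> \<mm>" "y \<in> \<mm>" "set ys' \<subseteq> \<mm>" using Cons.prems ys by auto
  then have car: "x \<in> carrier R" "set xs \<subseteq> carrier R" "y \<in> carrier R" "set ys' \<subseteq> carrier R" using mm_carr by auto
  let ?L1 = "L +\<^sub>S seq_smult ys' N"
  have L1: "sub ?L1" using L N car sub_seq_smult sub_ssum by blast
  have LL1: "L \<subseteq> ?L1" using ssum_ge(1)[OF L sub_seq_smult[OF car(4) N]] .
  have "regular_mod L N (ys' @ [y])" using regular_mod_rotate1[OF mem(3,4) L N Cons.prems(6)] Cons.prems(7) ys by simp
  then have r: "regular_mod L N ys'" and y: "\<And>n. n \<in> N \<Longrightarrow> y *\<^sub>M n \<in> ?L1 \<Longrightarrow> n \<in> ?L1"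
    using regular_mod_append[OF car(4) L N, of "[y]"] by auto
  obtain \<P> where P: "finite \<P>" "\<And>p. p \<in> \<P> \<Longrightarrow> primeideal p R"
    "\<And>p. p \<in> \<P> \<Longrightarrow> \<exists>v\<in>N - ?L1. p = colon R M ?L1 {v}"
    "\<And>u. u \<in> N \<Longrightarrow> u \<notin> ?L1 \<Longrightarrow> \<exists>p\<in>\<P>. colon R M ?L1 {u} \<subseteq> p"
    using zero_divisor_primes[OF L1 N] by blast
  \<comment> \<open>An associated prime containing x and xs would be \<mm>, hence contain y, which
    is regular modulo \<open>?L1\<close>. So the coset of x modulo the ideal of xs has an element
    outside all of them.\<close>
  have "\<exists>c\<in>Idl (set xs). \<forall>p\<in>\<P>. x \<oplus> c \<notin> p"
  proof (rule R.prime_avoidance_coset[OF P(1,2) R.genideal_ideal[OF car(2)] car(1)])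
    fix p assume p: "p \<in> \<P>" "x \<in> p"
    show "\<not> Idl (set xs) \<subseteq> p"
    proof
      assume "Idl (set xs) \<subseteq> p"
      then have xp: "set xs \<subseteq> p" using R.genideal_self[OF car(2)] by blast
      obtain v where v: "v \<in> N" "v \<notin> ?L1" "p = colon R M ?L1 {v}" using P(3)[OF p(1)] by blast
      have "colon R M L N \<subseteq> p" unfolding v(3) by (rule colon_mono[OF LL1]) (use v in auto)
      then have "p = \<mm>" using Cons.prems(8)[OF P(2)[OF p(1)]] p xp by auto
      then have "y *\<^sub>M v \<in> ?L1" using mem v(3) by (auto simp: colon_def)
      then show False using y v by blast
    qed
  qed
  then obtain c where c: "c \<in> Idl (set xs)" "\<And>p. p \<in> \<P> \<Longrightarrow> x \<oplus> c \<notin> p" by blast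
  let ?z = "x \<oplus> c"
  have cm: "c \<in> \<mm>" using c(1) mem R.Idl_le primeideal.axioms(1)[OF max_prime] by blast
  have cc: "c \<in> carrier R" using cm mm_carr by blast
  have zm: "?z \<in> \<mm>" using R.primeE(5)[OF max_prime] mem cm by blast
  have zc: "?z \<in> carrier R" using zm mm_carr by blast
  have "n \<in> ?L1" if n: "n \<in> N" "?z *\<^sub>M n \<in> ?L1" for n
  proof (rule ccontr)
    assume "n \<notin> ?L1"
    then obtain p where "p \<in> \<P>" "colon R M ?L1 {n} \<subseteq> p" using P(4)[OF n(1)] by blast
    moreover have "?z \<in> colon R M ?L1 {n}" using n zc by (auto simp: colon_def)
    ultimately show False using c(2) by blast
  qed
  then have "regular_mod L N (ys' @ [?z])" using r regular_mod_append[OF car(4) L N, of "[?z]"] by auto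
  then have z: "regular_mod L N (?z # ys')" using regular_mod_rotate2[OF zm mem(4) L N Cons.prems(6)] by blast
  have Z: "sub (?z *\<^sub>S N)" using N zc by (rule sub_scale)
  let ?L' = "L +\<^sub>S ?z *\<^sub>S N"
  have L': "sub ?L'" using L Z by (rule sub_ssum)
  have "regular_mod ?L' N xs"
  proof (rule Cons.IH[OF mem(2,4) _ L' N])
    show "length ys' = length xs" using Cons.prems(3) ys by simp
    show "?L' \<subseteq> N" using Cons.prems(6) scale_le[OF N zc] by (intro ssum_le N) auto
    show "regular_mod ?L' N ys'" using z by simp
    fix p assume p: "primeideal p R" "colon R M ?L' N \<union> set xs \<subseteq> p"
    have "?z \<in> colon R M ?L' N" using zc ssum_ge(2)[OF L Z] by (auto simp: colon_def scale_def)
    then have "?z \<in> p" using p by blast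
    moreover have "c \<in> p" using c(1) p R.Idl_le[OF primeideal.axioms(1)[OF p(1)]] by blast
    ultimately have "?z \<ominus> c \<in> p" using R.primeE(6)[OF p(1)] by blast
    moreover have "?z \<ominus> c = x" using car cc R.add_minus_cancel[of c x] by (simp add: R.a_comm)
    moreover have "colon R M L N \<subseteq> colon R M ?L' N" using ssum_ge(1)[OF L Z] by (intro colon_mono) auto
    ultimately show "p = \<mm>" using Cons.prems(8)[OF p(1)] p(2) by auto
  qed
  then have "regular_mod L N (?z # xs)" using z by simp
  then have "regular_mod L N (xs @ [?z])" using regular_mod_rotate1[OF zm mem(2) L N Cons.prems(6)] by blast
  then have rxs: "regular_mod L N xs" and z2: "\<And>n. n \<in> N \<Longrightarrow> ?z *\<^sub>M n \<in> L +\<^sub>S seq_smult xs N \<Longrightarrow> n \<in> L +\<^sub>S seq_smult xs N"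
    using regular_mod_append[OF car(2) L N, of "[?z]"] by auto
  have J: "sub (seq_smult xs N)" using sub_seq_smult[OF car(2) N] .
  have "n \<in> L +\<^sub>S seq_smult xs N" if n: "n \<in> N" "x *\<^sub>M n \<in> L +\<^sub>S seq_smult xs N" for n
  proof (rule z2[OF n(1)])
    have "c *\<^sub>M n \<in> L +\<^sub>S seq_smult xs N" using Idl_smult_mem[OF car(2) N c(1) n(1)] ssum_ge(2)[OF L J] by blast
    then show "?z *\<^sub>M n \<in> L +\<^sub>S seq_smult xs N"
      using n sub_carr[OF N n(1)] car cc subD(3)[OF sub_ssum[OF L J]] by (simp add: smult_l_distr)
  qed
  then have "regular_mod L N (xs @ [x])" using rxs regular_mod_append[OF car(2) L N, of "[x]"] by auto
  then show ?case using regular_mod_rotate2[OF mem(1,2) L N Cons.prems(6)] by blast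
qed simp

section \<open>Powers of an ideal generated by a regular sequence\<close>

lemma colon_power_aux:
  assumes x: "x \<in> carrier R" "set xs \<subseteq> carrier R" and L: "sub L" and N: "sub N"
    and W: "\<And>k n. n \<in> N \<Longrightarrow> x *\<^sub>M n \<in> L +\<^sub>S seq_power xs k N \<Longrightarrow> n \<in> L +\<^sub>S seq_power xs k N"
    and n: "n \<in> N" "x *\<^sub>M n \<in> L +\<^sub>S seq_power (x # xs) (Suc k) N"
  shows "n \<in> L +\<^sub>S seq_power (x # xs) k N"
proof -
  have xx: "set (x # xs) \<subseteq> carrier R" using x by simp
  have Q: "sub (seq_power (x # xs) k N)" for k using sub_seq_power[OF xx N] .
  have J: "sub (seq_power xs k N)" for k using sub_seq_power[OF x(2) N] .
  have B: "sub (L +\<^sub>S seq_power (x # xs) k N)" by (rule sub_ssum[OF L Q])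
  obtain l w u where lwu: "l \<in> L" "w \<in> seq_power (x # xs) k N" "u \<in> seq_power xs (Suc k) N" "x *\<^sub>M n = l +\<^sub>M (x *\<^sub>M w +\<^sub>M u)"
    using n(2) unfolding seq_power_Cons[OF xx N] by (auto simp: ssum_iff scale_def)
  have c: "l \<in> carrier M" "w \<in> carrier M" "u \<in> carrier M" "n \<in> carrier M" "w \<in> N"
    using lwu sub_carr[OF L] sub_carr[OF Q] sub_carr[OF J] sub_carr[OF N n(1)] seq_power_le[OF xx N] by blast+
  have "x *\<^sub>M n = x *\<^sub>M w +\<^sub>M (l +\<^sub>M u)" using lwu c x by (simp add: M.a_ac)
  \<comment> \<open>Subtracting w, which already lies in the k-th power, removes the monomials
    divisible by x; the remaining relation involves xs alone and falls under W.\<close>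
  then have "x *\<^sub>M (n -\<^sub>M w) = l +\<^sub>M u" using c x by (simp add: smult_minus madd_minus_cancel)
  then have "x *\<^sub>M (n -\<^sub>M w) \<in> L +\<^sub>S seq_power xs (Suc k) N" unfolding ssum_iff using lwu by blast
  then have "n -\<^sub>M w \<in> L +\<^sub>S seq_power xs (Suc k) N" by (rule W[rotated]) (rule subD(4)[OF N n(1) c(5)])
  moreover have "seq_power xs (Suc k) N \<subseteq> seq_power (x # xs) (Suc k) N" using xx N by (intro seq_power_mono) auto
  then have "seq_power xs (Suc k) N \<subseteq> seq_power (x # xs) k N" using seq_power_dec[OF xx N] by blast
  then have "L +\<^sub>S seq_power xs (Suc k) N \<subseteq> L +\<^sub>S seq_power (x # xs) k N" by (intro ssum_mono) auto
  ultimately have "n -\<^sub>M w \<in> L +\<^sub>S seq_power (x # xs) k N" by blast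
  moreover have "w \<in> L +\<^sub>S seq_power (x # xs) k N" using ssum_ge(2)[OF L Q] lwu by blast
  ultimately have "(n -\<^sub>M w) +\<^sub>M w \<in> L +\<^sub>S seq_power (x # xs) k N" by (rule subD(3)[OF B])
  then show ?thesis using c by (simp add: madd_minus_cancel)
qed

lemma regular_mod_last:
  assumes x: "x \<in> \<mm>" "set xs \<subseteq> \<mm>" and L: "sub L" and N: "sub N" "L \<subseteq> N" and r: "regular_mod L N (x # xs)"
  shows "regular_mod L N xs" "\<And>n. n \<in> N \<Longrightarrow> x *\<^sub>M n \<in> L +\<^sub>S seq_smult xs N \<Longrightarrow> n \<in> L +\<^sub>S seq_smult xs N"
proof -
  have xc: "set xs \<subseteq> carrier R" using x mm_carr by blast
  have "regular_mod L N (xs @ [x])" using regular_mod_rotate1[OF x L N r] .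
  then show "regular_mod L N xs" "\<And>n. n \<in> N \<Longrightarrow> x *\<^sub>M n \<in> L +\<^sub>S seq_smult xs N \<Longrightarrow> n \<in> L +\<^sub>S seq_smult xs N"
    using regular_mod_append[OF xc L N(1), of "[x]"] by auto
qed

text \<open>The successive quotients of the (xs)-adic filtration of N/L are direct sums of copies of
  N/(L + (xs)N), so that an element regular there stays regular modulo the powers. In place of the
  graded module there is a double induction: the hypothesis for the shorter list is used for the
  head x modulo L and for y modulo L + xN, and an inner induction on k joins the two.\<close>

lemma regular_mod_power:
  assumes "set xs \<subseteq> \<mm>" "sub L" "sub N" "L \<subseteq> N" "regular_mod L N xs" "y \<in> carrier R"
    and "\<And>n. n \<in> N \<Longrightarrow> y *\<^sub>M n \<in> L +\<^sub>S seq_smult xs N \<Longrightarrow> n \<in> L +\<^sub>S seq_smult xs N"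
    and "n \<in> N" "y *\<^sub>M n \<in> L +\<^sub>S seq_power xs k N"
  shows "n \<in> L +\<^sub>S seq_power xs k N"
  using assms
proof (induction xs arbitrary: L y n k)
  case Nil
  show ?case
  proof (cases k)
    case 0
    then show ?thesis using Nil ssum_ge(2)[of L N] by auto
  next
    case (Suc j)
    then show ?thesis using Nil by simp
  qed
next
  case (Cons x xs)
  note L = Cons.prems(2) and N = Cons.prems(3) and y = Cons.prems(6)
  have x: "x \<in> \<mm>" "set xs \<subseteq> \<mm>" using Cons.prems by auto
  have xc: "x \<in> carrier R" "set xs \<subseteq> carrier R" "set (x # xs) \<subseteq> carrier R" using x mm_carr by auto
  have X: "sub (x *\<^sub>S N)" using sub_scale[OF N xc(1)] .
  let ?L1 = "L +\<^sub>S x *\<^sub>S N"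
  have L1: "sub ?L1" using sub_ssum[OF L X] .
  have L1N: "?L1 \<subseteq> N" using Cons.prems(4) scale_le[OF N xc(1)] by (intro ssum_le N) auto
  have Q: "sub (seq_power (x # xs) k N)" for k using sub_seq_power[OF xc(3) N] .
  have J: "sub (seq_power xs k N)" for k using sub_seq_power[OF xc(2) N] .
  have LQ: "sub (L +\<^sub>S seq_power (x # xs) k N)" for k using sub_ssum[OF L Q] .
  note rl = regular_mod_last[OF x L N Cons.prems(4,5)]
  have Wx: "n \<in> L +\<^sub>S seq_power xs k N" if "n \<in> N" "x *\<^sub>M n \<in> L +\<^sub>S seq_power xs k N" for n k
    by (rule Cons.IH[OF x(2) L N Cons.prems(4) rl(1) xc(1) rl(2) that])
  have V: "n \<in> L +\<^sub>S seq_power (x # xs) k N" if "n \<in> N" "x *\<^sub>M n \<in> L +\<^sub>S seq_power (x # xs) (Suc k) N" for n k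
    by (rule colon_power_aux[OF xc(1,2) L N Wx that])
  have "L +\<^sub>S seq_smult (x # xs) N = ?L1 +\<^sub>S seq_smult xs N"
    using ssum_assoc[OF subD(1)[OF L] subD(1)[OF X] seq_smult_carr[OF xc(2) N]] by simp
  then have y1: "n \<in> ?L1 +\<^sub>S seq_smult xs N" if "n \<in> N" "y *\<^sub>M n \<in> ?L1 +\<^sub>S seq_smult xs N" for n
    using Cons.prems(7) that by simp
  have r1: "regular_mod ?L1 N xs" using Cons.prems(5) by simp
  have Wy: "n \<in> ?L1 +\<^sub>S seq_power xs k N" if "n \<in> N" "y *\<^sub>M n \<in> ?L1 +\<^sub>S seq_power xs k N" for n k
    by (rule Cons.IH[OF x(2) L1 N L1N r1 y y1 that])
  show ?case
    using Cons.prems(8,9)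
  proof (induction k arbitrary: n)
    case 0
    then show ?case using ssum_ge(2)[OF L N] by auto
  next
    case (Suc k)
    have le: "L +\<^sub>S seq_power (x # xs) (Suc k) N \<subseteq> ?L1 +\<^sub>S seq_power xs (Suc k) N"
    proof (rule ssum_le)
      show "sub (?L1 +\<^sub>S seq_power xs (Suc k) N)" using sub_ssum[OF L1 J] .
      show "L \<subseteq> ?L1 +\<^sub>S seq_power xs (Suc k) N" using ssum_ge(1)[OF L X] ssum_ge(1)[OF L1 J] by blast
      have "x *\<^sub>S seq_power (x # xs) k N \<subseteq> ?L1" using ssum_ge(2)[OF L X] scale_mono[OF seq_power_le[OF xc(3) N]] by blast
      then show "seq_power (x # xs) (Suc k) N \<subseteq> ?L1 +\<^sub>S seq_power xs (Suc k) N"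
        unfolding seq_power_Cons[OF xc(3) N] by (intro ssum_mono) auto
    qed
    then have "n \<in> ?L1 +\<^sub>S seq_power xs (Suc k) N" using Wy[OF Suc.prems(1)] Suc.prems(2) by blast
    \<comment> \<open>The terms l and u already lie in the target. For the remaining term xw the
      relation \<open>V\<close> cancels x, which lowers the exponent by one, so that the induction
      on k applies to w.\<close>
    then obtain l w u where lwu: "l \<in> L" "w \<in> N" "u \<in> seq_power xs (Suc k) N" "n = l +\<^sub>M x *\<^sub>M w +\<^sub>M u"
      by (auto simp: ssum_iff scale_def)
    have c: "l \<in> carrier M" "w \<in> carrier M" "u \<in> carrier M"
      using lwu sub_carr[OF L] sub_carr[OF J] sub_carr[OF N] by blast+
    let ?B = "L +\<^sub>S seq_power (x # xs) (Suc k) N"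
    have "seq_power xs (Suc k) N \<subseteq> seq_power (x # xs) (Suc k) N" using xc N by (intro seq_power_mono) auto
    then have uB: "u \<in> ?B" using ssum_ge(2)[OF L Q[of "Suc k"]] lwu by blast
    have lB: "l \<in> ?B" using ssum_ge(1)[OF L Q[of "Suc k"]] lwu by blast
    have "y *\<^sub>M n = y *\<^sub>M (l +\<^sub>M u) +\<^sub>M x *\<^sub>M y *\<^sub>M w"
      using c y xc lwu(4) by (simp add: smult_r_distr smult_commute M.a_ac)
    moreover have "y *\<^sub>M (l +\<^sub>M u) \<in> ?B" using subD(3,5)[OF LQ] lB uB y by blast
    ultimately have "x *\<^sub>M y *\<^sub>M w \<in> ?B"
      using sub_diff1[OF LQ, of "y *\<^sub>M (l +\<^sub>M u)" "Suc k"] Suc.prems(2) c y xc by (simp del: seq_power.simps)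
    then have "y *\<^sub>M w \<in> L +\<^sub>S seq_power (x # xs) k N" using V subD(5)[OF N y lwu(2)] by blast
    then have "w \<in> L +\<^sub>S seq_power (x # xs) k N" using Suc.IH lwu(2) by blast
    then obtain l' v where lv: "l' \<in> L" "v \<in> seq_power (x # xs) k N" "w = l' +\<^sub>M v" by (auto simp: ssum_iff)
    have "x *\<^sub>M v \<in> seq_power (x # xs) (Suc k) N" using seq_smult_mem[OF xc(3) Q, of x v] lv by simp
    then have "x *\<^sub>M v \<in> ?B" using ssum_ge(2)[OF L Q] by blast
    moreover have "x *\<^sub>M l' \<in> ?B" using ssum_ge(1)[OF L Q] subD(5)[OF L xc(1) lv(1)] by blast
    moreover have "x *\<^sub>M w = x *\<^sub>M l' +\<^sub>M x *\<^sub>M v"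
      using lv sub_carr[OF L] sub_carr[OF Q] xc by (simp add: smult_r_distr)
    ultimately have "x *\<^sub>M w \<in> ?B" using subD(3)[OF LQ] by (simp only:)
    then show ?case using uB lB subD(3)[OF LQ] by (simp only: lwu(4))
  qed
qed

lemma regular_head_mod_power:
  assumes "x \<in> \<mm>" "set xs \<subseteq> \<mm>" "sub L" "sub N" "L \<subseteq> N" "regular_mod L N (x # xs)" "n \<in> N" "x *\<^sub>M n \<in> L +\<^sub>S seq_power xs k N"
  shows "n \<in> L +\<^sub>S seq_power xs k N"
  using regular_mod_power[OF assms(2-5) regular_mod_last(1)[OF assms(1-6)] _ regular_mod_last(2)[OF assms(1-6)] assms(7,8)]
    assms(1) mm_carr by blast

text \<open>In other words, the initial form of x is a nonzerodivisor on the associated graded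
  module of N/L. This is what identifies the colon submodule in the length recursion.\<close>

lemma colon_power:
  assumes "x \<in> \<mm>" "set xs \<subseteq> \<mm>" "sub L" "sub N" "L \<subseteq> N" "regular_mod L N (x # xs)"
    and "n \<in> N" "x *\<^sub>M n \<in> L +\<^sub>S seq_power (x # xs) (Suc k) N"
  shows "n \<in> L +\<^sub>S seq_power (x # xs) k N"
proof (rule colon_power_aux[OF _ _ assms(3,4) _ assms(7,8)])
  show "n \<in> L +\<^sub>S seq_power xs k N" if "n \<in> N" "x *\<^sub>M n \<in> L +\<^sub>S seq_power xs k N" for n k
    using regular_head_mod_power[OF assms(1-6) that] .
qed (use assms mm_carr in auto)

text \<open>Keeps L/q^k L inside N/q^k N, so that lengths along the filtration add up. If u = xw + v
  lies in L with v in (xs)^(k+1) N, then w = l + j with l in L and j in (xs)^(k+1) N, since x is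
  regular modulo L + (xs)^(k+1) N. The element l falls under the induction on k, and the remainder
  xj + v lies in L and in (xs)^(k+1) N, where the shorter list applies.\<close>

lemma seq_power_inter_regular:
  assumes "set xs \<subseteq> \<mm>" "sub L" "sub N" "L \<subseteq> N" "regular_mod L N xs"
  shows "seq_power xs k N \<inter> L \<subseteq> seq_power xs k L"
  using assms
proof (induction xs arbitrary: k)
  case Nil
  then show ?case by (cases k) auto
next
  case (Cons x xs)
  note L = Cons.prems(2) and N = Cons.prems(3)
  have x: "x \<in> \<mm>" "set xs \<subseteq> \<mm>" using Cons.prems by auto
  have xc: "x \<in> carrier R" "set xs \<subseteq> carrier R" "set (x # xs) \<subseteq> carrier R" using x mm_carr by auto
  have Q: "sub (seq_power (x # xs) k N)" for k using sub_seq_power[OF xc(3) N] .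
  have J: "sub (seq_power xs k N)" for k using sub_seq_power[OF xc(2) N] .
  have rxs: "regular_mod L N xs" using regular_mod_last(1)[OF x L N Cons.prems(4,5)] .
  show ?case
  proof (induction k)
    case (Suc k)
    show ?case
    proof
      fix u assume "u \<in> seq_power (x # xs) (Suc k) N \<inter> L"
      then obtain w v where wv: "w \<in> seq_power (x # xs) k N" "v \<in> seq_power xs (Suc k) N" "u = x *\<^sub>M w +\<^sub>M v" "u \<in> L"
        unfolding seq_power_Cons[OF xc(3) N] by (auto simp: ssum_iff scale_def)
      have c: "w \<in> carrier M" "v \<in> carrier M" "u \<in> carrier M" "w \<in> N"
        using wv sub_carr[OF L] sub_carr[OF J] sub_carr[OF Q] seq_power_le[OF xc(3) N] by blast+
      have "x *\<^sub>M w = u -\<^sub>M v" using wv(3) c xc by (simp add: madd_minus_cancel)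
      moreover have "u -\<^sub>M v \<in> L +\<^sub>S seq_power xs (Suc k) N"
        using ssum_ge[OF L J[of "Suc k"]] wv by (intro subD(4) sub_ssum L J) auto
      ultimately have "w \<in> L +\<^sub>S seq_power xs (Suc k) N"
        using regular_head_mod_power[OF x L N Cons.prems(4,5) c(4), of "Suc k"] by (simp del: seq_power.simps)
      then obtain l j where lj: "l \<in> L" "j \<in> seq_power xs (Suc k) N" "w = l +\<^sub>M j" by (auto simp: ssum_iff)
      have lc: "l \<in> carrier M" "j \<in> carrier M" using lj sub_carr[OF L] sub_carr[OF J] by blast+
      have "seq_power xs (Suc k) N \<subseteq> seq_power (x # xs) (Suc k) N" using xc N by (intro seq_power_mono) auto
      then have "j \<in> seq_power (x # xs) k N" using seq_power_dec[OF xc(3) N] lj by blast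
      then have "l \<in> seq_power (x # xs) k N" using sub_diff2[OF Q, of j k l] lj wv lc by simp
      then have l: "l \<in> seq_power (x # xs) k L" using Suc lj by blast
      have "x *\<^sub>M j +\<^sub>M v \<in> seq_power xs (Suc k) N" by (intro subD(3,5)[OF J] lj wv xc)
      moreover have eq: "u = x *\<^sub>M l +\<^sub>M (x *\<^sub>M j +\<^sub>M v)"
        using wv(3) lj(3) lc c xc by (simp add: smult_r_distr M.a_assoc)
      then have "x *\<^sub>M j +\<^sub>M v \<in> L"
        using sub_diff1[OF L, of "x *\<^sub>M l"] wv(4) subD(5)[OF L xc(1) lj(1)] lc c xc by simp
      ultimately have "x *\<^sub>M j +\<^sub>M v \<in> seq_power xs (Suc k) L" using Cons.IH[OF x(2) L N Cons.prems(4) rxs] by blast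
      then show "u \<in> seq_power (x # xs) (Suc k) L"
        unfolding seq_power_Cons[OF xc(3) L] eq using l by (auto simp: ssum_iff scale_def)
    qed
  qed auto
qed

section \<open>Lengths modulo powers and binomial coefficients\<close>

lemma qlen_colon:
  assumes A: "sub A" and N: "sub N" and AN: "A \<subseteq> N" and x: "x \<in> carrier R"
  shows "qlen A (A +\<^sub>S x *\<^sub>S N) = qlen {n \<in> N. x *\<^sub>M n \<in> A} N"
proof (rule antisym)
  have X: "sub (x *\<^sub>S N)" using sub_scale[OF N x] .
  \<comment> \<open>Multiplication by x identifies N modulo the preimage of A with (A + xN)/A. On
    intermediate submodules, \<open>?C\<close> and the map K \<mapsto> A + xK are inverse to each
    other.\<close>
  let ?C = "\<lambda>K. {n \<in> N. x *\<^sub>M n \<in> K}"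
  have C: "sub (?C K)" if "sub K" for K using sub_pre[OF N that x] .
  have inv: "A +\<^sub>S x *\<^sub>S ?C K = K" if K: "sub K" "A \<subseteq> K" "K \<subseteq> A +\<^sub>S x *\<^sub>S N" for K
  proof
    show "A +\<^sub>S x *\<^sub>S ?C K \<subseteq> K" by (rule ssum_le[OF K(1,2)]) (auto simp: scale_def)
    show "K \<subseteq> A +\<^sub>S x *\<^sub>S ?C K"
    proof
      fix k assume k: "k \<in> K"
      then obtain a n where an: "a \<in> A" "n \<in> N" "k = a +\<^sub>M x *\<^sub>M n"
        using K(3) by (fastforce simp: ssum_iff scale_def)
      then have "x *\<^sub>M n \<in> K" using sub_diff1[OF K(1), of a] k K(2) sub_carr[OF N] x by auto
      then show "k \<in> A +\<^sub>S x *\<^sub>S ?C K" using an by (auto simp: ssum_iff scale_def)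
    qed
  qed
  show "qlen A (A +\<^sub>S x *\<^sub>S N) \<le> qlen (?C A) N"
  proof (rule len_map[where f = ?C])
    fix K K' assume K: "sub K" "A \<subseteq> K" "K \<subseteq> A +\<^sub>S x *\<^sub>S N" "sub K'" "A \<subseteq> K'" "K' \<subseteq> A +\<^sub>S x *\<^sub>S N" "K \<subset> K'"
    have "K = K'" if "?C K = ?C K'" using inv[OF K(1-3)] inv[OF K(4-6)] unfolding that by (rule trans[OF sym])
    then show "?C K \<subset> ?C K'" using K(7) by blast
  qed (use C saturated_max in auto)
  have inv': "?C (A +\<^sub>S x *\<^sub>S K) = K" if K: "sub K" "?C A \<subseteq> K" "K \<subseteq> N" for K
  proof
    show "K \<subseteq> ?C (A +\<^sub>S x *\<^sub>S K)"
      using K(3) ssum_ge(2)[OF A sub_scale[OF K(1) x]] unfolding scale_def by blast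
    show "?C (A +\<^sub>S x *\<^sub>S K) \<subseteq> K"
    proof
      fix n assume "n \<in> ?C (A +\<^sub>S x *\<^sub>S K)"
      then obtain a k where ak: "n \<in> N" "a \<in> A" "k \<in> K" "x *\<^sub>M n = a +\<^sub>M x *\<^sub>M k" by (auto simp: ssum_iff scale_def)
      have c: "n \<in> carrier M" "a \<in> carrier M" "k \<in> carrier M" "k \<in> N"
        using ak sub_carr[OF N] sub_carr[OF A] sub_carr[OF K(1)] K(3) by blast+
      have "x *\<^sub>M (n -\<^sub>M k) = a" using ak c x by (simp add: smult_minus madd_minus_cancel)
      then have "n -\<^sub>M k \<in> K" using K(2) ak subD(4)[OF N ak(1) c(4)] by auto
      then have "(n -\<^sub>M k) +\<^sub>M k \<in> K" using subD(3)[OF K(1)] ak by blast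
      then show "n \<in> K" using c by (simp add: madd_minus_cancel)
    qed
  qed
  show "qlen (?C A) N \<le> qlen A (A +\<^sub>S x *\<^sub>S N)"
  proof (rule len_map[where f = "\<lambda>K. A +\<^sub>S x *\<^sub>S K"])
    fix K assume K: "sub K" "?C A \<subseteq> K" "K \<subseteq> N"
    have "sub (A +\<^sub>S x *\<^sub>S K)" using sub_ssum[OF A sub_scale[OF K(1) x]] .
    then show "sub (A +\<^sub>S x *\<^sub>S K) \<and> saturated R M \<mm> (A +\<^sub>S x *\<^sub>S K) \<and> A \<subseteq> A +\<^sub>S x *\<^sub>S K \<and> A +\<^sub>S x *\<^sub>S K \<subseteq> A +\<^sub>S x *\<^sub>S N"
      using saturated_max ssum_ge(1)[OF A sub_scale[OF K(1) x]] ssum_mono[OF order_refl scale_mono[OF K(3)]] by auto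
  next
    fix K K' assume K: "sub K" "?C A \<subseteq> K" "K \<subseteq> N" "sub K'" "?C A \<subseteq> K'" "K' \<subseteq> N" "K \<subset> K'"
    have "A +\<^sub>S x *\<^sub>S K \<subseteq> A +\<^sub>S x *\<^sub>S K'" using K(7) by (intro ssum_mono scale_mono) auto
    moreover have "K = K'" if "A +\<^sub>S x *\<^sub>S K = A +\<^sub>S x *\<^sub>S K'"
      using inv'[OF K(1-3)] inv'[OF K(4-6)] unfolding that by (rule trans[OF sym])
    ultimately show "A +\<^sub>S x *\<^sub>S K \<subset> A +\<^sub>S x *\<^sub>S K'" using K(7) by blast
  qed
qed

text \<open>This recursion turns into Pascal's rule for the binomial coefficients in the length formula.\<close>

lemma qlen_lp_step:
  assumes x: "x \<in> carrier R" "set xs \<subseteq> carrier R" and L: "sub L" and N: "sub N" and LN: "L \<subseteq> N"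
  shows "qlen (L +\<^sub>S seq_power (x # xs) (Suc k) N) N =
    qlen {n \<in> N. x *\<^sub>M n \<in> L +\<^sub>S seq_power (x # xs) (Suc k) N} N + qlen (L +\<^sub>S x *\<^sub>S N +\<^sub>S seq_power xs (Suc k) N) N"
proof -
  have xx: "set (x # xs) \<subseteq> carrier R" using x by simp
  have Q: "sub (seq_power (x # xs) k N)" for k using sub_seq_power[OF xx N] .
  have J: "sub (seq_power xs k N)" for k using sub_seq_power[OF x(2) N] .
  have X: "sub (x *\<^sub>S N)" using sub_scale[OF N x(1)] .
  let ?A = "L +\<^sub>S seq_power (x # xs) (Suc k) N"
  let ?B = "L +\<^sub>S x *\<^sub>S N +\<^sub>S seq_power xs (Suc k) N"
  have A: "sub ?A" using sub_ssum[OF L Q] .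
  have B: "sub ?B" using sub_ssum[OF sub_ssum[OF L X] J] .
  have AN: "?A \<subseteq> N" using LN seq_power_le[OF xx N] by (intro ssum_le N)
  have eq: "?A +\<^sub>S x *\<^sub>S N = ?B"
  proof
    have 1: "L \<subseteq> ?B" "x *\<^sub>S N \<subseteq> ?B" "seq_power xs (Suc k) N \<subseteq> ?B"
      using ssum_ge[OF L X] ssum_ge[OF sub_ssum[OF L X] J[of "Suc k"]] by auto
    have "seq_power (x # xs) (Suc k) N \<subseteq> ?B" unfolding seq_power_Cons[OF xx N]
      using 1 scale_mono[OF seq_power_le[OF xx N, of k], of x] by (intro ssum_le B) auto
    then show "?A +\<^sub>S x *\<^sub>S N \<subseteq> ?B" using 1 by (intro ssum_le B)
    have 2: "L \<subseteq> ?A +\<^sub>S x *\<^sub>S N" "x *\<^sub>S N \<subseteq> ?A +\<^sub>S x *\<^sub>S N" "seq_power (x # xs) (Suc k) N \<subseteq> ?A +\<^sub>S x *\<^sub>S N"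
      using ssum_ge[OF L Q[of "Suc k"]] ssum_ge[OF A X] by auto
    moreover have "seq_power xs (Suc k) N \<subseteq> seq_power (x # xs) (Suc k) N" using xx N by (intro seq_power_mono) auto
    ultimately show "?B \<subseteq> ?A +\<^sub>S x *\<^sub>S N" by (intro ssum_le sub_ssum A X) auto
  qed
  have "qlen ?A N = qlen ?A (?A +\<^sub>S x *\<^sub>S N) + qlen (?A +\<^sub>S x *\<^sub>S N) N"
    by (rule qlen_add[OF A sub_ssum[OF A X] N ssum_ge(1)[OF A X] ssum_le[OF N AN scale_le[OF N x(1)]]])
  then show ?thesis using qlen_colon[OF A N AN x(1)] eq by simp
qed

text \<open>Source of the inequality in the length formula; regularity is what turns it into an
  equality.\<close>

lemma seq_power_le_colon:
  assumes x: "set (x # xs) \<subseteq> carrier R" and L: "sub L" and N: "sub N" and LN: "L \<subseteq> N"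
  shows "L +\<^sub>S seq_power (x # xs) k N \<subseteq> {n \<in> N. x *\<^sub>M n \<in> L +\<^sub>S seq_power (x # xs) (Suc k) N}"
proof
  fix n assume n: "n \<in> L +\<^sub>S seq_power (x # xs) k N"
  then obtain l q where lq: "l \<in> L" "q \<in> seq_power (x # xs) k N" "n = l +\<^sub>M q" by (auto simp: ssum_iff)
  have xc: "x \<in> carrier R" using x by simp
  have "x *\<^sub>M q \<in> seq_power (x # xs) (Suc k) N"
    using seq_smult_mem[OF x sub_seq_power[OF x N], of x q k] lq by simp
  moreover have "x *\<^sub>M n = x *\<^sub>M l +\<^sub>M x *\<^sub>M q"
    using lq xc sub_carr[OF L] sub_carr[OF sub_seq_power[OF x N]] by (simp add: smult_r_distr)
  moreover have "n \<in> N" using ssum_le[OF N LN seq_power_le[OF x N]] n by blast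
  ultimately show "n \<in> {n \<in> N. x *\<^sub>M n \<in> L +\<^sub>S seq_power (x # xs) (Suc k) N}"
    using subD(5)[OF L xc lq(1)] by (auto simp: ssum_iff simp del: seq_power.simps)
qed

lemma seq_smult_Cons_assoc:
  assumes "set (x # xs) \<subseteq> carrier R" "sub L" "sub N"
  shows "L +\<^sub>S x *\<^sub>S N +\<^sub>S seq_smult xs N = L +\<^sub>S seq_smult (x # xs) N"
  using assms ssum_assoc[OF subD(1)[OF assms(2)] subD(1)[OF sub_scale[OF assms(3), of x]] seq_smult_carr[OF _ assms(3), of xs]]
  by simp

text \<open>In the recursion the colon submodule contains L + q^(k+1) N, so its colength is bounded
  by the induction on k; the summand modulo x is bounded by the induction on the number of
  generators.\<close>

lemma qlen_lp_le:
  assumes "set xs \<subseteq> carrier R" "sub L" "sub N" "L \<subseteq> N"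
  shows "qlen (L +\<^sub>S seq_power xs (Suc k) N) N \<le> enat ((k + length xs) choose length xs) * qlen (L +\<^sub>S seq_smult xs N) N"
  using assms
proof (induction xs arbitrary: L k)
  case Nil
  then show ?case by (simp add: enat_Suc_0)
next
  case (Cons x xs)
  note L = Cons.prems(2) and N = Cons.prems(3)
  have x: "x \<in> carrier R" "set xs \<subseteq> carrier R" using Cons.prems by auto
  let ?e = "qlen (L +\<^sub>S seq_smult (x # xs) N) N" and ?L1 = "L +\<^sub>S x *\<^sub>S N"
  have L1: "sub ?L1" "?L1 \<subseteq> N"
    using sub_ssum[OF L sub_scale[OF N x(1)]] Cons.prems(4) scale_le[OF N x(1)] ssum_le[OF N, of L "x *\<^sub>S N"] by auto
  show ?case
  proof (induction k)
    case 0
    then show ?case by (simp add: enat_Suc_0)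
  next
    case (Suc k)
    have "qlen {n \<in> N. x *\<^sub>M n \<in> L +\<^sub>S seq_power (x # xs) (Suc (Suc k)) N} N \<le> qlen (L +\<^sub>S seq_power (x # xs) (Suc k) N) N"
      by (intro len_mono seq_power_le_colon Cons.prems order_refl)
    also note Suc
    finally have 1: "qlen {n \<in> N. x *\<^sub>M n \<in> L +\<^sub>S seq_power (x # xs) (Suc (Suc k)) N} N \<le> enat ((k + length (x # xs)) choose length (x # xs)) * ?e" .
    have 2: "qlen (?L1 +\<^sub>S seq_power xs (Suc (Suc k)) N) N \<le> enat ((Suc k + length xs) choose length xs) * ?e"
      using Cons.IH[OF x(2) L1(1) N L1(2), of "Suc k"] seq_smult_Cons_assoc[OF Cons.prems(1) L N] by simp
    \<comment> \<open>Pascal's rule: for d entries in \<open>x # xs\<close>, binomial (k+d, d) and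
      binomial (k+1+(d-1), d-1) add up to binomial (k+1+d, d).\<close>
    have "enat ((k + length (x # xs)) choose length (x # xs)) * ?e + enat ((Suc k + length xs) choose length xs) * ?e =
        enat ((Suc k + length (x # xs)) choose length (x # xs)) * ?e"
      by (simp add: ac_simps flip: distrib_right)
    then show ?case using qlen_lp_step[OF x L N Cons.prems(4), of "Suc k"] add_mono[OF 1 2] by simp
  qed
qed

text \<open>The same recursion, in which \<open>colon_power\<close> now makes the colon submodule
  equal to L + q^(k+1) N.\<close>

lemma qlen_lp_eq:
  assumes "set xs \<subseteq> \<mm>" "sub L" "sub N" "L \<subseteq> N" "regular_mod L N xs"
  shows "qlen (L +\<^sub>S seq_power xs (Suc k) N) N = enat ((k + length xs) choose length xs) * qlen (L +\<^sub>S seq_smult xs N) N"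
  using assms
proof (induction xs arbitrary: L k)
  case Nil
  then show ?case by (simp add: enat_Suc_0)
next
  case (Cons x xs)
  note L = Cons.prems(2) and N = Cons.prems(3)
  have xm: "x \<in> \<mm>" "set xs \<subseteq> \<mm>" using Cons.prems by auto
  have x: "x \<in> carrier R" "set xs \<subseteq> carrier R" "set (x # xs) \<subseteq> carrier R" using xm mm_carr by auto
  let ?e = "qlen (L +\<^sub>S seq_smult (x # xs) N) N" and ?L1 = "L +\<^sub>S x *\<^sub>S N"
  have L1: "sub ?L1" "?L1 \<subseteq> N"
    using sub_ssum[OF L sub_scale[OF N x(1)]] Cons.prems(4) scale_le[OF N x(1)] ssum_le[OF N, of L "x *\<^sub>S N"] by auto
  show ?case
  proof (induction k)
    case 0
    then show ?case by (simp add: enat_Suc_0)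
  next
    case (Suc k)
    have "{n \<in> N. x *\<^sub>M n \<in> L +\<^sub>S seq_power (x # xs) (Suc (Suc k)) N} = L +\<^sub>S seq_power (x # xs) (Suc k) N"
    proof
      show "{n \<in> N. x *\<^sub>M n \<in> L +\<^sub>S seq_power (x # xs) (Suc (Suc k)) N} \<subseteq> L +\<^sub>S seq_power (x # xs) (Suc k) N"
        using colon_power[OF xm L N Cons.prems(4,5)] by blast
      show "L +\<^sub>S seq_power (x # xs) (Suc k) N \<subseteq> {n \<in> N. x *\<^sub>M n \<in> L +\<^sub>S seq_power (x # xs) (Suc (Suc k)) N}"
        by (rule seq_power_le_colon[OF x(3) L N Cons.prems(4)])
    qed
    then have 1: "qlen {n \<in> N. x *\<^sub>M n \<in> L +\<^sub>S seq_power (x # xs) (Suc (Suc k)) N} N = enat ((k + length (x # xs)) choose length (x # xs)) * ?e"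
      using Suc by simp
    have 2: "qlen (?L1 +\<^sub>S seq_power xs (Suc (Suc k)) N) N = enat ((Suc k + length xs) choose length xs) * ?e"
      using Cons.IH[OF xm(2) L1(1) N L1(2), of "Suc k"] seq_smult_Cons_assoc[OF x(3) L N] Cons.prems(5) by simp
    have "enat ((k + length (x # xs)) choose length (x # xs)) * ?e + enat ((Suc k + length xs) choose length xs) * ?e =
        enat ((Suc k + length (x # xs)) choose length (x # xs)) * ?e"
      by (simp add: ac_simps flip: distrib_right)
    then show ?case using qlen_lp_step[OF x(1,2) L N Cons.prems(4), of "Suc k"] 1 2 by simp
  qed
qed

end

section \<open>Equality of lengths, regularity, and depth at most dimension\<close>

context noeth_local_module
begin

lemma qlen_eq_imp_eq:
  assumes "sub X" "sub Y" "sub N" "X \<subseteq> Y" "Y \<subseteq> N" "qlen X N = qlen Y N" "qlen Y N < \<infinity>"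
  shows "X = Y"
proof -
  obtain n where n: "qlen Y N = enat n" using assms(7) by auto
  have "qlen X N = qlen X Y + qlen Y N" by (rule qlen_add) (use assms in auto)
  then have "qlen X Y = 0" using assms(6) n by (cases "qlen X Y") (auto simp: zero_enat_def)
  then show ?thesis using qlen_eq_0 assms by blast
qed

text \<open>Cancellation among extended naturals: the two bounds must be finite for equality of the
  sums to force equality of the summands.\<close>

lemma enat_add_eq_bounds:
  assumes "a \<le> A" "b \<le> B" "a + b = A + B" "A < \<infinity>" "B < (\<infinity>::enat)"
  shows "a = A" "b = B"
  using assms by (cases a; cases b; cases A; cases B; auto)+

text \<open>Both summands of the recursion are at most their binomial bounds, and these add up to
  the total by Pascal's rule; so both bounds are attained. Equality in the colon summand for every k
  puts an element n with xn in L into all L + q^k N, hence into L by Krull's intersection theorem.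
  Equality in the other summand is the hypothesis for the shorter list modulo x.\<close>

lemma regular_of_qlen_eq:
  assumes "set xs \<subseteq> \<mm>" "sub L" "sub N" "L \<subseteq> N" "qlen (L +\<^sub>S seq_smult xs N) N < \<infinity>"
    and "\<And>k. qlen (L +\<^sub>S seq_power xs (Suc k) N) N = enat ((k + length xs) choose length xs) * qlen (L +\<^sub>S seq_smult xs N) N"
  shows "regular_mod L N xs"
  using assms
proof (induction xs arbitrary: L)
  case (Cons x xs)
  note L = Cons.prems(2) and N = Cons.prems(3) and LN = Cons.prems(4)
  have xm: "x \<in> \<mm>" "set xs \<subseteq> \<mm>" using Cons.prems by auto
  have x: "x \<in> carrier R" "set xs \<subseteq> carrier R" "set (x # xs) \<subseteq> carrier R" using xm mm_carr by auto
  let ?e = "qlen (L +\<^sub>S seq_smult (x # xs) N) N" and ?L1 = "L +\<^sub>S x *\<^sub>S N"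
  have L1: "sub ?L1" "?L1 \<subseteq> N"
    using sub_ssum[OF L sub_scale[OF N x(1)]] LN scale_le[OF N x(1)] ssum_le[OF N, of L "x *\<^sub>S N"] by auto
  obtain e where e: "?e = enat e" using Cons.prems(5) by auto
  have Q: "sub (seq_power (x # xs) k N)" for k using sub_seq_power[OF x(3) N] .
  define B where "B k = L +\<^sub>S seq_power (x # xs) k N" for k
  define C where "C k = {n \<in> N. x *\<^sub>M n \<in> B (Suc k)}" for k
  have B: "sub (B k)" "B k \<subseteq> N" for k
    unfolding B_def using sub_ssum[OF L Q] ssum_le[OF N LN seq_power_le[OF x(3) N]] by auto
  have C: "sub (C k)" "C k \<subseteq> N" for k unfolding C_def using sub_pre[OF N B(1) x(1)] by auto
  have BC: "B k \<subseteq> C k" for k unfolding B_def C_def by (rule seq_power_le_colon[OF x(3) L N LN])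
  have G: "qlen (?L1 +\<^sub>S seq_power xs (Suc k) N) N \<le> enat ((k + length xs) choose length xs) * ?e" for k
    using qlen_lp_le[OF x(2) L1(1) N L1(2), of k] seq_smult_Cons_assoc[OF x(3) L N] by simp
  have Bk: "qlen (B (Suc k)) N = enat ((k + length (x # xs)) choose length (x # xs)) * ?e" for k
    unfolding B_def by (rule Cons.prems(6))
  have "N \<subseteq> B 0" unfolding B_def using ssum_ge(2)[OF L N] by simp
  then have "B 0 = N" using B(2) by blast
  then have B0: "qlen (B 0) N = 0" using len_self by simp
  \<comment> \<open>At k = 0 the first summand vanishes because \<open>B 0 = N\<close>, and both
    binomial coefficients are 1; for positive k this is Pascal's rule.\<close>
  have sum: "qlen (B k) N + enat ((k + length xs) choose length xs) * ?e = qlen (B (Suc k)) N" for k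
  proof (cases k)
    case 0
    then show ?thesis unfolding Bk using B0 by simp
  next
    case (Suc j)
    show ?thesis unfolding Suc Bk by (simp add: ac_simps flip: distrib_right)
  qed
  have fin: "qlen (B k) N < \<infinity>" for k using B0 Bk e by (cases k) auto
  have eqs: "qlen (C k) N = qlen (B k) N \<and> qlen (?L1 +\<^sub>S seq_power xs (Suc k) N) N = enat ((k + length xs) choose length xs) * ?e" for k
  proof -
    have "qlen (C k) N + qlen (?L1 +\<^sub>S seq_power xs (Suc k) N) N = qlen (B k) N + enat ((k + length xs) choose length xs) * ?e"
      unfolding sum using qlen_lp_step[OF x(1,2) L N LN, of k] by (simp add: B_def C_def)
    moreover have "qlen (C k) N \<le> qlen (B k) N" using BC by (intro len_mono) auto
    moreover have "enat ((k + length xs) choose length xs) * ?e < \<infinity>" using e by simp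
    ultimately show ?thesis using enat_add_eq_bounds[OF _ G _ fin] by blast
  qed
  have CB: "C k = B k" for k
    using qlen_eq_imp_eq[OF B(1) C(1) N BC C(2)] eqs fin by metis
  have "n \<in> L" if n: "n \<in> N" "x *\<^sub>M n \<in> L" for n
  proof (rule krull_intersection[OF Cons.prems(1) L N])
    fix k
    have "x *\<^sub>M n \<in> B (Suc k)" using n ssum_ge(1)[OF L Q] unfolding B_def by blast
    then have "n \<in> C k" using n by (simp add: C_def)
    then show "n \<in> L +\<^sub>S seq_power (x # xs) k N" using CB unfolding B_def by blast
  qed
  moreover have "regular_mod ?L1 N xs"
  proof (rule Cons.IH[OF xm(2) L1(1) N L1(2)])
    show "qlen (?L1 +\<^sub>S seq_smult xs N) N < \<infinity>" using Cons.prems(5) seq_smult_Cons_assoc[OF x(3) L N] by simp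
    show "qlen (?L1 +\<^sub>S seq_power xs (Suc k) N) N = enat ((k + length xs) choose length xs) * qlen (?L1 +\<^sub>S seq_smult xs N) N" for k
      using eqs[of k] seq_smult_Cons_assoc[OF x(3) L N] by simp
  qed
  ultimately show ?case by simp
qed simp

text \<open>The inequality depth \<le> dim. A chain over the annihilator of N/(L + xN) is extended
  downwards by a prime over Ann (N/L) that omits x.\<close>

lemma regular_up_chain:
  assumes "set xs \<subseteq> \<mm>" "sub L" "sub N" "L \<subseteq> N" "regular_mod L N xs" "L +\<^sub>S seq_smult xs N \<noteq> N"
  shows "\<exists>p. colon R M L N \<subseteq> p \<and> up_chain R (length xs) p"
  using assms
proof (induction xs arbitrary: L)
  case Nil
  then have "L \<noteq> N" using ssum_zero by auto
  then obtain u where u: "u \<in> N" "u \<notin> L" using Nil by blast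
  obtain v where "v \<in> N" "primeideal (colon R M L {v}) R"
    using max_ann_above[OF Nil(2,3) u] by metis
  then show ?case using colon_mono[of L L "{v}" N] by auto
next
  case (Cons x xs)
  note L = Cons.prems(2) and N = Cons.prems(3)
  have x: "x \<in> carrier R" "set xs \<subseteq> carrier R" "set (x # xs) \<subseteq> carrier R" using Cons.prems mm_carr by auto
  let ?L1 = "L +\<^sub>S x *\<^sub>S N"
  have X: "sub (x *\<^sub>S N)" using sub_scale[OF N x(1)] .
  have L1: "sub ?L1" "?L1 \<subseteq> N"
    using sub_ssum[OF L X] Cons.prems(4) scale_le[OF N x(1)] ssum_le[OF N, of L "x *\<^sub>S N"] by auto
  have "\<exists>p. colon R M ?L1 N \<subseteq> p \<and> up_chain R (length xs) p"
    by (rule Cons.IH) (use Cons.prems L1 seq_smult_Cons_assoc[OF x(3) L N] in auto)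
  then obtain p where p: "colon R M ?L1 N \<subseteq> p" "up_chain R (length xs) p" by blast
  note pp = R.primeE[OF up_chain_prime[OF p(2)]]
  have "x \<in> colon R M ?L1 N" using x ssum_ge(2)[OF L X] by (auto simp: colon_def scale_def)
  then have xp: "x \<in> p" using p by blast
  have Lp: "colon R M L N \<subseteq> p" using p(1) colon_mono[OF ssum_ge(1)[OF L X], of N N] by blast
  \<comment> \<open>A prime disjoint from S lies inside p and omits x, so it is a proper step below
    p. Ann (N/L) is disjoint from S: since powers of x are regular modulo L, an element s x^k
    annihilating N/L would leave s in Ann (N/L) \<subseteq> p.\<close>
  define S where "S = {s \<otimes> x [^] (k::nat) | s k. s \<in> carrier R \<and> s \<notin> p}"
  have nzd: "n \<in> L" if "n \<in> N" "x *\<^sub>M n \<in> L" for n using Cons.prems(5) that by simp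
  have pow: "n \<in> L" if "n \<in> N" "x [^] (k::nat) *\<^sub>M n \<in> L" for n k
    using that
  proof (induction k arbitrary: n)
    case 0
    then show ?case using sub_carr[OF N] by simp
  next
    case (Suc k)
    have "x [^] k *\<^sub>M x *\<^sub>M n \<in> L" using Suc.prems x sub_carr[OF N] by (simp add: smult_assoc1)
    then have "x *\<^sub>M n \<in> L" using Suc.IH subD(5)[OF N x(1)] Suc.prems by blast
    then show ?case using nzd Suc.prems by blast
  qed
  have disj: "colon R M L N \<inter> S = {}"
  proof (rule ccontr)
    assume "\<not> ?thesis"
    then obtain s k where s: "s \<in> carrier R" "s \<notin> p" "s \<otimes> x [^] (k::nat) \<in> colon R M L N" by (auto simp: S_def)
    have "s *\<^sub>M n \<in> L" if n: "n \<in> N" for n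
    proof (rule pow)
      show "s *\<^sub>M n \<in> N" using subD(5)[OF N s(1) n] .
      have "x [^] k *\<^sub>M s *\<^sub>M n = (s \<otimes> x [^] k) *\<^sub>M n"
        using s(1) x sub_carr[OF N n] by (simp add: smult_assoc1 smult_commute)
      then show "x [^] k *\<^sub>M s *\<^sub>M n \<in> L" using s(3) n by (simp add: colon_def)
    qed
    then have "s \<in> colon R M L N" using s by (simp add: colon_def)
    then show False using Lp s by blast
  qed
  have S1: "s \<in> S" if "s \<in> carrier R" "s \<notin> p" for s
    unfolding S_def using that by (intro CollectI exI[of _ s] exI[of _ 0]) auto
  have xS: "x \<in> S" unfolding S_def using pp(1) x by (intro CollectI exI[of _ \<one>] exI[of _ 1]) auto
  have Smult: "u \<otimes> v \<in> S" if uv: "u \<in> S" "v \<in> S" for u v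
  proof -
    obtain s k s' k' where *: "s \<in> carrier R" "s \<notin> p" "u = s \<otimes> x [^] (k::nat)"
      "s' \<in> carrier R" "s' \<notin> p" "v = s' \<otimes> x [^] (k'::nat)" using uv unfolding S_def by blast
    then have "u \<otimes> v = (s \<otimes> s') \<otimes> x [^] (k + k')"
      using x by (simp add: R.m_ac R.nat_pow_mult[symmetric])
    moreover have "s \<otimes> s' \<notin> p" using * pp(4) by blast
    ultimately show ?thesis unfolding S_def using * by blast
  qed
  have Sc: "S \<subseteq> carrier R" using x by (auto simp: S_def)
  obtain q where q: "primeideal q R" "colon R M L N \<subseteq> q" "q \<inter> S = {}"
    using prime_in_multiplicative_complement[OF colon_ideal[OF L subD(1)[OF N]] Sc S1[OF _ pp(1)] Smult disj] by blast
  have "q \<subseteq> p" using q(3) S1 R.primeE(2)[OF q(1)] by blast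
  moreover have "x \<notin> q" using xS q(3) by blast
  ultimately have "up_chain R (length (x # xs)) q" using q(1) p(2) xp by auto
  then show ?case using q(2) by blast
qed

section \<open>Adding lengths along a filtration\<close>

lemma qlen_second_iso:
  assumes X: "sub X" and L: "sub L"
  shows "qlen X (L +\<^sub>S X) = qlen (X \<inter> L) L"
proof (rule antisym)
  have inv: "K \<inter> L +\<^sub>S X = K" if K: "sub K" "X \<subseteq> K" "K \<subseteq> L +\<^sub>S X" for K
  proof
    show "K \<inter> L +\<^sub>S X \<subseteq> K" using K by (intro ssum_le) auto
    have "K \<subseteq> (L +\<^sub>S X) \<inter> K" using K by blast
    also have "\<dots> \<subseteq> (L \<inter> K) +\<^sub>S X" by (rule modular_law[OF L X K(1,2)])
    finally show "K \<subseteq> K \<inter> L +\<^sub>S X" by (simp add: Int_commute)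
  qed
  have inv': "(K +\<^sub>S X) \<inter> L = K" if K: "sub K" "X \<inter> L \<subseteq> K" "K \<subseteq> L" for K
  proof
    show "K \<subseteq> (K +\<^sub>S X) \<inter> L" using ssum_ge(1)[OF K(1) X] K by blast
    have "(K +\<^sub>S X) \<inter> L = (X +\<^sub>S K) \<inter> L" using ssum_comm[OF subD(1)[OF K(1)] subD(1)[OF X]] by simp
    also have "\<dots> \<subseteq> (X \<inter> L) +\<^sub>S K" by (rule modular_law[OF X K(1) L K(3)])
    also have "\<dots> \<subseteq> K" using K by (intro ssum_le) auto
    finally show "(K +\<^sub>S X) \<inter> L \<subseteq> K" .
  qed
  show "qlen X (L +\<^sub>S X) \<le> qlen (X \<inter> L) L"
  proof (rule len_map[where f = "\<lambda>K. K \<inter> L"])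
    fix K K' assume K: "sub K" "X \<subseteq> K" "K \<subseteq> L +\<^sub>S X" "sub K'" "X \<subseteq> K'" "K' \<subseteq> L +\<^sub>S X" "K \<subset> K'"
    have "K = K'" if "K \<inter> L = K' \<inter> L" using inv[OF K(1-3)] inv[OF K(4-6)] unfolding that by (rule trans[OF sym])
    then show "K \<inter> L \<subset> K' \<inter> L" using K(7) by blast
  qed (use sub_Int L saturated_max in auto)
  show "qlen (X \<inter> L) L \<le> qlen X (L +\<^sub>S X)"
  proof (rule len_map[where f = "\<lambda>K. K +\<^sub>S X"])
    fix K assume K: "sub K" "X \<inter> L \<subseteq> K" "K \<subseteq> L"
    show "sub (K +\<^sub>S X) \<and> saturated R M \<mm> (K +\<^sub>S X) \<and> X \<subseteq> K +\<^sub>S X \<and> K +\<^sub>S X \<subseteq> L +\<^sub>S X"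
      using sub_ssum[OF K(1) X] saturated_max ssum_ge(2)[OF K(1) X] ssum_mono[OF K(3) order_refl] by auto
  next
    fix K K' assume K: "sub K" "X \<inter> L \<subseteq> K" "K \<subseteq> L" "sub K'" "X \<inter> L \<subseteq> K'" "K' \<subseteq> L" "K \<subset> K'"
    have "K +\<^sub>S X \<subseteq> K' +\<^sub>S X" using K(7) by (intro ssum_mono) auto
    moreover have "K = K'" if "K +\<^sub>S X = K' +\<^sub>S X"
      using inv'[OF K(1-3)] inv'[OF K(4-6)] unfolding that by (rule trans[OF sym])
    ultimately show "K +\<^sub>S X \<subset> K' +\<^sub>S X" using K(7) by blast
  qed
qed

lemma seq_power_take:
  assumes xs: "set xs \<subseteq> carrier R" and N: "sub N"
    and kill: "\<And>x n. x \<in> set (drop m xs) \<Longrightarrow> n \<in> N \<Longrightarrow> x *\<^sub>M n = 0\<^sub>M"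
  shows "seq_power xs k N = seq_power (take m xs) k N"
proof (induction k)
  case (Suc k)
  have t: "set (take m xs) \<subseteq> carrier R" "set (drop m xs) \<subseteq> carrier R"
    using xs set_take_subset[of m xs] set_drop_subset[of m xs] by auto
  let ?K = "seq_power (take m xs) k N"
  have K: "sub ?K" "?K \<subseteq> N" using sub_seq_power[OF t(1) N] seq_power_le[OF t(1) N] by auto
  have "seq_smult (drop m xs) ?K \<subseteq> {0\<^sub>M}"
    unfolding seq_smult_le_iff[OF t(2) K(1) sub_zero] using kill K by blast
  then have "seq_smult (take m xs) ?K +\<^sub>S seq_smult (drop m xs) ?K = seq_smult (take m xs) ?K"
    using subD(2)[OF sub_seq_smult[OF t(1) K(1)]] by (intro ssum_absorb sub_seq_smult t K) auto
  then have "seq_smult xs ?K = seq_smult (take m xs) ?K" using seq_smult_append[OF t K(1)] by simp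
  then show ?case using Suc by simp
qed simp

text \<open>\<open>E i\<close> stands for \<open>D (i - 1)\<close>, with 0 below \<open>D 0\<close>,
  so that all graded quotients are \<open>D i\<close> modulo \<open>E i\<close>, including i = 0.
  The filtration is abstract here: what remains of goodness is \<open>kill\<close>, by which only
  the first \<open>d i\<close> generators act on \<open>D i\<close>.\<close>

lemma filtration_formula_iff:
  fixes D :: "nat \<Rightarrow> 'c set" and d :: "nat \<Rightarrow> nat"
  assumes D: "\<And>i. i \<le> t \<Longrightarrow> sub (D i)" and mono: "\<And>i. i < t \<Longrightarrow> D i \<subseteq> D (Suc i)" and top: "D t = carrier M"
    and xs: "set xs \<subseteq> \<mm>" and fin: "qlen (seq_smult xs (carrier M)) (carrier M) < \<infinity>"
    and d: "d 0 = 0" "\<And>i. i \<le> t \<Longrightarrow> d i \<le> length xs"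
    and kill: "\<And>i x n. i \<le> t \<Longrightarrow> x \<in> set (drop (d i) xs) \<Longrightarrow> n \<in> D i \<Longrightarrow> x *\<^sub>M n = 0\<^sub>M"
  defines "E \<equiv> \<lambda>i. if i = 0 then {0\<^sub>M} else D (i - 1)"
  shows "(\<forall>k. qlen (seq_power xs (Suc k) (carrier M)) (carrier M) =
            (\<Sum>i = 0..t. enat ((k + d i) choose d i) * qlen (E i +\<^sub>S seq_smult xs (D i)) (D i))) \<longleftrightarrow>
         (\<forall>i\<in>{1..t}. regular_mod (D (i - 1)) (D i) (take (d i) xs))"
proof -
  have xc: "set xs \<subseteq> carrier R" using xs mm_carr by blast
  have E: "sub (E i)" "E i \<subseteq> D i" if "i \<le> t" for i
    using D[of "i - 1"] subD(2)[OF D[OF that]] mono[of "i - 1"] that sub_zero by (cases i; auto simp: E_def)+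
  have tk: "set (take (d i) xs) \<subseteq> \<mm>" "set (take (d i) xs) \<subseteq> carrier R" for i
    using xs xc set_take_subset[of "d i" xs] by auto
  have lpt: "seq_power xs k (D i) = seq_power (take (d i) xs) k (D i)" if "i \<le> t" for i k
    by (rule seq_power_take[OF xc D[OF that] kill[OF that]])
  have lst: "seq_smult xs (D i) = seq_smult (take (d i) xs) (D i)" if "i \<le> t" for i
    using lpt[OF that, of 1] by simp
  have lpE: "seq_power xs k (E i) = seq_power (take (d i) xs) k (E i)" if "i \<le> t" for i k
    by (rule seq_power_take[OF xc E(1)[OF that] kill[OF that]]) (use E(2)[OF that] in auto)
  have len_take: "length (take (d i) xs) = d i" if "i \<le> t" for i using d(2)[OF that] by simp
  define X where "X k i = seq_power xs (Suc k) (D i)" for k i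
  have X: "sub (X k i)" "X k i \<subseteq> D i" if "i \<le> t" for k i
    unfolding X_def using sub_seq_power[OF xc D[OF that]] seq_power_le[OF xc D[OF that]] by blast+
  define b where "b k i = qlen (E i +\<^sub>S X k i) (D i)" for k i
  let ?e = "\<lambda>i. qlen (E i +\<^sub>S seq_smult xs (D i)) (D i)"
  let ?c = "\<lambda>k i. enat ((k + d i) choose d i)"
  \<comment> \<open>\<open>b k i\<close> is the length of the i-th graded quotient modulo q^(k+1).
    The formula hinges on comparing q^(k+1) \<open>D i\<close> \<inter> \<open>E i\<close>, which
    occurs in the other summand, with q^(k+1) \<open>E i\<close>.\<close>
  have step: "qlen (X k i) (D i) = qlen (X k i \<inter> E i) (E i) + b k i" if "i \<le> t" for k i
  proof -
    have "qlen (X k i) (D i) = qlen (X k i) (E i +\<^sub>S X k i) + b k i" unfolding b_def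
      using ssum_ge(2)[OF E(1)[OF that] X(1)[OF that]] ssum_le[OF D[OF that] E(2)[OF that] X(2)[OF that]]
      by (intro qlen_add X D sub_ssum E that)
    then show ?thesis using qlen_second_iso[OF X(1)[OF that] E(1)[OF that]] by simp
  qed
  have b_le: "b k i \<le> ?c k i * ?e i" if "i \<le> t" for k i
    using qlen_lp_le[OF tk(2) E(1)[OF that] D[OF that] E(2)[OF that], of i k] that
    by (simp only: b_def X_def lpt lst len_take)
  \<comment> \<open>\<open>D i\<close> is only a submodule, so the finite length of M/qM does not
    pass to it directly. What does pass is that \<mm> is the only prime over Ann M and xs.\<close>
  have efin: "?e i < \<infinity>" if i: "i \<le> t" for i
  proof (rule qlen_finite)
    have J: "sub (seq_smult xs (D i))" using sub_seq_smult[OF xc D[OF i]] .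
    show "sub (E i +\<^sub>S seq_smult xs (D i))" by (rule sub_ssum[OF E(1)[OF i] J])
    show "E i +\<^sub>S seq_smult xs (D i) \<subseteq> D i" using ssum_le[OF D[OF i] E(2)[OF i] seq_smult_le[OF xc D[OF i]]] .
    fix p assume p: "primeideal p R" "colon R M (E i +\<^sub>S seq_smult xs (D i)) (D i) \<subseteq> p"
    show "p = \<mm>"
    proof (rule parameters_of_finite_length[OF xs sub_zero carrier_is_submodule _ _ p(1)])
      show "{0\<^sub>M} \<subseteq> carrier M" by simp
      show "qlen ({0\<^sub>M} +\<^sub>S seq_smult xs (carrier M)) (carrier M) < \<infinity>"
        using fin ssum_absorb[OF sub_seq_smult[OF xc carrier_is_submodule] sub_zero]
          ssum_comm[of "{0\<^sub>M}" "seq_smult xs (carrier M)"] subD[OF sub_seq_smult[OF xc carrier_is_submodule]] by simp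
      have "colon R M {0\<^sub>M} (carrier M) \<subseteq> colon R M (E i +\<^sub>S seq_smult xs (D i)) (D i)"
        using subD(1)[OF D[OF i]] subD(2)[OF sub_ssum[OF E(1)[OF i] J]] by (intro colon_mono) auto
      moreover have "set xs \<subseteq> colon R M (E i +\<^sub>S seq_smult xs (D i)) (D i)"
        using xc seq_smult_mem[OF xc D[OF i]] ssum_ge(2)[OF E(1)[OF i] J] by (auto simp: colon_def)
      ultimately show "colon R M {0\<^sub>M} (carrier M) \<union> set xs \<subseteq> p" using p(2) by blast
    qed
  qed (rule D[OF i])
  have sum_upto: "j \<le> t \<Longrightarrow> qlen (X k j) (D j) \<le> (\<Sum>i = 0..j. b k i)" for j k
  proof (induction j)
    case 0
    have "qlen (X k 0 \<inter> E 0) (E 0) = 0"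
    proof -
      have "X k 0 \<inter> E 0 = E 0" using subD(2)[OF X(1)[OF 0]] by (auto simp: E_def)
      then show ?thesis using len_self by simp
    qed
    then show ?case using step[OF 0, of k] by simp
  next
    case (Suc j)
    have "E (Suc j) = D j" by (simp add: E_def)
    moreover have "X k j \<subseteq> X k (Suc j) \<inter> D j"
      unfolding X_def using Suc.prems mono[of j] seq_power_le[OF xc D, of j "Suc k"]
      by (intro Int_greatest seq_power_mono xc D) auto
    then have "qlen (X k (Suc j) \<inter> D j) (D j) \<le> qlen (X k j) (D j)" by (intro len_mono) auto
    ultimately have "qlen (X k (Suc j)) (D (Suc j)) \<le> qlen (X k j) (D j) + b k (Suc j)"
      using step[OF Suc.prems, of k] by (simp add: add_right_mono)
    also have "\<dots> \<le> (\<Sum>i = 0..j. b k i) + b k (Suc j)" using Suc by (intro add_right_mono) auto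
    finally show ?case by simp
  qed
  show ?thesis
  proof
    assume eq: "\<forall>k. qlen (seq_power xs (Suc k) (carrier M)) (carrier M) = (\<Sum>i = 0..t. ?c k i * ?e i)"
    \<comment> \<open>The sum of the \<open>b k i\<close> lies between the two sides of the formula,
      which agree, and each \<open>b k i\<close> is at most its own term. Since the bounds are
      finite, a single term can be split off and compared.\<close>
    have beq: "b k i = ?c k i * ?e i" if i: "i \<le> t" for k i
    proof -
      have "(\<Sum>i = 0..t. ?c k i * ?e i) \<le> (\<Sum>i = 0..t. b k i)"
        using sum_upto[of t k] eq top by (simp add: X_def del: seq_power.simps)
      moreover have le: "(\<Sum>i\<in>{0..t} - {i}. b k i) \<le> (\<Sum>i\<in>{0..t} - {i}. ?c k i * ?e i)"
        by (intro sum_mono b_le) auto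
      moreover have "(\<Sum>i = 0..t. b k i) \<le> (\<Sum>i = 0..t. ?c k i * ?e i)" by (intro sum_mono b_le) auto
      ultimately have s: "b k i + (\<Sum>i\<in>{0..t} - {i}. b k i) = ?c k i * ?e i + (\<Sum>i\<in>{0..t} - {i}. ?c k i * ?e i)"
        using i sum.remove[of "{0..t}" i "b k"] sum.remove[of "{0..t}" i "\<lambda>i. ?c k i * ?e i"] by simp
      have fin1: "?c k i * ?e i < \<infinity>" if "i \<le> t" for i using efin[OF that] by auto
      have "(\<Sum>i\<in>F. ?c k i * ?e i) < \<infinity>" if "finite F" "F \<subseteq> {0..t}" for F
        using that
      proof (induction F rule: finite_induct)
        case (insert j F)
        then have "?c k j * ?e j < \<infinity>" "(\<Sum>i\<in>F. ?c k i * ?e i) < \<infinity>" using fin1[of j] by auto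
        then show ?case using insert.hyps by auto
      qed simp
      then have "(\<Sum>i\<in>{0..t} - {i}. ?c k i * ?e i) < \<infinity>" by auto
      then show ?thesis by (rule enat_add_eq_bounds(1)[OF b_le[OF i] le s fin1[OF i]])
    qed
    show "\<forall>i\<in>{1..t}. regular_mod (D (i - 1)) (D i) (take (d i) xs)"
    proof
      fix i assume "i \<in> {1..t}"
      then have i: "i \<le> t" and Ei: "E i = D (i - 1)" by (auto simp: E_def)
      have "regular_mod (E i) (D i) (take (d i) xs)"
      proof (rule regular_of_qlen_eq[OF tk(1) E(1)[OF i] D[OF i] E(2)[OF i]])
        show "qlen (E i +\<^sub>S seq_smult (take (d i) xs) (D i)) (D i) < \<infinity>" using efin[OF i] lst[OF i] by simp
        show "qlen (E i +\<^sub>S seq_power (take (d i) xs) (Suc k) (D i)) (D i) =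
            enat ((k + length (take (d i) xs)) choose length (take (d i) xs)) * qlen (E i +\<^sub>S seq_smult (take (d i) xs) (D i)) (D i)" for k
          using beq[OF i, of k] unfolding b_def X_def lpt[OF i] lst[OF i] len_take[OF i] .
      qed
      then show "regular_mod (D (i - 1)) (D i) (take (d i) xs)" using Ei by simp
    qed
  next
    assume r: "\<forall>i\<in>{1..t}. regular_mod (D (i - 1)) (D i) (take (d i) xs)"
    \<comment> \<open>At i = 0 the list is empty because \<open>d 0 = 0\<close>, so regularity there
      is automatic.\<close>
    have rE: "regular_mod (E i) (D i) (take (d i) xs)" if "i \<le> t" for i
      using r that d(1) by (cases "i = 0") (auto simp: E_def)
    have beq: "b k i = ?c k i * ?e i" if i: "i \<le> t" for k i
      using qlen_lp_eq[OF tk(1) E(1)[OF i] D[OF i] E(2)[OF i] rE[OF i], of k]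
      unfolding b_def X_def lpt[OF i] lst[OF i] len_take[OF i] .
    have "qlen (X k j) (D j) = (\<Sum>i = 0..j. b k i)" if "j \<le> t" for j k
      using that
    proof (induction j)
      case 0
      have "X k 0 \<inter> E 0 = E 0" using subD(2)[OF X(1)[OF 0]] by (auto simp: E_def)
      then have "qlen (X k 0 \<inter> E 0) (E 0) = 0" using len_self by simp
      then show ?case using step[OF 0, of k] by simp
    next
      case (Suc j)
      have Ej: "E (Suc j) = D j" by (simp add: E_def)
      have j: "j \<le> t" using Suc.prems by simp
      have "X k (Suc j) \<inter> D j \<subseteq> X k j"
        using seq_power_inter_regular[OF tk(1) E(1)[OF Suc.prems] D[OF Suc.prems] E(2)[OF Suc.prems] rE[OF Suc.prems], of "Suc k"]
        unfolding lpt[OF Suc.prems, symmetric] lpE[OF Suc.prems, symmetric, unfolded Ej] Ej X_def .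
      moreover have "X k j \<subseteq> X k (Suc j) \<inter> D j"
        unfolding X_def using Suc.prems mono[of j] seq_power_le[OF xc D, of j "Suc k"]
        by (intro Int_greatest seq_power_mono xc D) auto
      ultimately have "X k (Suc j) \<inter> D j = X k j" by blast
      then have "qlen (X k (Suc j)) (D (Suc j)) = qlen (X k j) (D j) + b k (Suc j)"
        using step[OF Suc.prems, of k] Ej by simp
      then show ?case using Suc by simp
    qed
    from this[of t] show "\<forall>k. qlen (seq_power xs (Suc k) (carrier M)) (carrier M) = (\<Sum>i = 0..t. ?c k i * ?e i)"
      using beq top by (auto simp: X_def simp del: seq_power.simps)
  qed
qed

end

section \<open>Noetherian rings and modules\<close>

lemma noeth_cringI:
  assumes "cring R" "noetherian_ring R"
  shows "noeth_cring R"
proof -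
  interpret cring R by fact
  interpret noetherian_ring R by fact
  have "\<not> (\<exists>f. \<forall>i. (f (Suc i), f i) \<in> {(J, I). ideal I R \<and> ideal J R \<and> I \<subset> J})"
  proof
    assume "\<exists>f. \<forall>i. (f (Suc i), f i) \<in> {(J, I). ideal I R \<and> ideal J R \<and> I \<subset> J}"
    then obtain f :: "nat \<Rightarrow> 'a set" where f: "\<And>i. ideal (f i) R" "\<And>i. f i \<subset> f (Suc i)"
      by blast
    have mono: "f i \<subseteq> f j" if "i \<le> j" for i j
      using f(2) by (intro lift_Suc_mono_le[OF _ that]) auto
    have "\<Union>(range f) \<in> range f"
    proof (rule ideal_chain_is_trivial)
      show "subset.chain {I. ideal I R} (range f)"
        unfolding subset_chain_def using f(1) mono nat_le_linear by blast
    qed simp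
    then obtain n where "\<Union>(range f) = f n" by blast
    then have "f (Suc n) \<subseteq> f n" by blast
    then show False using f(2)[of n] by blast
  qed
  then have "wf {(J, I). ideal I R \<and> ideal J R \<and> I \<subset> J}"
    unfolding wf_iff_no_infinite_down_chain .
  then show ?thesis by (intro noeth_cring.intro noeth_cring_axioms.intro is_cring)
qed

context module
begin

lemma span_module_sub: "S \<subseteq> carrier M \<Longrightarrow> sub (span_module R M S)"
proof -
  assume S: "S \<subseteq> carrier M"
  have c: "span_module R M S \<subseteq> carrier M" unfolding span_module_def using S carrier_is_submodule by blast
  show ?thesis
    by (rule subI) (use c subD in \<open>auto simp: span_module_def\<close>)
qed

lemma span_module_ge: "S \<subseteq> span_module R M S"
  by (auto simp: span_module_def)

lemma span_module_le: "sub N \<Longrightarrow> S \<subseteq> N \<Longrightarrow> span_module R M S \<subseteq> N"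
  by (auto simp: span_module_def)

text \<open>A submodule K of A + Rv is measured by the ideal of coefficients of v occurring in K,
  and then by K \<inter> A. For N \<subseteq> K with equal measures, k = s + rv in K is matched by
  some s' + rv in N, and the difference s - s' lies in K \<inter> A = N \<inter> A; so N = K. The
  lexicographic order therefore makes strict growth well-founded.\<close>

lemma wf_subs_extend:
  assumes A: "sub A" and v: "v \<in> carrier M"
    and wfI: "wf {(J, I). ideal I R \<and> ideal J R \<and> I \<subset> J}"
    and wfA: "wf {(K, N). sub N \<and> sub K \<and> N \<subset> K \<and> K \<subseteq> A}"
  shows "wf {(K, N). sub N \<and> sub K \<and> N \<subset> K \<and> K \<subseteq> A +\<^sub>S cyclic v}"
proof -
  define I where "I K = {r \<in> carrier R. \<exists>s\<in>A. s +\<^sub>M r *\<^sub>M v \<in> K}" for K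
  have Ac: "s \<in> carrier M" if "s \<in> A" for s using that A sub_carr by blast
  have ideal_I: "ideal (I K) R" if K: "sub K" for K
  proof (rule R.cr_idealI)
    have "0\<^sub>M +\<^sub>M \<zero> *\<^sub>M v = 0\<^sub>M" using v by simp
    then have "0\<^sub>M +\<^sub>M \<zero> *\<^sub>M v \<in> K" using subD(2)[OF K] by metis
    then show "\<zero> \<in> I K" using subD(2)[OF A] by (auto simp: I_def)
    show "a \<oplus> b \<in> I K" if ab: "a \<in> I K" "b \<in> I K" for a b
    proof -
      from ab obtain s s' where s: "a \<in> carrier R" "b \<in> carrier R" "s \<in> A" "s' \<in> A" "s +\<^sub>M a *\<^sub>M v \<in> K" "s' +\<^sub>M b *\<^sub>M v \<in> K"
        by (auto simp: I_def)
      have "(s +\<^sub>M a *\<^sub>M v) +\<^sub>M (s' +\<^sub>M b *\<^sub>M v) = (s +\<^sub>M s') +\<^sub>M (a \<oplus> b) *\<^sub>M v"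
        using s v Ac by (simp add: smult_l_distr M.a_ac)
      then show ?thesis unfolding I_def using s subD(3)[OF K s(5,6)] subD(3)[OF A s(3,4)] by auto
    qed
    show "a \<otimes> b \<in> I K" if ab: "a \<in> carrier R" "b \<in> I K" for a b
    proof -
      from ab obtain s where s: "b \<in> carrier R" "s \<in> A" "s +\<^sub>M b *\<^sub>M v \<in> K" by (auto simp: I_def)
      have "a *\<^sub>M (s +\<^sub>M b *\<^sub>M v) = a *\<^sub>M s +\<^sub>M (a \<otimes> b) *\<^sub>M v"
        using s v Ac ab by (simp add: smult_r_distr smult_assoc1)
      then show ?thesis unfolding I_def using s ab(1) subD(5)[OF K ab(1) s(3)] subD(5)[OF A ab(1) s(2)] by auto
    qed
  qed (auto simp: I_def)
  let ?lex = "{(J, I). ideal I R \<and> ideal J R \<and> I \<subset> J} <*lex*> {(K, N). sub N \<and> sub K \<and> N \<subset> K \<and> K \<subseteq> A}"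
  have "wf (inv_image ?lex (\<lambda>K. (I K, K \<inter> A)))" using wfI wfA by (intro wf_inv_image wf_lex_prod)
  moreover have "{(K, N). sub N \<and> sub K \<and> N \<subset> K \<and> K \<subseteq> A +\<^sub>S cyclic v} \<subseteq> inv_image ?lex (\<lambda>K. (I K, K \<inter> A))"
  proof (intro subrelI)
    fix K N assume "(K, N) \<in> {(K, N). sub N \<and> sub K \<and> N \<subset> K \<and> K \<subseteq> A +\<^sub>S cyclic v}"
    then have KN: "sub N" "sub K" "N \<subset> K" "K \<subseteq> A +\<^sub>S cyclic v" by auto
    have "I N \<subseteq> I K" "N \<inter> A \<subseteq> K \<inter> A" using KN(3) by (auto simp: I_def)
    moreover have "\<not> (I N = I K \<and> N \<inter> A = K \<inter> A)"
    proof
      assume eq: "I N = I K \<and> N \<inter> A = K \<inter> A"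
      have "K \<subseteq> N"
      proof
        fix k assume k: "k \<in> K"
        then have "k \<in> A +\<^sub>S cyclic v" using KN(4) by blast
        then obtain s r where sr: "s \<in> A" "r \<in> carrier R" "k = s +\<^sub>M r *\<^sub>M v" by (auto simp: ssum_iff cyclic_def)
        then have "r \<in> I K" using k by (auto simp: I_def)
        then obtain s' where s': "s' \<in> A" "s' +\<^sub>M r *\<^sub>M v \<in> N" using eq by (auto simp: I_def)
        let ?n = "s' +\<^sub>M r *\<^sub>M v"
        have nk: "?n \<in> K" using s' KN(3) by blast
        have "k -\<^sub>M ?n = s -\<^sub>M s'"
        proof -
          have "k = (s -\<^sub>M s') +\<^sub>M ?n"
            using sr s' Ac v by (simp add: a_minus_def M.a_assoc M.r_neg1)
          then show ?thesis using madd_minus_cancel(2)[of "s -\<^sub>M s'" ?n] sr s' Ac v by simp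
        qed
        moreover have "k -\<^sub>M ?n \<in> K" using subD(4)[OF KN(2) k nk] .
        moreover have "s -\<^sub>M s' \<in> A" using subD(4)[OF A sr(1) s'(1)] .
        ultimately have "k -\<^sub>M ?n \<in> N" using eq by auto
        then have "(k -\<^sub>M ?n) +\<^sub>M ?n \<in> N" using subD(3)[OF KN(1)] s'(2) by blast
        then show "k \<in> N" using sub_carr[OF KN(2) k] sub_carr[OF KN(2) nk] by (simp add: madd_minus_cancel)
      qed
      then show False using KN(3) by blast
    qed
    ultimately show "(K, N) \<in> inv_image ?lex (\<lambda>K. (I K, K \<inter> A))"
      using ideal_I KN sub_Int[OF _ A] by auto
  qed
  ultimately show ?thesis by (rule wf_subset)
qed

lemma wf_subs_span:
  assumes "finite S" "S \<subseteq> carrier M" and wfI: "wf {(J, I). ideal I R \<and> ideal J R \<and> I \<subset> J}"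
  shows "wf {(K, N). sub N \<and> sub K \<and> N \<subset> K \<and> K \<subseteq> span_module R M S}"
  using assms(1,2)
proof (induction S rule: finite_induct)
  case empty
  have "span_module R M {} \<subseteq> {0\<^sub>M}" by (intro span_module_le sub_zero) simp
  then have eq: "{(K, N). sub N \<and> sub K \<and> N \<subset> K \<and> K \<subseteq> span_module R M {}} = {}"
    using subD(2) by auto
  show ?case unfolding eq by simp
next
  case (insert v S)
  have S: "sub (span_module R M S)" "v \<in> carrier M" using insert.prems span_module_sub by auto
  have "sub (span_module R M S +\<^sub>S cyclic v)" using S sub_cyclic sub_ssum by blast
  then have le: "span_module R M (insert v S) \<subseteq> span_module R M S +\<^sub>S cyclic v"
    using ssum_ge[OF S(1) sub_cyclic[OF S(2)]] span_module_ge[of S] cyclic_self[OF S(2)] by (intro span_module_le) auto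
  have "wf {(K, N). sub N \<and> sub K \<and> N \<subset> K \<and> K \<subseteq> span_module R M S +\<^sub>S cyclic v}"
    using insert by (intro wf_subs_extend S wfI) auto
  then show ?case by (rule wf_subset) (use le in auto)
qed

end

lemma noeth_moduleI:
  assumes "noeth_cring R" "fg_module R M"
  shows "noeth_module R M"
proof -
  have m: "module R M" using assms(2) by (simp add: fg_module_def)
  interpret module R M by fact
  obtain S where S: "S \<subseteq> carrier M" "finite S" "span_module R M S = carrier M"
    using assms(2) by (auto simp: fg_module_def)
  have "wf {(K, N). sub N \<and> sub K \<and> N \<subset> K \<and> K \<subseteq> span_module R M S}"
    using noeth_cring.wf_ideals[OF assms(1)] S by (intro wf_subs_span) auto
  then have "wf {(K, N). sub N \<and> sub K \<and> N \<subset> K}"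
    by (rule wf_subset) (use S(3) subD(1) in auto)
  then show ?thesis using assms(1) m by (simp add: noeth_module_def noeth_module_axioms_def)
qed

text \<open>Needed because \<open>cohen_macaulay\<close> includes finite generation, which for the
  graded quotients is read off from the ascending chain condition.\<close>

lemma (in noeth_module) finitely_generated: "fg_module R M"
proof -
  have ex: "\<exists>S. finite S \<and> S \<subseteq> carrier M \<and> span_module R M {} = span_module R M S"
    by (intro exI[of _ "{}"]) auto
  obtain N where N: "\<exists>S. finite S \<and> S \<subseteq> carrier M \<and> N = span_module R M S"
    and max: "\<And>K. \<exists>S. finite S \<and> S \<subseteq> carrier M \<and> K = span_module R M S \<Longrightarrow> N \<subseteq> K \<Longrightarrow> K = N"
    by (rule max_sub[of "\<lambda>N. \<exists>S. finite S \<and> S \<subseteq> carrier M \<and> N = span_module R M S"])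
      (use ex span_module_sub in auto)
  from N obtain S where S: "finite S" "S \<subseteq> carrier M" "N = span_module R M S" by blast
  have "carrier M \<subseteq> N"
  proof
    fix x assume x: "x \<in> carrier M"
    have "N \<subseteq> span_module R M (insert x S)"
      unfolding S(3) using S x span_module_ge[of "insert x S"] by (intro span_module_le span_module_sub) auto
    then have "span_module R M (insert x S) = N" using S x by (intro max exI[of _ "insert x S"]) auto
    then show "x \<in> N" using span_module_ge[of "insert x S"] by auto
  qed
  then have "span_module R M S = carrier M" using S subD(1)[OF span_module_sub[OF S(2)]] by auto
  then show ?thesis unfolding fg_module_def using S module_axioms by blast
qed

text \<open>A largest ideal above p without 1 exists by the Noetherian property and is maximal, so
  it is \<mm>.\<close>

lemma noeth_localI:
  fixes R (structure)
  assumes "noetherian_local_ring R \<mm>"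
  shows "noeth_local R \<mm>"
proof -
  interpret noetherian_local_ring R \<mm> by fact
  interpret N: noeth_cring R by (rule noeth_cringI) unfold_locales
  show ?thesis
  proof (intro noeth_local.intro noeth_local_axioms.intro N.noeth_cring_axioms)
    show "primeideal \<mm> R" using maximalideal_prime[OF maximal] .
    fix p assume p: "primeideal p R"
    have "ideal p R \<and> p \<subseteq> p \<and> \<one> \<notin> p" using p primeE(1) primeideal.axioms(1) by blast
    then obtain J where J: "ideal J R \<and> p \<subseteq> J \<and> \<one> \<notin> J"
      and max: "\<And>K. ideal K R \<and> p \<subseteq> K \<and> \<one> \<notin> K \<Longrightarrow> J \<subseteq> K \<Longrightarrow> K = J"
      by (rule N.max_ideal[of "\<lambda>J. ideal J R \<and> p \<subseteq> J \<and> \<one> \<notin> J"]) auto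
    have "maximalideal J R"
    proof (rule maximalidealI)
      show "ideal J R" "carrier R \<noteq> J" using J by auto
      fix K assume K: "ideal K R" "J \<subseteq> K" "K \<subseteq> carrier R"
      show "K = J \<or> K = carrier R"
        using max[of K] K J ideal.one_imp_carrier[OF K(1)] by blast
    qed
    then have "J = \<mm>" by (rule unique_maximal)
    then show "p \<subseteq> \<mm>" using J by simp
  qed
qed

section \<open>Restrictions and quotients\<close>

context module
begin

lemma sub_is_module: "sub N \<Longrightarrow> module R (M\<lparr>carrier := N\<rparr>)"
  using submodule.submodule_is_module module_axioms by blast

lemma sub_restrict_iff:
  assumes N: "sub N"
  shows "submodule K R (M\<lparr>carrier := N\<rparr>) \<longleftrightarrow> sub K \<and> K \<subseteq> N"
proof -
  interpret N: module R "M\<lparr>carrier := N\<rparr>" by (rule sub_is_module[OF N])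
  show ?thesis
  proof
    assume K: "submodule K R (M\<lparr>carrier := N\<rparr>)"
    then have KN: "K \<subseteq> N" using N.subD(1) by auto
    moreover have "sub K"
      using N.subD(2,3,5)[OF K] KN subD(1)[OF N] by (intro subI) auto
    ultimately show "sub K \<and> K \<subseteq> N" by blast
  next
    assume K: "sub K \<and> K \<subseteq> N"
    then have K': "sub K" by simp
    show "submodule K R (M\<lparr>carrier := N\<rparr>)"
      by (rule N.subI) (use K subD[OF K'] in auto)
  qed
qed

lemma seq_smult_restrict:
  assumes "sub N"
  shows "module.seq_smult (M\<lparr>carrier := N\<rparr>) xs K = seq_smult xs K"
proof -
  interpret N: module R "M\<lparr>carrier := N\<rparr>" by (rule sub_is_module[OF assms])
  show ?thesis by (induction xs) (simp_all add: scale_def N.scale_def set_add_def set_mult_def)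
qed

lemma colon_restrict: "colon R (M\<lparr>carrier := N\<rparr>) L K = colon R M L K"
  by (simp add: colon_def)

lemma annihilator_eq_qann: "annihilator R M = colon R M {0\<^sub>M} (carrier M)"
  by (simp add: annihilator_def colon_def)

lemma annihilator_restrict: "annihilator R (M\<lparr>carrier := N\<rparr>) = colon R M {0\<^sub>M} N"
  by (simp add: annihilator_def colon_def)

lemma ideal_smult_mem:
  assumes "I \<subseteq> carrier R" "a \<in> I" "x \<in> carrier M"
  shows "a *\<^sub>M x \<in> ideal_smult R I M"
  unfolding ideal_smult_def by (rule subsetD[OF span_module_ge]) (use assms in blast)

lemma sub_ideal_smult:
  assumes "I \<subseteq> carrier R"
  shows "sub (ideal_smult R I M)"
  unfolding ideal_smult_def using assms by (intro span_module_sub) auto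

lemma ideal_smult_le_iff:
  assumes "I \<subseteq> carrier R" "sub T"
  shows "ideal_smult R I M \<subseteq> T \<longleftrightarrow> (\<forall>a\<in>I. \<forall>x\<in>carrier M. a *\<^sub>M x \<in> T)"
proof
  show "\<forall>a\<in>I. \<forall>x\<in>carrier M. a *\<^sub>M x \<in> T" if "ideal_smult R I M \<subseteq> T"
    using ideal_smult_mem[OF assms(1)] that by blast
  show "ideal_smult R I M \<subseteq> T" if "\<forall>a\<in>I. \<forall>x\<in>carrier M. a *\<^sub>M x \<in> T"
    unfolding ideal_smult_def using that by (intro span_module_le[OF assms(2)]) auto
qed

lemma ideal_smult_Idl:
  assumes xs: "set xs \<subseteq> carrier R"
  shows "ideal_smult R (Idl (set xs)) M = seq_smult xs (carrier M)"
proof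
  have I: "Idl (set xs) \<subseteq> carrier R" using R.genideal_ideal[OF xs] R.ideal_closed(1) by blast
  show "ideal_smult R (Idl (set xs)) M \<subseteq> seq_smult xs (carrier M)"
    unfolding ideal_smult_le_iff[OF I sub_seq_smult[OF xs carrier_is_submodule]]
    using Idl_smult_mem[OF xs carrier_is_submodule] by blast
  show "seq_smult xs (carrier M) \<subseteq> ideal_smult R (Idl (set xs)) M"
    unfolding seq_smult_le_iff[OF xs carrier_is_submodule sub_ideal_smult[OF I]]
    using ideal_smult_mem[OF I] R.genideal_self[OF xs] by blast
qed

text \<open>Links powers in the monoid \<open>ideals_set R\<close>, whose unit is the whole ring,
  with the iterated products used so far. That each power is an ideal is carried along because the
  product is handled only for ideals.\<close>

lemma ideal_smult_power:
  assumes xs: "set xs \<subseteq> carrier R"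
  shows "ideal (Idl (set xs) [^]\<^bsub>ideals_set R\<^esub> (k::nat)) R \<and>
    ideal_smult R (Idl (set xs) [^]\<^bsub>ideals_set R\<^esub> k) M = seq_power xs k (carrier M)"
proof (induction k)
  let ?q = "Idl (set xs)"
  case 0
  have one: "?q [^]\<^bsub>ideals_set R\<^esub> (0::nat) = carrier R" by (simp add: ideals_set_def)
  have "carrier M \<subseteq> ideal_smult R (carrier R) M"
  proof
    fix x assume "x \<in> carrier M"
    then show "x \<in> ideal_smult R (carrier R) M" using ideal_smult_mem[of "carrier R" \<one> x] by simp
  qed
  then show ?case unfolding one using R.oneideal subD(1)[OF sub_ideal_smult[of "carrier R"]] by auto
next
  let ?q = "Idl (set xs)"
  case (Suc k)
  let ?J = "?q [^]\<^bsub>ideals_set R\<^esub> k"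
  have J: "ideal ?J R" "ideal_smult R ?J M = seq_power xs k (carrier M)" using Suc by auto
  have q: "ideal ?q R" using R.genideal_ideal[OF xs] .
  have s: "?q [^]\<^bsub>ideals_set R\<^esub> Suc k = ?J \<cdot>\<^bsub>R\<^esub> ?q" by (simp add: ideals_set_def)
  have Jq: "ideal (?J \<cdot>\<^bsub>R\<^esub> ?q) R" using R.ideal_prod_is_ideal[OF J(1) q] .
  note c = R.ideal_closed(1)[OF J(1)] R.ideal_closed(1)[OF q] R.ideal_closed(1)[OF Jq]
  let ?N = "seq_power xs k (carrier M)"
  have N: "sub ?N" using sub_seq_power[OF xs carrier_is_submodule] .
  have "ideal_smult R (?J \<cdot>\<^bsub>R\<^esub> ?q) M = seq_smult xs ?N"
  proof
    show "ideal_smult R (?J \<cdot>\<^bsub>R\<^esub> ?q) M \<subseteq> seq_smult xs ?N"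
      unfolding ideal_smult_le_iff[OF c(3) sub_seq_smult[OF xs N]]
    proof (intro ballI)
      fix a x assume "a \<in> ?J \<cdot>\<^bsub>R\<^esub> ?q" and x: "x \<in> carrier M"
      then show "a *\<^sub>M x \<in> seq_smult xs ?N"
      proof (induction a rule: ideal_prod.induct)
        case (prod i j)
        have "i *\<^sub>M x \<in> ?N" using ideal_smult_mem[OF c(1) prod(1) x] J(2) by simp
        then have "j *\<^sub>M i *\<^sub>M x \<in> seq_smult xs ?N" using Idl_smult_mem[OF xs N prod(2)] by blast
        moreover have "(i \<otimes> j) *\<^sub>M x = j *\<^sub>M i *\<^sub>M x"
          using prod c x by (simp add: smult_assoc1 smult_commute subset_iff)
        ultimately show ?case by simp
      next
        case (sum s1 s2)
        then have "s1 \<in> carrier R" "s2 \<in> carrier R" using c(3) by blast+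
        then show ?case using sum subD(3)[OF sub_seq_smult[OF xs N]] x by (simp add: smult_l_distr)
      qed
    qed
    show "seq_smult xs ?N \<subseteq> ideal_smult R (?J \<cdot>\<^bsub>R\<^esub> ?q) M"
      unfolding seq_smult_le_iff[OF xs N sub_ideal_smult[OF c(3)]]
    proof (intro ballI)
      fix x n assume x: "x \<in> set xs" and n: "n \<in> ?N"
      have xc: "x \<in> carrier R" using x xs by blast
      \<comment> \<open>The preimage under multiplication by x is a submodule, so it suffices to
        test the generators ay of JM.\<close>
      have "ideal_smult R ?J M \<subseteq> {n \<in> carrier M. x *\<^sub>M n \<in> ideal_smult R (?J \<cdot>\<^bsub>R\<^esub> ?q) M}"
        unfolding ideal_smult_le_iff[OF c(1) sub_pre[OF carrier_is_submodule sub_ideal_smult[OF c(3)] xc]]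
      proof (intro ballI)
        fix a y assume a: "a \<in> ?J" "y \<in> carrier M"
        have ac: "a \<in> carrier R" using a c by blast
        have "a \<otimes> x \<in> ?J \<cdot>\<^bsub>R\<^esub> ?q" using a x R.genideal_self[OF xs] by (intro ideal_prod.prod) auto
        then have "(a \<otimes> x) *\<^sub>M y \<in> ideal_smult R (?J \<cdot>\<^bsub>R\<^esub> ?q) M" using ideal_smult_mem[OF c(3)] a by blast
        moreover have "(a \<otimes> x) *\<^sub>M y = x *\<^sub>M a *\<^sub>M y" using ac xc a by (simp add: smult_assoc1 smult_commute)
        ultimately show "a *\<^sub>M y \<in> {n \<in> carrier M. x *\<^sub>M n \<in> ideal_smult R (?J \<cdot>\<^bsub>R\<^esub> ?q) M}" using a ac by simp
      qed
      then show "x *\<^sub>M n \<in> ideal_smult R (?J \<cdot>\<^bsub>R\<^esub> ?q) M" using n J(2) by blast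
    qed
  qed
  then show ?case unfolding s using Jq by simp
qed

section \<open>Submodules of quotients and their preimages\<close>

lemma coset_self: "sub L \<Longrightarrow> x \<in> carrier M \<Longrightarrow> x \<in> L +>\<^bsub>M\<^esub> x"
  unfolding a_r_coset_def' using subD(2)[of L] by (auto intro!: bexI[of _ "0\<^sub>M"])

lemma coset_eq_iff:
  assumes L: "sub L" and x: "x \<in> carrier M" "y \<in> carrier M"
  shows "L +>\<^bsub>M\<^esub> x = L +>\<^bsub>M\<^esub> y \<longleftrightarrow> x -\<^sub>M y \<in> L"
proof
  assume "L +>\<^bsub>M\<^esub> x = L +>\<^bsub>M\<^esub> y"
  then have "x \<in> L +>\<^bsub>M\<^esub> y" using coset_self[OF L x(1)] by simp
  then obtain l where l: "l \<in> L" "x = l +\<^sub>M y" by (auto simp: a_r_coset_def')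
  then show "x -\<^sub>M y \<in> L" using x sub_carr[OF L] by (simp add: madd_minus_cancel)
next
  assume l: "x -\<^sub>M y \<in> L"
  have "L +>\<^bsub>M\<^esub> x \<subseteq> L +>\<^bsub>M\<^esub> y"
  proof
    fix z assume "z \<in> L +>\<^bsub>M\<^esub> x"
    then obtain k where k: "k \<in> L" "z = k +\<^sub>M x" by (auto simp: a_r_coset_def')
    have "k +\<^sub>M x = (k +\<^sub>M (x -\<^sub>M y)) +\<^sub>M y"
      using k x sub_carr[OF L] by (simp add: M.a_assoc madd_minus_cancel)
    then show "z \<in> L +>\<^bsub>M\<^esub> y" using k subD(3)[OF L k(1) l] by (auto simp: a_r_coset_def')
  qed
  moreover have "L +>\<^bsub>M\<^esub> y \<subseteq> L +>\<^bsub>M\<^esub> x"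
  proof
    fix z assume "z \<in> L +>\<^bsub>M\<^esub> y"
    then obtain k where k: "k \<in> L" "z = k +\<^sub>M y" by (auto simp: a_r_coset_def')
    have "(k -\<^sub>M u) +\<^sub>M (u +\<^sub>M y) = k +\<^sub>M y" if "u \<in> carrier M" for u
      using that k x sub_carr[OF L] by (simp add: a_minus_def M.a_assoc M.r_neg1)
    from this[of "x -\<^sub>M y"] have "(k -\<^sub>M (x -\<^sub>M y)) +\<^sub>M x = k +\<^sub>M y"
      using x by (simp add: madd_minus_cancel)
    then show "z \<in> L +>\<^bsub>M\<^esub> x" using k subD(4)[OF L k(1) l] by (force simp: a_r_coset_def')
  qed
  ultimately show "L +>\<^bsub>M\<^esub> x = L +>\<^bsub>M\<^esub> y" by blast
qed

lemma coset_zero: "sub L \<Longrightarrow> L +>\<^bsub>M\<^esub> 0\<^sub>M = L"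
  using subD(1)[of L] by (auto simp: a_r_coset_def' subset_iff)

lemma coset_eq_self_iff:
  assumes L: "sub L" and x: "x \<in> carrier M"
  shows "L +>\<^bsub>M\<^esub> x = L \<longleftrightarrow> x \<in> L"
  using coset_eq_iff[OF L x, of "0\<^sub>M"] coset_zero[OF L] x madd_minus_cancel(2)[of x "0\<^sub>M"] by simp

lemma quotient_simps:
  assumes L: "sub L"
  shows "carrier (quotient_module M L) = (\<lambda>x. L +>\<^bsub>M\<^esub> x) ` carrier M"
    "zero (quotient_module M L) = L"
    "\<And>x y. x \<in> carrier M \<Longrightarrow> y \<in> carrier M \<Longrightarrow>
      (L +>\<^bsub>M\<^esub> x) \<oplus>\<^bsub>quotient_module M L\<^esub> (L +>\<^bsub>M\<^esub> y) = L +>\<^bsub>M\<^esub> (x +\<^sub>M y)"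
    "\<And>a x. a \<in> carrier R \<Longrightarrow> x \<in> carrier M \<Longrightarrow>
      a \<odot>\<^bsub>quotient_module M L\<^esub> (L +>\<^bsub>M\<^esub> x) = L +>\<^bsub>M\<^esub> (a *\<^sub>M x)"
proof -
  have "abelian_subgroup L M"
    by (rule abelian_subgroupI3) (use L M.abelian_group_axioms in \<open>auto simp: additive_subgroup_def submodule_def\<close>)
  then interpret A: abelian_subgroup L M .
  show "carrier (quotient_module M L) = (\<lambda>x. L +>\<^bsub>M\<^esub> x) ` carrier M"
    by (auto simp: quotient_module_def A_RCOSETS_def RCOSETS_def a_r_coset_def)
  show "zero (quotient_module M L) = L" by (simp add: quotient_module_def)
  show "(L +>\<^bsub>M\<^esub> x) \<oplus>\<^bsub>quotient_module M L\<^esub> (L +>\<^bsub>M\<^esub> y) = L +>\<^bsub>M\<^esub> (x +\<^sub>M y)"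
    if "x \<in> carrier M" "y \<in> carrier M" for x y
    using that A.a_rcos_sum by (simp add: quotient_module_def)
  show "a \<odot>\<^bsub>quotient_module M L\<^esub> (L +>\<^bsub>M\<^esub> x) = L +>\<^bsub>M\<^esub> (a *\<^sub>M x)"
    if "a \<in> carrier R" "x \<in> carrier M" for a x
    using quotient_module_smult[OF module_axioms L that] .
qed

lemma quotient_is_module: "sub L \<Longrightarrow> module R (quotient_module M L)"
  using quotient_module_is_module module_axioms by blast

lemma quotient_mem_image:
  assumes L: "sub L" and K: "sub K" "L \<subseteq> K" and x: "x \<in> carrier M"
  shows "L +>\<^bsub>M\<^esub> x \<in> (\<lambda>x. L +>\<^bsub>M\<^esub> x) ` K \<longleftrightarrow> x \<in> K"
proof
  assume "L +>\<^bsub>M\<^esub> x \<in> (\<lambda>x. L +>\<^bsub>M\<^esub> x) ` K"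
  then obtain k where k: "k \<in> K" "L +>\<^bsub>M\<^esub> x = L +>\<^bsub>M\<^esub> k" by blast
  have kc: "k \<in> carrier M" using k K sub_carr by blast
  have "x -\<^sub>M k \<in> K" using k(2) coset_eq_iff[OF L x kc] K by blast
  then have "(x -\<^sub>M k) +\<^sub>M k \<in> K" using subD(3)[OF K(1)] k by blast
  then show "x \<in> K" using x kc by (simp add: madd_minus_cancel)
qed blast

lemma quotient_image_sub:
  assumes L: "sub L" and K: "sub K"
  shows "submodule ((\<lambda>x. L +>\<^bsub>M\<^esub> x) ` K) R (quotient_module M L)"
proof -
  interpret Q: module R "quotient_module M L" using quotient_is_module[OF L] .
  note qs = quotient_simps[OF L]
  have Kc: "x \<in> carrier M" if "x \<in> K" for x using that K sub_carr by blast
  show ?thesis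
  proof (rule Q.subI)
    show "(\<lambda>x. L +>\<^bsub>M\<^esub> x) ` K \<subseteq> carrier (quotient_module M L)" using qs(1) Kc by auto
    show "\<zero>\<^bsub>quotient_module M L\<^esub> \<in> (\<lambda>x. L +>\<^bsub>M\<^esub> x) ` K"
      using qs(2) coset_zero[OF L] subD(2)[OF K] by (metis imageI)
    show "u \<oplus>\<^bsub>quotient_module M L\<^esub> v \<in> (\<lambda>x. L +>\<^bsub>M\<^esub> x) ` K"
      if "u \<in> (\<lambda>x. L +>\<^bsub>M\<^esub> x) ` K" "v \<in> (\<lambda>x. L +>\<^bsub>M\<^esub> x) ` K" for u v
      using that qs(3) Kc subD(3)[OF K] by auto
    show "a \<odot>\<^bsub>quotient_module M L\<^esub> u \<in> (\<lambda>x. L +>\<^bsub>M\<^esub> x) ` K"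
      if "a \<in> carrier R" "u \<in> (\<lambda>x. L +>\<^bsub>M\<^esub> x) ` K" for a u
      using that qs(4) Kc subD(5)[OF K] by auto
  qed
qed

lemma quotient_preimage:
  assumes L: "sub L" and K: "submodule K R (quotient_module M L)"
  defines "K' \<equiv> {x \<in> carrier M. L +>\<^bsub>M\<^esub> x \<in> K}"
  shows "sub K'" "L \<subseteq> K'" "(\<lambda>x. L +>\<^bsub>M\<^esub> x) ` K' = K"
proof -
  interpret Q: module R "quotient_module M L" using quotient_is_module[OF L] .
  note qs = quotient_simps[OF L] and k = Q.subD[OF K]
  have LK: "L \<in> K" using k(2) qs(2) by simp
  show "sub K'"
  proof (rule subI)
    show "0\<^sub>M \<in> K'" using LK coset_zero[OF L] by (simp add: K'_def)
    show "x +\<^sub>M y \<in> K'" if "x \<in> K'" "y \<in> K'" for x y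
      using that k(3)[of "L +>\<^bsub>M\<^esub> x" "L +>\<^bsub>M\<^esub> y"] qs(3) by (simp add: K'_def)
    show "a *\<^sub>M x \<in> K'" if "a \<in> carrier R" "x \<in> K'" for a x
      using that k(5)[of a "L +>\<^bsub>M\<^esub> x"] qs(4) by (simp add: K'_def)
  qed (auto simp: K'_def)
  show "L \<subseteq> K'"
  proof
    fix x assume x: "x \<in> L"
    have xc: "x \<in> carrier M" using x sub_carr[OF L] by blast
    then have "L +>\<^bsub>M\<^esub> x = L" using coset_eq_self_iff[OF L] x by blast
    then show "x \<in> K'" using LK xc by (simp add: K'_def)
  qed
  show "(\<lambda>x. L +>\<^bsub>M\<^esub> x) ` K' = K" using k(1) qs(1) by (auto simp: K'_def)
qed

lemma seq_smult_quotient: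
  assumes L: "sub L" and xs: "set xs \<subseteq> carrier R"
  shows "module.seq_smult (quotient_module M L) xs (carrier (quotient_module M L)) =
    (\<lambda>x. L +>\<^bsub>M\<^esub> x) ` (L +\<^sub>S seq_smult xs (carrier M))"
proof -
  interpret Q: module R "quotient_module M L" using quotient_is_module[OF L] .
  note qs = quotient_simps[OF L]
  have J: "sub (seq_smult xs (carrier M))" using sub_seq_smult[OF xs carrier_is_submodule] .
  have K: "sub (L +\<^sub>S seq_smult xs (carrier M))" using sub_ssum[OF L J] .
  have QJ: "Q.sub (Q.seq_smult xs (carrier (quotient_module M L)))" using Q.sub_seq_smult[OF xs Q.carrier_is_submodule] .
  show ?thesis
  proof
    show "Q.seq_smult xs (carrier (quotient_module M L)) \<subseteq> (\<lambda>x. L +>\<^bsub>M\<^esub> x) ` (L +\<^sub>S seq_smult xs (carrier M))"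
      unfolding Q.seq_smult_le_iff[OF xs Q.carrier_is_submodule quotient_image_sub[OF L K]]
    proof (intro ballI)
      fix x n assume x: "x \<in> set xs" and "n \<in> carrier (quotient_module M L)"
      then obtain m where m: "m \<in> carrier M" "n = L +>\<^bsub>M\<^esub> m" using qs(1) by auto
      have "x *\<^sub>M m \<in> L +\<^sub>S seq_smult xs (carrier M)"
        using seq_smult_mem[OF xs carrier_is_submodule x m(1)] ssum_ge(2)[OF L J] by blast
      then show "x \<odot>\<^bsub>quotient_module M L\<^esub> n \<in> (\<lambda>x. L +>\<^bsub>M\<^esub> x) ` (L +\<^sub>S seq_smult xs (carrier M))"
        using qs(4) m x xs by auto
    qed
    let ?P = "{x \<in> carrier M. L +>\<^bsub>M\<^esub> x \<in> Q.seq_smult xs (carrier (quotient_module M L))}"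
    note pre = quotient_preimage[OF L QJ]
    have "seq_smult xs (carrier M) \<subseteq> ?P"
      unfolding seq_smult_le_iff[OF xs carrier_is_submodule pre(1)]
    proof (intro ballI)
      fix x n assume x: "x \<in> set xs" and n: "n \<in> carrier M"
      have "x \<odot>\<^bsub>quotient_module M L\<^esub> (L +>\<^bsub>M\<^esub> n) \<in> Q.seq_smult xs (carrier (quotient_module M L))"
        using Q.seq_smult_mem[OF xs Q.carrier_is_submodule x] qs(1) n by blast
      then show "x *\<^sub>M n \<in> ?P" using qs(4)[of x n] x xs n by auto
    qed
    then have "L +\<^sub>S seq_smult xs (carrier M) \<subseteq> ?P" using ssum_le[OF pre(1,2)] by blast
    then show "(\<lambda>x. L +>\<^bsub>M\<^esub> x) ` (L +\<^sub>S seq_smult xs (carrier M)) \<subseteq> Q.seq_smult xs (carrier (quotient_module M L))" by blast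
  qed
qed

lemma annihilator_quotient:
  assumes L: "sub L"
  shows "annihilator R (quotient_module M L) = colon R M L (carrier M)"
proof -
  have "a \<odot>\<^bsub>quotient_module M L\<^esub> (L +>\<^bsub>M\<^esub> x) = L \<longleftrightarrow> a *\<^sub>M x \<in> L"
    if "a \<in> carrier R" "x \<in> carrier M" for a x
    using quotient_simps(4)[OF L that] coset_eq_self_iff[OF L] that by simp
  then show ?thesis unfolding annihilator_def colon_def quotient_simps(1,2)[OF L] by auto
qed

end

section \<open>Lengths of restrictions and quotients, read in the ambient module\<close>

context local_module
begin

lemma module_length_eq: "module_length R M = sat_len R M \<mm> {0\<^sub>M} (carrier M)"
proof -
  have "(submodule N R M \<and> saturated R M \<mm> N \<and> {0\<^sub>M} \<subseteq> N \<and> N \<subseteq> carrier M) = submodule N R M" for N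
    using saturated_max[of N] subD(1,2)[of N] by auto
  then show ?thesis by (simp add: module_length_def sat_len_def)
qed

lemma len_quotient:
  assumes L: "sub L" and K: "sub K" "L \<subseteq> K"
  shows "sat_len R (quotient_module M L) \<mm> ((\<lambda>x. L +>\<^bsub>M\<^esub> x) ` K) (carrier (quotient_module M L)) = sat_len R M \<mm> K (carrier M)"
proof (rule antisym)
  let ?Q = "quotient_module M L" and ?\<pi> = "\<lambda>x. L +>\<^bsub>M\<^esub> x"
  interpret Q: local_module R ?Q \<mm>
    using quotient_is_module[OF L] noeth_local_axioms by (rule local_module.intro)
  show "sat_len R ?Q \<mm> (?\<pi> ` K) (carrier ?Q) \<le> sat_len R M \<mm> K (carrier M)"
  proof (rule len_map[where f = "\<lambda>A. {x \<in> carrier M. ?\<pi> x \<in> A}"])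
    fix A assume A: "Q.sub A" "?\<pi> ` K \<subseteq> A"
    then show "sub {x \<in> carrier M. ?\<pi> x \<in> A} \<and> saturated R M \<mm> {x \<in> carrier M. ?\<pi> x \<in> A} \<and>
        K \<subseteq> {x \<in> carrier M. ?\<pi> x \<in> A} \<and> {x \<in> carrier M. ?\<pi> x \<in> A} \<subseteq> carrier M"
      using quotient_preimage(1)[OF L A(1)] saturated_max sub_carr[OF K(1)] by auto
  next
    fix A B assume AB: "Q.sub A" "Q.sub B" "A \<subset> B"
    have "?\<pi> ` {x \<in> carrier M. ?\<pi> x \<in> A} \<noteq> ?\<pi> ` {x \<in> carrier M. ?\<pi> x \<in> B}"
      using quotient_preimage(3)[OF L AB(1)] quotient_preimage(3)[OF L AB(2)] AB(3) by simp
    then show "{x \<in> carrier M. ?\<pi> x \<in> A} \<subset> {x \<in> carrier M. ?\<pi> x \<in> B}" using AB(3) by blast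
  qed
  show "sat_len R M \<mm> K (carrier M) \<le> sat_len R ?Q \<mm> (?\<pi> ` K) (carrier ?Q)"
  proof (rule len_map[where f = "\<lambda>A. ?\<pi> ` A"])
    fix A assume A: "sub A" "K \<subseteq> A" "A \<subseteq> carrier M"
    then show "Q.sub (?\<pi> ` A) \<and> saturated R ?Q \<mm> (?\<pi> ` A) \<and> ?\<pi> ` K \<subseteq> ?\<pi> ` A \<and> ?\<pi> ` A \<subseteq> carrier ?Q"
      using quotient_image_sub[OF L A(1)] Q.saturated_max[of "?\<pi> ` A"] Q.subD(1)[of "?\<pi> ` A"] by auto
  next
    fix A B assume AB: "sub A" "K \<subseteq> A" "sub B" "A \<subset> B"
    then obtain b where b: "b \<in> B" "b \<notin> A" by blast
    then have "?\<pi> b \<notin> ?\<pi> ` A" using quotient_mem_image[OF L AB(1) _ sub_carr[OF AB(3) b(1)]] K(2) AB(2) by blast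
    then show "?\<pi> ` A \<subset> ?\<pi> ` B" using AB(4) b by blast
  qed
qed

lemma module_length_quotient:
  assumes L: "sub L"
  shows "module_length R (quotient_module M L) = sat_len R M \<mm> L (carrier M)"
proof -
  interpret Q: local_module R "quotient_module M L" \<mm>
    using quotient_is_module[OF L] noeth_local_axioms by (rule local_module.intro)
  have "(\<lambda>x. L +>\<^bsub>M\<^esub> x) ` L = {\<zero>\<^bsub>quotient_module M L\<^esub>}"
    using coset_eq_self_iff[OF L] sub_carr[OF L] subD(2)[OF L] quotient_simps(2)[OF L] by auto
  then show ?thesis using Q.module_length_eq len_quotient[OF L L order_refl] by simp
qed

lemma len_restrict:
  assumes N: "sub N" and B: "B \<subseteq> N"
  shows "sat_len R (M\<lparr>carrier := N\<rparr>) \<mm> A B = sat_len R M \<mm> A B"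
proof -
  interpret N: local_module R "M\<lparr>carrier := N\<rparr>" \<mm>
    using sub_is_module[OF N] noeth_local_axioms by (rule local_module.intro)
  show ?thesis
  proof (rule antisym)
    show "sat_len R (M\<lparr>carrier := N\<rparr>) \<mm> A B \<le> sat_len R M \<mm> A B"
      by (rule len_map[where f = "\<lambda>K. K"]) (use sub_restrict_iff[OF N] saturated_max in auto)
    show "sat_len R M \<mm> A B \<le> sat_len R (M\<lparr>carrier := N\<rparr>) \<mm> A B"
      by (rule len_map[where f = "\<lambda>K. K"]) (use sub_restrict_iff[OF N] N.saturated_max B in auto)
  qed
qed

end

lemma (in noeth_module) quotient_noeth:
  assumes L: "sub L"
  shows "noeth_module R (quotient_module M L)"
proof -
  let ?f = "\<lambda>K. {x \<in> carrier M. L +>\<^bsub>M\<^esub> x \<in> K}"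
  have "wf (inv_image {(K, N). sub N \<and> sub K \<and> N \<subset> K} ?f)" using wf_subs by (rule wf_inv_image)
  then have "wf {(K, N). submodule N R (quotient_module M L) \<and> submodule K R (quotient_module M L) \<and> N \<subset> K}"
  proof (rule wf_subset, intro subrelI)
    fix K N assume "(K, N) \<in> {(K, N). submodule N R (quotient_module M L) \<and> submodule K R (quotient_module M L) \<and> N \<subset> K}"
    then have KN: "submodule N R (quotient_module M L)" "submodule K R (quotient_module M L)" "N \<subset> K" by auto
    have "(\<lambda>x. L +>\<^bsub>M\<^esub> x) ` ?f N \<noteq> (\<lambda>x. L +>\<^bsub>M\<^esub> x) ` ?f K"
      using quotient_preimage(3)[OF L KN(1)] quotient_preimage(3)[OF L KN(2)] KN(3) by simp
    then have "?f N \<noteq> ?f K" by metis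
    moreover have "?f N \<subseteq> ?f K" using KN(3) by blast
    ultimately show "(K, N) \<in> inv_image {(K, N). sub N \<and> sub K \<and> N \<subset> K} ?f"
      using quotient_preimage(1)[OF L KN(1)] quotient_preimage(1)[OF L KN(2)] by auto
  qed
  then show ?thesis
    by (intro noeth_module.intro noeth_module_axioms.intro quotient_is_module[OF L] noeth_cring_axioms)
qed

lemma (in noeth_module) restrict_noeth:
  assumes N: "sub N"
  shows "noeth_module R (M\<lparr>carrier := N\<rparr>)"
proof (intro noeth_module.intro noeth_module_axioms.intro sub_is_module[OF N] noeth_cring_axioms)
  have "{(K, L). submodule L R (M\<lparr>carrier := N\<rparr>) \<and> submodule K R (M\<lparr>carrier := N\<rparr>) \<and> L \<subset> K}
      \<subseteq> {(K, L). sub L \<and> sub K \<and> L \<subset> K}"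
    by (simp only: sub_restrict_iff[OF N]) blast
  then show "wf {(K, L). submodule L R (M\<lparr>carrier := N\<rparr>) \<and> submodule K R (M\<lparr>carrier := N\<rparr>) \<and> L \<subset> K}"
    by (rule wf_subset[OF wf_subs])
qed

section \<open>Krull dimension\<close>

lemma up_chain_iff:
  "up_chain R n p \<longleftrightarrow> (\<exists>P. P 0 = p \<and> (\<forall>i\<le>n. primeideal (P i) R) \<and> (\<forall>i<n. P i \<subset> P (Suc i)))"
proof (induction n arbitrary: p)
  case 0
  then show ?case by (auto intro: exI[of _ "\<lambda>_. p"])
next
  case (Suc n)
  show ?case
  proof
    assume "up_chain R (Suc n) p"
    then obtain q P where q: "primeideal p R" "p \<subset> q" "P 0 = q" "\<forall>i\<le>n. primeideal (P i) R" "\<forall>i<n. P i \<subset> P (Suc i)"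
      using Suc by auto
    have "\<forall>i\<le>Suc n. primeideal (case_nat p P i) R" using q by (auto split: nat.split)
    moreover have "\<forall>i<Suc n. case_nat p P i \<subset> case_nat p P (Suc i)" using q by (auto split: nat.split)
    ultimately show "\<exists>P. P 0 = p \<and> (\<forall>i\<le>Suc n. primeideal (P i) R) \<and> (\<forall>i<Suc n. P i \<subset> P (Suc i))"
      by (intro exI[of _ "case_nat p P"]) simp
  next
    assume "\<exists>P. P 0 = p \<and> (\<forall>i\<le>Suc n. primeideal (P i) R) \<and> (\<forall>i<Suc n. P i \<subset> P (Suc i))"
    then obtain P where P: "P 0 = p" "\<forall>i\<le>Suc n. primeideal (P i) R" "\<forall>i<Suc n. P i \<subset> P (Suc i)" by blast
    have "up_chain R n (P (Suc 0))" unfolding Suc using P(2,3) by (intro exI[of _ "\<lambda>i. P (Suc i)"]) auto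
    moreover have "primeideal p R" "p \<subset> P (Suc 0)" using P by auto
    ultimately show "up_chain R (Suc n) p" by auto
  qed
qed

text \<open>For an ideal I this is dim (R/I), expressed through primes of R. As in
  \<open>krull_dim\<close>, the absence of chains gives 0.\<close>

definition cdim :: "('a, 'r) ring_scheme \<Rightarrow> 'a set \<Rightarrow> enat" where
  "cdim R I = Sup {enat n | n. \<exists>p. I \<subseteq> p \<and> up_chain R n p}"

context cring
begin

lemma ideal_coset_mem_iff:
  assumes I: "ideal I R" and p: "ideal p R" "I \<subseteq> p" and a: "a \<in> carrier R"
  shows "I +> a \<in> (+>) I ` p \<longleftrightarrow> a \<in> p"
proof
  interpret I: ideal I R by fact
  assume "I +> a \<in> (+>) I ` p"
  then obtain b where b: "b \<in> p" "I +> a = I +> b" by blast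
  have "\<zero> \<oplus> a \<in> I +> a" using I.zero_closed by (auto simp: a_r_coset_def')
  then have "a \<in> I +> b" using a b by simp
  then obtain i where "i \<in> I" "a = i \<oplus> b" by (auto simp: a_r_coset_def')
  then show "a \<in> p" using p b ideal_closed(3)[OF p(1)] by blast
qed blast

lemma primeideal_quotient_image:
  assumes I: "ideal I R" and p: "primeideal p R" "I \<subseteq> p"
  shows "primeideal ((+>) I ` p) (R Quot I)"
proof (rule primeidealI)
  have pI: "ideal p R" using p primeideal.axioms(1) by blast
  note mem = ideal_coset_mem_iff[OF I pI p(2)]
  interpret I: ideal I R by fact
  have car: "carrier (R Quot I) = (+>) I ` carrier R"
    by (auto simp: FactRing_def A_RCOSETS_def')
  show "ideal ((+>) I ` p) (R Quot I)" using ring_ideal_imp_quot_ideal[OF I pI] .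
  show "cring (R Quot I)" using I.quotient_is_cring is_cring by blast
  have "I +> \<one> \<in> carrier (R Quot I)" using car by blast
  moreover have "I +> \<one> \<notin> (+>) I ` p" using mem primeE(1)[OF p(1)] by blast
  ultimately show "carrier (R Quot I) \<noteq> (+>) I ` p" by blast
  fix A B assume "A \<in> carrier (R Quot I)" "B \<in> carrier (R Quot I)" and AB: "A \<otimes>\<^bsub>R Quot I\<^esub> B \<in> (+>) I ` p"
  then obtain a b where ab: "a \<in> carrier R" "b \<in> carrier R" "A = I +> a" "B = I +> b"
    unfolding car by (elim imageE)
  have "A \<otimes>\<^bsub>R Quot I\<^esub> B = I +> (a \<otimes> b)" using ab I.rcoset_mult_add by (simp add: FactRing_def)
  then have "a \<otimes> b \<in> p" using AB mem ab by simp
  then show "A \<in> (+>) I ` p \<or> B \<in> (+>) I ` p" using ab primeE(4)[OF p(1)] by blast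
qed

lemma krull_dim_quotient:
  assumes I: "ideal I R"
  shows "krull_dim (R Quot I) = cdim R I"
proof -
  interpret I: ideal I R by fact
  have car: "carrier (R Quot I) = (+>) I ` carrier R"
    by (auto simp: FactRing_def A_RCOSETS_def')
  have "(\<exists>P. (\<forall>i\<le>n. primeideal (P i) (R Quot I)) \<and> (\<forall>i<n. P i \<subset> P (Suc i))) \<longleftrightarrow>
      (\<exists>p. I \<subseteq> p \<and> up_chain R n p)" for n
  proof
    assume "\<exists>P. (\<forall>i\<le>n. primeideal (P i) (R Quot I)) \<and> (\<forall>i<n. P i \<subset> P (Suc i))"
    then obtain P where P: "\<And>i. i \<le> n \<Longrightarrow> primeideal (P i) (R Quot I)" "\<And>i. i < n \<Longrightarrow> P i \<subset> P (Suc i)" by blast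
    define Q where "Q i = {r \<in> carrier R. I +> r \<in> P i}" for i
    have "primeideal (Q i) R" if "i \<le> n" for i
      unfolding Q_def using ring_hom_ring.primeideal_vimage[OF I.rcos_ring_hom_ring is_cring P(1)[OF that]] .
    moreover have "Q i \<subset> Q (Suc i)" if i: "i < n" for i
    proof -
      obtain x where x: "x \<in> P (Suc i)" "x \<notin> P i" using P(2)[OF i] by blast
      have "P (Suc i) \<subseteq> carrier (R Quot I)"
        using P(1)[of "Suc i"] i by (simp add: primeideal_def ideal_def additive_subgroup.a_subset)
      then obtain r where "r \<in> carrier R" "x = I +> r" using x car by blast
      then show ?thesis using x P(2)[OF i] unfolding Q_def by blast
    qed
    ultimately have "up_chain R n (Q 0)" unfolding up_chain_iff by blast
    moreover have "I \<subseteq> Q 0"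
    proof
      fix i assume i: "i \<in> I"
      then have "I +> i = I" using I.a_rcos_const by blast
      moreover have "I \<in> P 0"
        using P(1)[of 0] additive_subgroup.zero_closed[of "P 0" "R Quot I"]
        by (simp add: primeideal_def ideal_def FactRing_def)
      ultimately show "i \<in> Q 0" using i I.Icarr by (simp add: Q_def)
    qed
    ultimately show "\<exists>p. I \<subseteq> p \<and> up_chain R n p" by blast
  next
    assume "\<exists>p. I \<subseteq> p \<and> up_chain R n p"
    then obtain P where P: "I \<subseteq> P 0" "\<And>i. i \<le> n \<Longrightarrow> primeideal (P i) R" "\<And>i. i < n \<Longrightarrow> P i \<subset> P (Suc i)"
      unfolding up_chain_iff by blast
    have IP: "I \<subseteq> P i" if "i \<le> n" for i
      using that by (induction i) (use P(1,3) in \<open>auto, meson Suc_le_eq psubsetD subsetD\<close>)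
    have "P i \<subset> P (Suc i) \<Longrightarrow> (+>) I ` P i \<subset> (+>) I ` P (Suc i)" if i: "i < n" for i
    proof -
      obtain x where x: "x \<in> P (Suc i)" "x \<notin> P i" using P(3)[OF i] by blast
      have "x \<in> carrier R" using x primeE(2)[OF P(2)[of "Suc i"]] i by auto
      then have "I +> x \<notin> (+>) I ` P i"
        using ideal_coset_mem_iff[OF I primeideal.axioms(1)[OF P(2)[of i]] IP[of i]] x(2) i by simp
      then show ?thesis using x(1) P(3)[OF i] by blast
    qed
    then show "\<exists>P. (\<forall>i\<le>n. primeideal (P i) (R Quot I)) \<and> (\<forall>i<n. P i \<subset> P (Suc i))"
      using primeideal_quotient_image[OF I P(2) IP] P(3) by (intro exI[of _ "\<lambda>i. (+>) I ` P i"]) auto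
  qed
  then show ?thesis unfolding krull_dim_def cdim_def by simp
qed

end

lemma cdim_ge: "I \<subseteq> p \<Longrightarrow> up_chain R n p \<Longrightarrow> enat n \<le> cdim R I"
  unfolding cdim_def by (intro Sup_upper) blast

lemma cdim_antimono: "I \<subseteq> J \<Longrightarrow> cdim R J \<le> cdim R I"
  unfolding cdim_def by (intro Sup_subset_mono) blast

lemma cdim_attained:
  assumes "cdim R I = enat d" "d \<noteq> 0"
  obtains p where "I \<subseteq> p" "up_chain R d p"
proof -
  have "enat d \<in> {enat n | n. \<exists>p. I \<subseteq> p \<and> up_chain R n p}"
  proof (rule Sup_enat_mem)
    show s: "Sup {enat n | n. \<exists>p. I \<subseteq> p \<and> up_chain R n p} = enat d" using assms(1) by (simp add: cdim_def)
    show "{enat n | n. \<exists>p. I \<subseteq> p \<and> up_chain R n p} \<noteq> {}"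
    proof
      assume "{enat n | n. \<exists>p. I \<subseteq> p \<and> up_chain R n p} = {}"
      then have "enat d = 0" using s by (simp add: Sup_enat_def)
      then show False using assms(2) by (simp add: zero_enat_def)
    qed
  qed
  then show ?thesis using that by auto
qed

lemma (in noeth_local) cdim_finite: "cdim R I < \<infinity>"
proof -
  obtain s where s: "\<forall>n p. up_chain R n p \<longrightarrow> n \<le> s" using finite_dimension by blast
  have "cdim R I \<le> enat s" unfolding cdim_def using s by (intro Sup_least) auto
  then show ?thesis using enat_ile by fastforce
qed

section \<open>Dimension, regular sequences and the Cohen-Macaulay property of a quotient\<close>

context local_module
begin

lemma module_dim_eq: "module_dim R M = cdim R (colon R M {0\<^sub>M} (carrier M))"
  unfolding module_dim_def annihilator_eq_qann
  by (rule R.krull_dim_quotient) (intro colon_ideal sub_zero order_refl)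

lemma module_dim_restrict: "sub N \<Longrightarrow> module_dim R (M\<lparr>carrier := N\<rparr>) = cdim R (colon R M {0\<^sub>M} N)"
  unfolding module_dim_def annihilator_restrict
  by (rule R.krull_dim_quotient) (intro colon_ideal sub_zero subD(1))

lemma module_dim_quotient: "sub L \<Longrightarrow> module_dim R (quotient_module M L) = cdim R (colon R M L (carrier M))"
  unfolding module_dim_def annihilator_quotient
  by (rule R.krull_dim_quotient) (intro colon_ideal order_refl)

text \<open>Turns the recursion into the indexed form used by \<open>regular_sequence\<close>.
  Appending at the end leaves the earlier prefixes, and thus their conditions, unchanged.\<close>

lemma regular_mod_iff_nth:
  assumes "set ys \<subseteq> carrier R" "sub L" "sub N"
  shows "regular_mod L N ys \<longleftrightarrow>
    (\<forall>j<length ys. \<forall>n\<in>N. ys ! j *\<^sub>M n \<in> L +\<^sub>S seq_smult (take j ys) N \<longrightarrow> n \<in> L +\<^sub>S seq_smult (take j ys) N)"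
  using assms(1)
proof (induction ys rule: rev_induct)
  case (snoc y ys)
  have ys: "set ys \<subseteq> carrier R" using snoc.prems by simp
  have "regular_mod L N (ys @ [y]) \<longleftrightarrow> regular_mod L N ys \<and> regular_mod (L +\<^sub>S seq_smult ys N) N [y]"
    by (rule regular_mod_append[OF ys assms(2,3)])
  then show ?case using snoc.IH[OF ys] by (auto simp: less_Suc_eq nth_append)
qed simp

lemma regular_mod_restrict:
  assumes "sub N"
  shows "module.regular_mod (M\<lparr>carrier := N\<rparr>) L K xs = regular_mod L K xs"
proof -
  interpret N: module R "M\<lparr>carrier := N\<rparr>" by (rule sub_is_module[OF assms])
  show ?thesis
    by (induction xs arbitrary: L) (simp_all add: scale_def N.scale_def set_add_def set_mult_def)
qed

text \<open>The definition works in a quotient of a quotient; both layers are unfolded to submodules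
  of M above L. The separate inequality is the nonvanishing clause, which \<open>regular_mod\<close>
  omits.\<close>

lemma regular_sequence_quotient_iff:
  assumes L: "sub L" and ys: "set ys \<subseteq> carrier R"
  shows "regular_sequence R (quotient_module M L) ys \<longleftrightarrow>
    regular_mod L (carrier M) ys \<and> L +\<^sub>S seq_smult ys (carrier M) \<noteq> carrier M"
proof -
  let ?Q = "quotient_module M L"
  interpret Q: local_module R ?Q \<mm>
    using quotient_is_module[OF L] noeth_local_axioms by (rule local_module.intro)
  note qs = quotient_simps[OF L]
  define K where "K zs = L +\<^sub>S seq_smult zs (carrier M)" for zs
  have J: "sub (seq_smult zs (carrier M))" if "set zs \<subseteq> carrier R" for zs
    using sub_seq_smult[OF that carrier_is_submodule] .
  have K: "sub (K zs)" "L \<subseteq> K zs" if "set zs \<subseteq> carrier R" for zs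
    unfolding K_def using sub_ssum[OF L J[OF that]] ssum_ge(1)[OF L J[OF that]] by auto
  have sm: "ideal_smult R (Idl (set zs)) ?Q = (\<lambda>x. L +>\<^bsub>M\<^esub> x) ` K zs" if "set zs \<subseteq> carrier R" for zs
    unfolding K_def Q.ideal_smult_Idl[OF that] by (rule seq_smult_quotient[OF L that])
  have QK: "Q.sub ((\<lambda>x. L +>\<^bsub>M\<^esub> x) ` K zs)" if "set zs \<subseteq> carrier R" for zs
    using quotient_image_sub[OF L K(1)[OF that]] .
  have mem: "L +>\<^bsub>M\<^esub> x \<in> (\<lambda>x. L +>\<^bsub>M\<^esub> x) ` K zs \<longleftrightarrow> x \<in> K zs" if "set zs \<subseteq> carrier R" "x \<in> carrier M" for zs x
    by (rule quotient_mem_image[OF L K[OF that(1)] that(2)])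
  have 1: "(let QQ = quotient_module ?Q (ideal_smult R (Idl (set (take i ys))) ?Q)
       in \<forall>y\<in>carrier QQ. (ys ! i) \<odot>\<^bsub>QQ\<^esub> y = \<zero>\<^bsub>QQ\<^esub> \<longrightarrow> y = \<zero>\<^bsub>QQ\<^esub>) \<longleftrightarrow>
       (\<forall>n\<in>carrier M. ys ! i *\<^sub>M n \<in> K (take i ys) \<longrightarrow> n \<in> K (take i ys))" if i: "i < length ys" for i
  proof -
    have t: "set (take i ys) \<subseteq> carrier R" using ys set_take_subset[of i ys] by blast
    have yi: "ys ! i \<in> carrier R" using ys i by auto
    let ?KQ = "(\<lambda>x. L +>\<^bsub>M\<^esub> x) ` K (take i ys)"
    note qq = Q.quotient_simps[OF QK[OF t]]
    have "(let QQ = quotient_module ?Q (ideal_smult R (Idl (set (take i ys))) ?Q)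
       in \<forall>y\<in>carrier QQ. (ys ! i) \<odot>\<^bsub>QQ\<^esub> y = \<zero>\<^bsub>QQ\<^esub> \<longrightarrow> y = \<zero>\<^bsub>QQ\<^esub>) \<longleftrightarrow>
       (\<forall>z\<in>carrier ?Q. (ys ! i) \<odot>\<^bsub>?Q\<^esub> z \<in> ?KQ \<longrightarrow> z \<in> ?KQ)"
      unfolding Let_def sm[OF t] qq(1,2)
      using qq(4)[OF yi] Q.coset_eq_self_iff[OF QK[OF t]] Q.smult_closed[OF yi] by simp
    also have "\<dots> \<longleftrightarrow> (\<forall>n\<in>carrier M. ys ! i *\<^sub>M n \<in> K (take i ys) \<longrightarrow> n \<in> K (take i ys))"
      unfolding qs(1) using qs(4)[OF yi] mem[OF t] smult_closed[OF yi] by simp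
    finally show ?thesis .
  qed
  have 2: "nonzero_module (quotient_module ?Q (ideal_smult R (Idl (set ys)) ?Q)) \<longleftrightarrow> K ys \<noteq> carrier M"
  proof -
    let ?KQ = "(\<lambda>x. L +>\<^bsub>M\<^esub> x) ` K ys"
    note qq = Q.quotient_simps[OF QK[OF ys]]
    have "nonzero_module (quotient_module ?Q (ideal_smult R (Idl (set ys)) ?Q)) \<longleftrightarrow>
       (\<exists>z\<in>carrier ?Q. ?KQ +>\<^bsub>?Q\<^esub> z \<noteq> ?KQ)"
      unfolding nonzero_module_def sm[OF ys] qq(1,2) using Q.subD(2)[OF Q.carrier_is_submodule] by blast
    also have "\<dots> \<longleftrightarrow> (\<exists>z\<in>carrier ?Q. z \<notin> ?KQ)" using Q.coset_eq_self_iff[OF QK[OF ys]] by simp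
    also have "\<dots> \<longleftrightarrow> (\<exists>n\<in>carrier M. n \<notin> K ys)" unfolding qs(1) using mem[OF ys] by simp
    also have "\<dots> \<longleftrightarrow> K ys \<noteq> carrier M" using subD(1)[OF K(1)[OF ys]] by blast
    finally show ?thesis .
  qed
  show ?thesis
    unfolding regular_sequence_def regular_mod_iff_nth[OF ys L carrier_is_submodule] K_def[symmetric] 2
    using 1 ys by blast
qed

end

text \<open>If depth equals dimension, some regular sequence is as long as xs, and
  \<open>parameters_regular\<close> carries its regularity over to xs. Conversely, regular
  parameters bound the depth from below by the dimension, and \<open>regular_up_chain\<close> bounds
  it from above.\<close>

lemma (in noeth_local_module) cohen_macaulay_quotient_iff:
  assumes L: "sub L" "L \<noteq> carrier M" and xs: "set xs \<subseteq> \<mm>" "length xs \<noteq> 0"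
    and dim: "cdim R (colon R M L (carrier M)) = enat (length xs)"
    and par: "\<And>p. primeideal p R \<Longrightarrow> colon R M L (carrier M) \<union> set xs \<subseteq> p \<Longrightarrow> p = \<mm>"
  shows "cohen_macaulay R \<mm> (quotient_module M L) \<longleftrightarrow> regular_mod L (carrier M) xs"
proof
  let ?Q = "quotient_module M L"
  let ?S = "{enat (length zs) | zs. set zs \<subseteq> \<mm> \<and> regular_sequence R ?Q zs}"
  have Lc: "L \<subseteq> carrier M" using subD(1)[OF L(1)] .
  note iff = regular_sequence_quotient_iff[OF L(1)]
  have mdim: "module_dim R ?Q = enat (length xs)" using module_dim_quotient[OF L(1)] dim by simp
  {
    assume "cohen_macaulay R \<mm> ?Q"
    then have S: "Sup ?S = enat (length xs)" unfolding cohen_macaulay_def depth_def mdim by blast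
    \<comment> \<open>The empty set has supremum 0, which the positive number of parameters
      excludes; so the depth is attained by some sequence.\<close>
    moreover have "?S \<noteq> {}"
    proof
      assume e: "?S = {}"
      have "enat (length xs) = 0" using S unfolding e by (simp add: Sup_enat_def)
      then show False using xs(2) by (simp add: zero_enat_def)
    qed
    ultimately have "enat (length xs) \<in> ?S" by (rule Sup_enat_mem)
    then obtain zs where zs: "length zs = length xs" "set zs \<subseteq> \<mm>" "regular_sequence R ?Q zs" by auto
    have zc: "set zs \<subseteq> carrier R" using zs mm_carr by blast
    have "regular_mod L (carrier M) zs" using zs(3) iff[OF zc] by blast
    then show "regular_mod L (carrier M) xs"
      using parameters_regular[OF xs(1) zs(2,1) L(1) carrier_is_submodule Lc] par by blast
  }
  assume r: "regular_mod L (carrier M) xs"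
  have xc: "set xs \<subseteq> carrier R" using xs mm_carr by blast
  have "L +\<^sub>S seq_smult xs (carrier M) \<noteq> carrier M"
  proof
    assume eq: "L +\<^sub>S seq_smult xs (carrier M) = carrier M"
    have "carrier M \<subseteq> L"
    proof (rule local_nakayama[OF L(1) order_refl])
      fix T assume T: "sub T" "L \<subseteq> T" "\<And>p k. p \<in> \<mm> \<Longrightarrow> k \<in> carrier M \<Longrightarrow> p *\<^sub>M k \<in> T"
      have "seq_smult xs (carrier M) \<subseteq> T" using seq_smult_le_iff[OF xc carrier_is_submodule T(1)] T(3) xs(1) by blast
      then show "carrier M \<subseteq> T" using ssum_le[OF T(1,2)] eq by blast
    qed
    then show False using L Lc by blast
  qed
  then have "regular_sequence R ?Q xs" using iff[OF xc] r by blast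
  then have "enat (length xs) \<in> ?S" using xs by blast
  then have "enat (length xs) \<le> Sup ?S" by (rule Sup_upper)
  moreover have "Sup ?S \<le> enat (length xs)"
  proof (rule Sup_least)
    fix e assume "e \<in> ?S"
    then obtain zs where zs: "e = enat (length zs)" "set zs \<subseteq> \<mm>" "regular_sequence R ?Q zs" by blast
    have zc: "set zs \<subseteq> carrier R" using zs mm_carr by blast
    obtain p where "colon R M L (carrier M) \<subseteq> p" "up_chain R (length zs) p"
      using regular_up_chain[OF zs(2) L(1) carrier_is_submodule Lc] zs(3) iff[OF zc] by blast
    then show "e \<le> enat (length xs)" using cdim_ge dim zs(1) by metis
  qed
  ultimately have "depth R \<mm> ?Q = module_dim R ?Q" unfolding depth_def mdim by (rule antisym[rotated])
  moreover have "fg_module R ?Q" using noeth_module.finitely_generated[OF quotient_noeth[OF L(1)]] .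
  ultimately show "cohen_macaulay R \<mm> ?Q" by (simp add: cohen_macaulay_def)
qed

section \<open>The dimension filtration\<close>

lemma is_largest_unique: "is_largest P N \<Longrightarrow> is_largest P N' \<Longrightarrow> N = N'"
  unfolding is_largest_def by blast

context noeth_local_module
begin

abbreviation (input) mdim :: "'c set \<Rightarrow> enat" where "mdim N \<equiv> cdim R (colon R M {0\<^sub>M} N)"

text \<open>Finite length makes \<mm> the only prime over the annihilator, which is the height
  theorem with no parameters at all.\<close>

lemma mdim_finite_length:
  assumes N: "sub N" and fin: "qlen {0\<^sub>M} N < \<infinity>"
  shows "mdim N = 0"
proof -
  have pr: "p = \<mm>" if "primeideal p R" "colon R M {0\<^sub>M} N \<union> set [] \<subseteq> p" for p
    by (rule parameters_of_finite_length[OF _ sub_zero N zero_le[OF N] _ that])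
      (use fin ssum_zero[OF sub_zero] in auto)
  have "n = 0" if "colon R M {0\<^sub>M} N \<subseteq> p" "up_chain R n p" for n p
    using up_chain_bound[of "[]", OF _ pr that] by simp
  then have "mdim N \<le> enat 0" unfolding cdim_def by (intro Sup_least) auto
  then show ?thesis by (simp add: zero_enat_def[symmetric])
qed

text \<open>\<open>D (i - 1)\<close> is given as a submodule of \<open>D i\<close> only, hence the
  induction downwards from \<open>D t\<close>, which is all of M.\<close>

lemma filtration_sub:
  assumes df: "dimension_filtration R M t D" and i: "i \<le> t"
  shows "sub (D i)"
  using i
proof (induction rule: inc_induct)
  case base
  then show ?case using df carrier_is_submodule by (simp add: dimension_filtration_def)
next
  case (step n)
  then have "submodule (D (Suc n - 1)) R (M\<lparr>carrier := D (Suc n)\<rparr>)"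
    using df by (auto simp: dimension_filtration_def is_largest_def Ball_def dest!: spec[of _ "Suc n"])
  then show ?case using sub_restrict_iff[OF step.IH] by simp
qed

lemma filtration_step:
  assumes df: "dimension_filtration R M t D" and i: "i < t"
  shows "D i \<subseteq> D (Suc i)" "mdim (D i) < mdim (D (Suc i))"
proof -
  have s: "sub (D i)" "sub (D (Suc i))" using filtration_sub[OF df] i by auto
  have "Suc i \<in> {1..t}" using i by simp
  then have "submodule (D i) R (M\<lparr>carrier := D (Suc i)\<rparr>) \<and>
      module_dim R (M\<lparr>carrier := D i\<rparr>) < module_dim R (M\<lparr>carrier := D (Suc i)\<rparr>)"
    using df unfolding dimension_filtration_def is_largest_def by fastforce
  then show "D i \<subseteq> D (Suc i)" "mdim (D i) < mdim (D (Suc i))"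
    using sub_restrict_iff[OF s(2)] module_dim_restrict[OF s(1)] module_dim_restrict[OF s(2)] by auto
qed

lemma filtration_mono:
  assumes df: "dimension_filtration R M t D" and ij: "i \<le> j" "j \<le> t"
  shows "D i \<subseteq> D j"
  using ij
proof (induction rule: dec_induct)
  case (step n)
  then show ?case using filtration_step(1)[OF df, of n] by auto
qed simp

lemma filtration_zero:
  assumes df: "dimension_filtration R M t D"
  shows "mdim (D 0) = 0"
proof (rule mdim_finite_length)
  show s: "sub (D 0)" using filtration_sub[OF df] by simp
  interpret D: local_module R "M\<lparr>carrier := D 0\<rparr>" \<mm>
    using sub_is_module[OF s] noeth_local_axioms by (rule local_module.intro)
  have "module_length R (M\<lparr>carrier := D 0\<rparr>) < \<infinity>"
    using df by (simp add: dimension_filtration_def is_largest_def)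
  then show "qlen {0\<^sub>M} (D 0) < \<infinity>"
    using D.module_length_eq len_restrict[OF s order_refl, of "{0\<^sub>M}"] by simp
qed

text \<open>Both filtrations start at M and descend by the same rule, so they agree counted from the
  top. If one were longer, its members below the bottom of the other would have dimension less than
  0.\<close>

lemma filtration_unique:
  assumes df: "dimension_filtration R M t D" "dimension_filtration R M t' D'"
  shows "t = t'" "\<And>i. i \<le> t \<Longrightarrow> D i = D' i"
proof -
  have largest: "is_largest (\<lambda>N. submodule N R (M\<lparr>carrier := E i\<rparr>) \<and>
      module_dim R (M\<lparr>carrier := N\<rparr>) < module_dim R (M\<lparr>carrier := E i\<rparr>)) (E (i - 1))"
    if "dimension_filtration R M s E" "i \<in> {1..s}" for s E i
    using that unfolding dimension_filtration_def by blast
  have eq: "D (t - j) = D' (t' - j)" if "j \<le> t" "j \<le> t'" for j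
    using that
  proof (induction j)
    case 0
    then show ?case using df by (simp add: dimension_filtration_def)
  next
    case (Suc j)
    then have e: "D (t - j) = D' (t' - j)" by simp
    have "t - j \<in> {1..t}" and j': "t' - j \<in> {1..t'}" using Suc.prems by auto
    then have "D (t - j - 1) = D' (t' - j - 1)"
      by (intro is_largest_unique[OF largest[OF df(1)] largest[OF df(2) j', folded e]])
    then show ?case by simp
  qed
  have no: False if "s < s'" "dimension_filtration R M s E" "dimension_filtration R M s' E'" "E 0 = E' (s' - s)" for s s' E E'
  proof -
    have "mdim (E' (s' - s - 1)) < mdim (E' (Suc (s' - s - 1)))" using that by (intro filtration_step(2)) auto
    moreover have "Suc (s' - s - 1) = s' - s" using that by simp
    ultimately have "mdim (E' (s' - s - 1)) < mdim (E 0)" using that(4) by simp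
    then show False using filtration_zero[OF that(2)] by simp
  qed
  show t: "t = t'"
  proof (rule linorder_cases)
    assume "t < t'"
    then show ?thesis using no[OF _ df] eq[of t] by simp
  next
    assume "t' < t"
    then show ?thesis using no[OF _ df(2,1)] eq[of t'] by simp
  qed
  show "D i = D' i" if "i \<le> t" for i using eq[of "t - i"] that t by simp
qed

text \<open>Gives dim (D_i / D_{i-1}) = dim D_i. Since Ann K times Ann (N/K) lies in Ann N, a prime
  at the bottom of a longest chain over Ann N contains one of the two; it cannot contain Ann K,
  because dim K < dim N.\<close>

lemma cdim_filtration_quotient:
  assumes K: "sub K" and N: "sub N" and KN: "K \<subseteq> N" and lt: "mdim K < mdim N"
  shows "cdim R (colon R M K N) = mdim N"
proof (rule antisym)
  show "cdim R (colon R M K N) \<le> mdim N" using zero_le[OF K] by (intro cdim_antimono colon_mono) auto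
  obtain d where d: "mdim N = enat d" using cdim_finite[of "colon R M {0\<^sub>M} N"] by auto
  have "d \<noteq> 0"
  proof
    assume "d = 0"
    then have "mdim N = 0" using d by (simp add: zero_enat_def)
    then show False using lt by simp
  qed
  then obtain p where p: "colon R M {0\<^sub>M} N \<subseteq> p" "up_chain R d p" using cdim_attained[OF d] by blast
  note pp = R.primeE[OF up_chain_prime[OF p(2)]]
  have "colon R M K N \<subseteq> p"
  proof (rule ccontr)
    assume "\<not> ?thesis"
    then obtain a where a: "a \<in> colon R M K N" "a \<notin> p" by blast
    have ac: "a \<in> carrier R" using a by (simp add: colon_def)
    have "colon R M {0\<^sub>M} K \<subseteq> p"
    proof
      fix b assume b: "b \<in> colon R M {0\<^sub>M} K"
      have bc: "b \<in> carrier R" using b by (simp add: colon_def)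
      have "(b \<otimes> a) *\<^sub>M n = 0\<^sub>M" if "n \<in> N" for n
      proof -
        have "a *\<^sub>M n \<in> K" using a that by (auto simp: colon_def)
        then have "b *\<^sub>M a *\<^sub>M n = 0\<^sub>M" using b by (auto simp: colon_def)
        then show ?thesis using ac bc sub_carr[OF N that] by (simp add: smult_assoc1)
      qed
      then have "b \<otimes> a \<in> p" using p(1) ac bc by (auto simp: colon_def)
      then show "b \<in> p" using pp(4)[OF bc ac] a by blast
    qed
    then have "enat d \<le> mdim K" using cdim_ge p(2) by blast
    then show False using lt d by simp
  qed
  then show "mdim N \<le> cdim R (colon R M K N)" unfolding d using cdim_ge p(2) by blast
qed

lemma filtration_dim_eq:
  assumes "sub (D i)"
  shows "enat (filtration_dim R M D i) = mdim (D i)"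
  using cdim_finite[of "colon R M {0\<^sub>M} (D i)"] module_dim_restrict[OF assms] by (auto simp: filtration_dim_def)

section \<open>Lengths of the graded quotients, good systems and the formula in the original
  terms\<close>

lemma filtration_quotient_length_eq:
  assumes df: "dimension_filtration R M t D" and i: "i \<le> t" and xs: "set xs \<subseteq> carrier R"
  shows "filtration_quotient_length R M D (Idl (set xs)) i =
    qlen ((if i = 0 then {0\<^sub>M} else D (i - 1)) +\<^sub>S seq_smult xs (D i)) (D i)"
proof -
  have s: "sub (D i)" using filtration_sub[OF df i] .
  let ?Mi = "M\<lparr>carrier := D i\<rparr>"
  interpret D: local_module R ?Mi \<mm>
    using sub_is_module[OF s] noeth_local_axioms by (rule local_module.intro)
  have l: "D.seq_smult xs (carrier ?Mi) = seq_smult xs (D i)" using seq_smult_restrict[OF s] by simp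
  have add: "A <+>\<^bsub>?Mi\<^esub> B = A +\<^sub>S B" for A B by (simp add: set_add_def set_mult_def)
  have J: "sub (seq_smult xs (D i))" "seq_smult xs (D i) \<subseteq> D i" using sub_seq_smult[OF xs s] seq_smult_le[OF xs s] .
  show ?thesis
  proof (cases "i = 0")
    case True
    have "D.sub (seq_smult xs (D i))" using sub_restrict_iff[OF s] J by blast
    then have "module_length R (quotient_module ?Mi (seq_smult xs (D i))) = qlen (seq_smult xs (D i)) (D i)"
      using D.module_length_quotient len_restrict[OF s order_refl] by simp
    moreover have "{0\<^sub>M} +\<^sub>S seq_smult xs (D i) = seq_smult xs (D i)"
      using ssum_comm[OF subD(1)[OF sub_zero] subD(1)[OF J(1)]] ssum_zero[OF J(1)] by simp
    ultimately show ?thesis using True D.ideal_smult_Idl[OF xs] l by (simp add: filtration_quotient_length_def)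
  next
    case False
    let ?L = "D (i - 1)"
    have L: "sub ?L" "?L \<subseteq> D i"
      using filtration_sub[OF df, of "i - 1"] filtration_mono[OF df, of "i - 1" i] i by auto
    have DL: "D.sub ?L" using sub_restrict_iff[OF s] L by blast
    let ?Q = "quotient_module ?Mi ?L" and ?K = "?L +\<^sub>S seq_smult xs (D i)"
    interpret Q: local_module R ?Q \<mm>
      using D.quotient_is_module[OF DL] noeth_local_axioms by (rule local_module.intro)
    have K: "D.sub ?K" "?L \<subseteq> ?K"
      using sub_restrict_iff[OF s] sub_ssum[OF L(1) J(1)] ssum_le[OF s L(2) J(2)] ssum_ge(1)[OF L(1) J(1)] by auto
    have e: "ideal_smult R (Idl (set xs)) ?Q = (\<lambda>x. ?L +>\<^bsub>?Mi\<^esub> x) ` ?K"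
      using Q.ideal_smult_Idl[OF xs] D.seq_smult_quotient[OF DL xs] l add by simp
    have "module_length R (quotient_module ?Q ((\<lambda>x. ?L +>\<^bsub>?Mi\<^esub> x) ` ?K)) = sat_len R ?Q \<mm> ((\<lambda>x. ?L +>\<^bsub>?Mi\<^esub> x) ` ?K) (carrier ?Q)"
      by (rule Q.module_length_quotient[OF D.quotient_image_sub[OF DL K(1)]])
    also have "\<dots> = qlen ?K (D i)"
      using D.len_quotient[OF DL K] len_restrict[OF s order_refl] by simp
    finally show ?thesis using False e by (simp add: filtration_quotient_length_def filtration_quotient_def)
  qed
qed

lemma length_power_quotient:
  assumes xs: "set xs \<subseteq> carrier R"
  shows "module_length R (quotient_module M (ideal_smult R (Idl (set xs) [^]\<^bsub>ideals_set R\<^esub> (n + 1 :: nat)) M)) =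
    qlen (seq_power xs (Suc n) (carrier M)) (carrier M)"
proof -
  have "ideal_smult R (Idl (set xs) [^]\<^bsub>ideals_set R\<^esub> (n + 1)) M = seq_power xs (Suc n) (carrier M)"
    using ideal_smult_power[OF xs, of "Suc n"] by simp
  then show ?thesis using module_length_quotient[OF sub_seq_power[OF xs carrier_is_submodule]] by metis
qed

text \<open>
  The parameters \<open>x\<^sub>j\<close> are chosen in \<open>Ann (M / G i)\<close> for all \<open>i\<close> with \<open>d i < j\<close>, where \<open>G i\<close> is
  maximal with \<open>G i \<inter> D i = 0\<close>. This is possible since \<open>Ann (M / G i)\<close> and \<open>Ann (D i)\<close> have
  comparable radicals.
\<close>

lemma good_system_exists:
  assumes df: "dimension_filtration R M t D"
  shows "\<exists>xs. good_system_of_parameters R \<mm> M xs"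
proof -
  let ?d = "filtration_dim R M D"
  have D: "sub (D i)" if "i \<le> t" for i using filtration_sub[OF df that] .
  obtain d where d: "mdim (carrier M) = enat d" using cdim_finite[of "colon R M {0\<^sub>M} (carrier M)"] by auto
  have "\<exists>G. sub G \<and> G \<inter> D i = {0\<^sub>M} \<and> (\<forall>K. sub K \<longrightarrow> G \<subseteq> K \<longrightarrow> K \<inter> D i = {0\<^sub>M} \<longrightarrow> K = G)" if "i \<le> t" for i
    using relative_complement[OF D[OF that] sub_zero zero_le[OF D[OF that]]] by metis
  then obtain G where G: "\<And>i. i \<le> t \<Longrightarrow> sub (G i)" "\<And>i. i \<le> t \<Longrightarrow> G i \<inter> D i = {0\<^sub>M}"
    "\<And>i K. i \<le> t \<Longrightarrow> sub K \<Longrightarrow> G i \<subseteq> K \<Longrightarrow> K \<inter> D i = {0\<^sub>M} \<Longrightarrow> K = G i" by metis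
  \<comment> \<open>Requirements on the j-th parameter: it lies in \<mm> and in Ann (M / G i)
    whenever d_i < j. As \<open>xs ! j\<close> is parameter number j + 1, it is taken from the
    intersection of \<open>A (Suc j)\<close>.\<close>
  define A where "A j = insert \<mm> ((\<lambda>i. colon R M (G i) (carrier M)) ` {i. i \<le> t \<and> ?d i < j})" for j
  have A_ideal: "ideal J R" if "J \<in> A j" for J j
    using that max_prime primeideal.axioms(1) colon_ideal[OF G(1) order_refl] unfolding A_def by blast
  have finA: "finite (A j)" for j
  proof -
    have "finite {i. i \<le> t \<and> ?d i < j}" by (rule finite_subset[of _ "{..t}"]) auto
    then show ?thesis unfolding A_def by simp
  qed
  have "\<exists>xs. length xs = d \<and> (\<forall>j<d. xs ! j \<in> \<Inter>(A (Suc j))) \<and>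
      (\<forall>p. colon R M {0\<^sub>M} (carrier M) \<union> set xs \<subseteq> p \<longrightarrow> \<not> up_chain R 1 p)"
  proof (rule parameters_exist)
    show "colon R M {0\<^sub>M} (carrier M) \<subseteq> carrier R" by (auto simp: colon_def)
    show "ideal (\<Inter>(A j)) R" for j
      using R.i_Intersect[of "A j"] A_ideal by (auto simp: A_def)
    show "\<not> up_chain R (Suc d) p" if "colon R M {0\<^sub>M} (carrier M) \<subseteq> p" for p
      using cdim_ge[OF that, of R "Suc d"] d by auto
    fix j p assume j: "j \<in> {1..d}" and p: "colon R M {0\<^sub>M} (carrier M) \<subseteq> p" "up_chain R j p"
    have pp: "primeideal p R" using up_chain_prime[OF p(2)] .
    have "\<not> J \<subseteq> p" if J: "J \<in> A j" for J
    proof (cases "J = \<mm>")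
      case True
      obtain k where "j = Suc k" using j by (cases j) auto
      then obtain q where "p \<subset> q" "up_chain R k q" using p(2) by auto
      then show ?thesis using le_max[OF up_chain_prime] True by blast
    next
      case False
      then obtain i where i: "i \<le> t" "?d i < j" "J = colon R M (G i) (carrier M)" using J by (auto simp: A_def)
      show ?thesis
      proof
        assume Jp: "J \<subseteq> p"
        \<comment> \<open>With Ann (M / G i) in p also Ann (D i) is in p, as each of its elements
          has a power sending M into \<open>G i\<close>. But then dim D_i \<ge> j, against d_i <
          j.\<close>
        have "colon R M {0\<^sub>M} (D i) \<subseteq> p"
        proof
          fix a assume a: "a \<in> colon R M {0\<^sub>M} (D i)"
          have ac: "a \<in> carrier R" using a by (simp add: colon_def)
          have "a *\<^sub>M e \<in> {0\<^sub>M}" if "e \<in> D i" for e using a that by (simp add: colon_def)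
          then obtain k :: nat where k: "\<forall>n\<in>carrier M. a [^] k *\<^sub>M n \<in> G i"
            using relative_complement_power[OF D[OF i(1)] G(1)[OF i(1)] G(2)[OF i(1)] G(3)[OF i(1)] ac] by blast
          then have "a [^] k \<in> J" using i(3) ac by (simp add: colon_def)
          then show "a \<in> p" using Jp R.prime_pow[OF pp ac] by blast
        qed
        then have "enat j \<le> mdim (D i)" using cdim_ge p(2) by blast
        then have "enat j \<le> enat (?d i)" using filtration_dim_eq[of D i] D[OF i(1)] by simp
        then show False using i(2) by simp
      qed
    qed
    then have "\<exists>a\<in>carrier R. a \<notin> p \<and> (\<forall>J\<in>A j. a \<in> J)"
      using A_ideal by (intro R.prime_separation finA pp) auto
    then show "\<not> \<Inter>(A j) \<subseteq> p" by blast
  qed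
  then obtain xs where xs: "length xs = d" "\<And>j. j < d \<Longrightarrow> xs ! j \<in> \<Inter>(A (Suc j))"
    "\<And>p. colon R M {0\<^sub>M} (carrier M) \<union> set xs \<subseteq> p \<Longrightarrow> \<not> up_chain R 1 p" by blast
  have xm: "set xs \<subseteq> \<mm>"
  proof
    fix x assume "x \<in> set xs"
    then obtain j where "j < d" "x = xs ! j" using xs(1) by (auto simp: in_set_conv_nth)
    then show "x \<in> \<mm>" using xs(2)[of j] by (auto simp: A_def)
  qed
  have xc: "set xs \<subseteq> carrier R" using xm mm_carr by blast
  have J: "sub (seq_smult xs (carrier M))" using sub_seq_smult[OF xc carrier_is_submodule] .
  have "qlen (seq_smult xs (carrier M)) (carrier M) < \<infinity>"
  proof (rule qlen_finite[OF J carrier_is_submodule subD(1)[OF J]])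
    fix p assume p: "primeideal p R" "colon R M (seq_smult xs (carrier M)) (carrier M) \<subseteq> p"
    have "colon R M {0\<^sub>M} (carrier M) \<subseteq> colon R M (seq_smult xs (carrier M)) (carrier M)"
      using zero_le[OF J] by (intro colon_mono) auto
    moreover have "set xs \<subseteq> colon R M (seq_smult xs (carrier M)) (carrier M)"
      using xc seq_smult_mem[OF xc carrier_is_submodule] by (auto simp: colon_def)
    ultimately have "\<not> up_chain R 1 p" using xs(3) p(2) by blast
    then show "p = \<mm>" using p(1) le_max[OF p(1)] max_prime by auto
  qed
  then have sop: "system_of_parameters R \<mm> M xs"
    unfolding system_of_parameters_def ideal_smult_Idl[OF xc] module_dim_eq d
    using xm xs(1) module_length_quotient[OF J] by simp
  have "D i \<inter> ideal_smult R (Idl (set (drop (?d i) xs))) M = {0\<^sub>M}" if i: "i < t" for i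
  proof -
    have dc: "set (drop (?d i) xs) \<subseteq> carrier R" using xc set_drop_subset[of "?d i" xs] by blast
    have it: "i \<le> t" using i by simp
    \<comment> \<open>All parameters after the d_i-th were chosen in Ann (M / G i), so they send M
      into \<open>G i\<close>, which meets \<open>D i\<close> only in 0.\<close>
    have "seq_smult (drop (?d i) xs) (carrier M) \<subseteq> G i"
      unfolding seq_smult_le_iff[OF dc carrier_is_submodule G(1)[OF it]]
    proof (intro ballI)
      fix x n assume x: "x \<in> set (drop (?d i) xs)" and n: "n \<in> carrier M"
      then obtain k where "k < length (drop (?d i) xs)" "x = drop (?d i) xs ! k" by (metis in_set_conv_nth)
      then have "?d i + k < d" "x = xs ! (?d i + k)" using xs(1) by auto
      then have "x \<in> colon R M (G i) (carrier M)" using xs(2)[of "?d i + k"] it by (auto simp: A_def)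
      then show "x *\<^sub>M n \<in> G i" using n by (simp add: colon_def)
    qed
    then show ?thesis
      unfolding ideal_smult_Idl[OF dc] using G(2)[OF it] subD(2)[OF D[OF it]] subD(2)[OF sub_seq_smult[OF dc carrier_is_submodule]]
      by blast
  qed
  then show ?thesis using sop df unfolding good_system_of_parameters_def by blast
qed

lemma good_system_formula_iff:
  assumes df: "dimension_filtration R M t D" and good: "good_system_of_parameters R \<mm> M xs"
  shows "(\<forall>n::nat. module_length R (quotient_module M (ideal_smult R (Idl (set xs) [^]\<^bsub>ideals_set R\<^esub> (n + 1)) M)) =
      (\<Sum>i = 0..t. enat ((n + filtration_dim R M D i) choose filtration_dim R M D i) *
         filtration_quotient_length R M D (Idl (set xs)) i)) \<longleftrightarrow>
    (\<forall>i\<in>{1..t}. cohen_macaulay R \<mm> (filtration_quotient M D i))"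
proof -
  let ?d = "filtration_dim R M D"
  have xm: "set xs \<subseteq> \<mm>" and dimM: "enat (length xs) = mdim (carrier M)"
    and len_fin: "module_length R (quotient_module M (ideal_smult R (Idl (set xs)) M)) < \<infinity>"
    using good by (auto simp: good_system_of_parameters_def system_of_parameters_def module_dim_eq)
  have xc: "set xs \<subseteq> carrier R" using xm mm_carr by blast
  obtain t' D' where df': "dimension_filtration R M t' D'"
    and good': "\<And>i. i < t' \<Longrightarrow> D' i \<inter> ideal_smult R (Idl (set (drop (filtration_dim R M D' i) xs))) M = {0\<^sub>M}"
    using good by (auto simp: good_system_of_parameters_def)
  note uniq = filtration_unique[OF df df']
  have D: "sub (D i)" if "i \<le> t" for i using filtration_sub[OF df that] .
  have dd: "enat (?d i) = mdim (D i)" if "i \<le> t" for i using filtration_dim_eq D[OF that] .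
  have top: "D t = carrier M" using df by (simp add: dimension_filtration_def)
  have dt: "?d t = length xs" using dd[of t] dimM top by (metis enat.inject order_refl)
  have fin: "qlen (seq_smult xs (carrier M)) (carrier M) < \<infinity>"
    using len_fin module_length_quotient[OF sub_seq_smult[OF xc carrier_is_submodule]] unfolding ideal_smult_Idl[OF xc] by simp
  have d0: "?d 0 = 0" using dd[of 0] filtration_zero[OF df] by (simp add: zero_enat_def)
  have d_le: "?d i \<le> length xs" if "i \<le> t" for i
  proof -
    have "mdim (D i) \<le> mdim (carrier M)" using subD(1)[OF D[OF that]] by (intro cdim_antimono colon_mono) auto
    then show ?thesis using dd[OF that] dimM by (metis enat_ord_simps(1))
  qed
  \<comment> \<open>For i = t nothing is dropped, since d_t is the number of parameters. For i < t
    the product xn lies in both submodules of the goodness condition, whose filtration is identified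
    with D by uniqueness.\<close>
  have kill: "x *\<^sub>M n = 0\<^sub>M" if i: "i \<le> t" and x: "x \<in> set (drop (?d i) xs)" and n: "n \<in> D i" for i x n
  proof (cases "i = t")
    case True
    then show ?thesis using x dt by simp
  next
    case False
    then have it: "i < t" using i by simp
    have Di: "D' i = D i" "filtration_dim R M D' i = ?d i" using uniq i by (auto simp: filtration_dim_def)
    have dc: "set (drop (?d i) xs) \<subseteq> carrier R" using xc set_drop_subset[of "?d i" xs] by blast
    have "x *\<^sub>M n \<in> seq_smult (drop (?d i) xs) (carrier M)"
      using seq_smult_mem[OF dc carrier_is_submodule x] sub_carr[OF D[OF i] n] by blast
    moreover have "x *\<^sub>M n \<in> D i" using subD(5)[OF D[OF i]] x dc n by blast
    moreover have "i < t'" using it uniq(1) by simp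
    ultimately show ?thesis using good'[of i] unfolding Di ideal_smult_Idl[OF dc] by blast
  qed
  have cm: "cohen_macaulay R \<mm> (filtration_quotient M D i) \<longleftrightarrow> regular_mod (D (i - 1)) (D i) (take (?d i) xs)"
    if i1: "i \<in> {1..t}" for i
  proof -
    have i: "i \<le> t" "i - 1 \<le> t" "i - 1 < t" "Suc (i - 1) = i" using i1 by auto
    let ?Mi = "M\<lparr>carrier := D i\<rparr>" and ?L = "D (i - 1)" and ?ys = "take (?d i) xs"
    note s = D[OF i(1)] and L = D[OF i(2)]
    have LD: "?L \<subseteq> D i" and lt: "mdim ?L < mdim (D i)"
      using filtration_step[OF df i(3)] i(4) by auto
    interpret Di: noeth_local_module R ?Mi \<mm>
      by (intro noeth_local_module.intro local_module.intro restrict_noeth[OF s] sub_is_module[OF s] noeth_local_axioms)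
    have ly: "length ?ys = ?d i" using d_le[OF i(1)] by simp
    have "cohen_macaulay R \<mm> (quotient_module ?Mi ?L) \<longleftrightarrow> Di.regular_mod ?L (carrier ?Mi) ?ys"
    proof (rule Di.cohen_macaulay_quotient_iff)
      show "Di.sub ?L" using sub_restrict_iff[OF s] L LD by blast
      show "?L \<noteq> carrier ?Mi" using lt by auto
      show "set ?ys \<subseteq> \<mm>" using xm set_take_subset[of "?d i" xs] by blast
      have "mdim (D i) \<noteq> 0" using lt by auto
      then show "length ?ys \<noteq> 0" using dd[OF i(1)] ly by (metis zero_enat_def)
      show "cdim R (colon R ?Mi ?L (carrier ?Mi)) = enat (length ?ys)"
        unfolding colon_restrict ly dd[OF i(1)] using cdim_filtration_quotient[OF L s LD lt] by simp
      \<comment> \<open>A prime over Ann (D_i / D_{i-1}) contains Ann (D_i) and with it the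
        parameters after the d_i-th, which annihilate D_i. So p contains Ann M and all of
        xs.\<close>
      fix p assume p: "primeideal p R" "colon R ?Mi ?L (carrier ?Mi) \<union> set ?ys \<subseteq> p"
      then have pL: "colon R M ?L (D i) \<subseteq> p" "set ?ys \<subseteq> p" by (simp_all add: colon_restrict)
      have 1: "colon R M {0\<^sub>M} (D i) \<subseteq> p" using pL(1) zero_le[OF L] colon_mono[of "{0\<^sub>M}" ?L "D i" "D i"] by blast
      have "set (drop (?d i) xs) \<subseteq> colon R M {0\<^sub>M} (D i)"
        using kill[OF i(1)] xc set_drop_subset[of "?d i" xs] by (auto simp: colon_def)
      moreover have "set xs = set ?ys \<union> set (drop (?d i) xs)" by (metis append_take_drop_id set_append)
      ultimately have "set xs \<subseteq> p" using 1 pL(2) by blast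
      moreover have "colon R M {0\<^sub>M} (carrier M) \<subseteq> p"
        using 1 colon_mono[OF order_refl subD(1)[OF s], of "{0\<^sub>M}"] by blast
      ultimately have "colon R M {0\<^sub>M} (carrier M) \<union> set xs \<subseteq> p" by blast
      moreover have "qlen ({0\<^sub>M} +\<^sub>S seq_smult xs (carrier M)) (carrier M) < \<infinity>"
        using fin ssum_comm[OF subD(1)[OF sub_zero] seq_smult_carr[OF xc carrier_is_submodule]]
          ssum_zero[OF sub_seq_smult[OF xc carrier_is_submodule]] by simp
      ultimately show "p = \<mm>"
        using parameters_of_finite_length[OF xm sub_zero carrier_is_submodule _ _ p(1)] by simp
    qed
    then show ?thesis using regular_mod_restrict[OF s] by (simp add: filtration_quotient_def)
  qed
  have sum_eq: "(\<Sum>i = 0..t. enat ((n + ?d i) choose ?d i) * filtration_quotient_length R M D (Idl (set xs)) i) =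
      (\<Sum>i = 0..t. enat ((n + ?d i) choose ?d i) * qlen ((if i = 0 then {0\<^sub>M} else D (i - 1)) +\<^sub>S seq_smult xs (D i)) (D i))" for n
    by (intro sum.cong refl arg_cong2[where f = "(*)"] filtration_quotient_length_eq[OF df _ xc]) simp
  have "(\<forall>n::nat. module_length R (quotient_module M (ideal_smult R (Idl (set xs) [^]\<^bsub>ideals_set R\<^esub> (n + 1)) M)) =
      (\<Sum>i = 0..t. enat ((n + ?d i) choose ?d i) * filtration_quotient_length R M D (Idl (set xs)) i)) \<longleftrightarrow>
    (\<forall>k. qlen (seq_power xs (Suc k) (carrier M)) (carrier M) =
      (\<Sum>i = 0..t. enat ((k + ?d i) choose ?d i) * qlen ((if i = 0 then {0\<^sub>M} else D (i - 1)) +\<^sub>S seq_smult xs (D i)) (D i)))"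
    unfolding length_power_quotient[OF xc] sum_eq ..
  also have "\<dots> \<longleftrightarrow> (\<forall>i\<in>{1..t}. regular_mod (D (i - 1)) (D i) (take (?d i) xs))"
    by (rule filtration_formula_iff) (use D filtration_step(1)[OF df] top xm fin d0 d_le kill in auto)
  also have "\<dots> \<longleftrightarrow> (\<forall>i\<in>{1..t}. cohen_macaulay R \<mm> (filtration_quotient M D i))" using cm by blast
  finally show ?thesis .
qed

lemma sequentially_cohen_macaulay_iff:
  assumes df: "dimension_filtration R M t D"
  shows "sequentially_cohen_macaulay R \<mm> M \<longleftrightarrow> (\<forall>i\<in>{1..t}. cohen_macaulay R \<mm> (filtration_quotient M D i))"
proof
  assume "sequentially_cohen_macaulay R \<mm> M"
  then obtain t' D' where df': "dimension_filtration R M t' D'"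
    and cm: "\<forall>i\<in>{1..t'}. cohen_macaulay R \<mm> (filtration_quotient M D' i)"
    by (auto simp: sequentially_cohen_macaulay_def)
  note uniq = filtration_unique[OF df df']
  have "filtration_quotient M D i = filtration_quotient M D' i" if "i \<in> {1..t}" for i
  proof -
    have "i \<le> t" "i - 1 \<le> t" using that by auto
    then show ?thesis using uniq(2) unfolding filtration_quotient_def by metis
  qed
  then show "\<forall>i\<in>{1..t}. cohen_macaulay R \<mm> (filtration_quotient M D i)" using cm uniq(1) by simp
qed (use df in \<open>auto simp: sequentially_cohen_macaulay_def\<close>)

end

theorem theorem4p3:
  fixes R :: "('a, 'r) ring_scheme" and \<mm> :: "'a set"
    and M :: "('a, 'b, 'm) module_scheme"
    and t :: nat and D :: "nat \<Rightarrow> 'b set"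
  assumes "noetherian_local_ring R \<mm>"
    and "fg_module R M"
    and "nonzero_module M"
    and "dimension_filtration R M t D"
  shows "(sequentially_cohen_macaulay R \<mm> M \<longleftrightarrow>
           (\<forall>\<qq>. good_parameter_ideal R \<mm> M \<qq> \<longrightarrow>
             (\<forall>n::nat.
               module_length R
                 (quotient_module M (ideal_smult R (\<qq> [^]\<^bsub>ideals_set R\<^esub> (n + 1)) M)) =
               (\<Sum>i = 0..t.
                 enat ((n + filtration_dim R M D i) choose filtration_dim R M D i) *
                 filtration_quotient_length R M D \<qq> i)))) \<and>
         (sequentially_cohen_macaulay R \<mm> M \<longleftrightarrow>
           (\<exists>\<qq>. good_parameter_ideal R \<mm> M \<qq> \<and>
             (\<forall>n::nat.
               module_length R
                 (quotient_module M (ideal_smult R (\<qq> [^]\<^bsub>ideals_set R\<^esub> (n + 1)) M)) =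
               (\<Sum>i = 0..t.
                 enat ((n + filtration_dim R M D i) choose filtration_dim R M D i) *
                 filtration_quotient_length R M D \<qq> i))))"
proof -
  have l: "noeth_local R \<mm>" using noeth_localI[OF assms(1)] .
  have "noeth_module R M" using noeth_moduleI[OF _ assms(2)] l by (simp add: noeth_local_def)
  moreover have "module R M" using assms(2) by (simp add: fg_module_def)
  ultimately interpret noeth_local_module R M \<mm>
    using l by (intro noeth_local_module.intro local_module.intro)
  let ?F = "\<lambda>\<qq>. \<forall>n::nat. module_length R (quotient_module M (ideal_smult R (\<qq> [^]\<^bsub>ideals_set R\<^esub> (n + 1)) M)) =
    (\<Sum>i = 0..t. enat ((n + filtration_dim R M D i) choose filtration_dim R M D i) * filtration_quotient_length R M D \<qq> i)"
  have "?F \<qq> \<longleftrightarrow> sequentially_cohen_macaulay R \<mm> M" if "good_parameter_ideal R \<mm> M \<qq>" for \<qq>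
  proof -
    obtain xs where xs: "good_system_of_parameters R \<mm> M xs" "\<qq> = Idl\<^bsub>R\<^esub> (set xs)"
      using \<open>good_parameter_ideal R \<mm> M \<qq>\<close> unfolding good_parameter_ideal_def by blast
    show ?thesis
      unfolding xs(2) sequentially_cohen_macaulay_iff[OF assms(4)] by (rule good_system_formula_iff[OF assms(4) xs(1)])
  qed
  \<comment> \<open>Without a good parameter ideal the universal statement would be vacuous and the
    existential one false.\<close>
  moreover have "\<exists>\<qq>. good_parameter_ideal R \<mm> M \<qq>"
    using good_system_exists[OF assms(4)] unfolding good_parameter_ideal_def by blast
  ultimately show ?thesis by blast
qed

end
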